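(* Let $A\in\mathbb{R}^{p\times m}$, $B\in\mathbb{R}^{n\times q}$, $C\in\mathbb{R}^{p\times q}$ be such that $AXB=C$ is consistent, let $G\in\mathbb{R}^{m\times m}$ be symmetric positive definite, and let $(X^k)_{k\ge 0}$ be the random sequence generated by the sketch-and-project iteration $X^{k+1}=X^k-Z_1'(X^k-X^* )Z_2$ from an arbitrary (deterministic) $X^0\in\mathbb{R}^{m\times n}$. Then for every $X^*\in\mathbb{R}^{m\times n}$ satisfying $AX^*B=C$ and every $k\ge 0$, $$\left\|\mathbf{E}\left[X^{k+1}-X^*\right]\right\|_{F(G)}\le\rho^k\,\|X^0-X^*\|_{F(G)},$$ where $\rho=\lambda_{\max}\left(I-\mathbf{E}[Z_2\otimes Z_1']\right)=1-\lambda_{\min}\left(\mathbf{E}[Z_2\otimes Z_1']\right)$.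
   Context: At each iteration, random matrices $S\in\mathbb{R}^{p\times\tau_1}$ and $P\in\mathbb{R}^{q\times\tau_2}$ (whose numbers of columns $\tau_1,\tau_2$ may be random) are drawn from a fixed distribution, independently of the previous iterations (i.i.d. across iterations). With $\dagger$ the Moore-Penrose pseudoinverse, $$Z_1'=G^{-1}A^\top S\,(S^\top AG^{-1}A^\top S)^\dagger S^\top A\in\mathbb{R}^{m\times m},\qquad Z_2=BP\,(P^\top B^\top BP)^\dagger P^\top B^\top\in\mathbb{R}^{n\times n},$$ using the $S,P$ drawn at that iteration. The iteration is $$X^{k+1}=X^k-G^{-1}A^\top S(S^\top AG^{-1}A^\top S)^\dagger S^\top(AX^kB-C)P(P^\top B^\top BP)^\dagger P^\top B^\top,$$ which equals $X^k-Z_1'(X^k-X^* )Z_2$ for any solution $X^*$ of $AX^*B=C$. The norm is $\|X\|_{F(G)}^2=\mathrm{Tr}(X^\top GX)$; $\otimes$ is the Kronecker product; $\lambda_{\min},\lambda_{\max}$ are the smallest and largest eigenvalues ($\mathbf{E}[Z_2\otimes Z_1']$ is similar to a symmetric matrix via conjugation by $I\otimes G^{1/2}$, so its eigenvalues are real). *)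

theory Defs
  imports "HOL-Probability.Probability" "Jordan_Normal_Form.Spectral_Radius"
begin

text \<open>
  All matrices are matrices of Jordan\_Normal\_Form, whose dimensions are not part of the type:
  a sketching matrix has a random number of columns.
\<close>

definition is_pinv :: "real mat \<Rightarrow> real mat \<Rightarrow> bool" where
  "is_pinv M N \<longleftrightarrow>
     N \<in> carrier_mat (dim_col M) (dim_row M) \<and>
     M * N * M = M \<and> N * M * N = N \<and>
     transpose_mat (M * N) = M * N \<and> transpose_mat (N * M) = N * M"

definition pinv :: "real mat \<Rightarrow> real mat" where
  "pinv M = (THE N. is_pinv M N)"

definition mat_inv :: "real mat \<Rightarrow> real mat" where
  "mat_inv M = the (mat_inverse M)"

definition mat_trace :: "real mat \<Rightarrow> real" where
  "mat_trace M = (\<Sum>i<dim_row M. M $$ (i, i))"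

definition kronecker :: "real mat \<Rightarrow> real mat \<Rightarrow> real mat" where
  "kronecker M N = mat (dim_row M * dim_row N) (dim_col M * dim_col N)
     (\<lambda>(i, j). M $$ (i div dim_row N, j div dim_col N) * N $$ (i mod dim_row N, j mod dim_col N))"

definition sym_pos_def :: "nat \<Rightarrow> real mat \<Rightarrow> bool" where
  "sym_pos_def m G \<longleftrightarrow> G \<in> carrier_mat m m \<and> transpose_mat G = G \<and>
     (\<forall>v\<in>carrier_vec m. v \<noteq> 0\<^sub>v m \<longrightarrow> v \<bullet> (G *\<^sub>v v) > 0)"

definition wfrob_norm :: "real mat \<Rightarrow> real mat \<Rightarrow> real" where
  "wfrob_norm G X = sqrt (mat_trace (transpose_mat X * G * X))"

text \<open>
  The spectrum of a real matrix is its set of real eigenvalues. The following two definitions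
  are meaningful for nonempty square matrices all of whose eigenvalues are real.
\<close>

definition lambda_max :: "real mat \<Rightarrow> real" where
  "lambda_max M = Max (spectrum M)"

definition lambda_min :: "real mat \<Rightarrow> real" where
  "lambda_min M = Min (spectrum M)"

definition Z1' :: "real mat \<Rightarrow> real mat \<Rightarrow> real mat \<Rightarrow> real mat" where
  "Z1' A G S = mat_inv G * transpose_mat A * S *
     pinv (transpose_mat S * A * mat_inv G * transpose_mat A * S) * transpose_mat S * A"

definition Z2 :: "real mat \<Rightarrow> real mat \<Rightarrow> real mat" where
  "Z2 B P = B * P * pinv (transpose_mat P * transpose_mat B * B * P) *
     transpose_mat P * transpose_mat B"

definition sketch_step ::
  "real mat \<Rightarrow> real mat \<Rightarrow> real mat \<Rightarrow> real mat \<Rightarrow> real mat \<Rightarrow> real mat \<Rightarrow> real mat \<Rightarrow> real mat" where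
  "sketch_step A B C G S P X = X -
     mat_inv G * transpose_mat A * S *
       pinv (transpose_mat S * A * mat_inv G * transpose_mat A * S) * transpose_mat S *
     (A * X * B - C) *
     P * pinv (transpose_mat P * transpose_mat B * B * P) * transpose_mat P * transpose_mat B"

text \<open>
  The measurable space of real matrices with \<open>r\<close> rows and any number of columns: the disjoint
  union over \<open>c\<close> of the spaces of \<open>r \<times> c\<close> matrices, each with its Borel sets. The cylinder
  sets with \<open>U = UNIV\<close> do not yield the sets of all \<open>r \<times> c\<close> matrices when \<open>r * c = 0\<close>,
  so these are added as generators.
\<close>

definition mat_borel :: "nat \<Rightarrow> real mat measure" where
  "mat_borel r = sigma {M. dim_row M = r}
     ({carrier_mat r c | c. True} \<union>
      {{M \<in> carrier_mat r c. M $$ (i, j) \<in> U} | c i j U. i < r \<and> j < c \<and> open U})"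

text \<open>Entrywise expectation of a random \<open>r \<times> c\<close> matrix.\<close>

definition mat_expectation :: "'w measure \<Rightarrow> nat \<Rightarrow> nat \<Rightarrow> ('w \<Rightarrow> real mat) \<Rightarrow> real mat" where
  "mat_expectation M r c F = mat r c (\<lambda>(i, j). \<integral>\<omega>. F \<omega> $$ (i, j) \<partial>M)"

end

theory Submission
  imports Defs
begin

text \<open>
  Stack the columns of \<open>X\<^sup>k - X\<^sup>*\<close> into a vector. The iteration becomes
  \<open>v\<^sub>k\<^sub>+\<^sub>1 = (I - K\<^sub>k) v\<^sub>k\<close> with independent copies \<open>K\<^sub>k\<close> of \<open>Z\<^sub>2 \<otimes> Z\<^sub>1'\<close>, so that
  \<open>E v\<^sub>k = T\<^sup>k v\<^sub>0\<close> for \<open>T = I - E[Z\<^sub>2 \<otimes> Z\<^sub>1']\<close>. For the inner product given by \<open>H = I \<otimes> G\<close>, in which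
  the norm of \<open>v\<close> is the \<open>F(G)\<close>-norm of the matrix, every \<open>K\<^sub>k\<close> is an orthogonal
  projection; hence \<open>T\<close> is self-adjoint with \<open>0 \<le> T \<le> I\<close>, its largest eigenvalue \<open>\<rho>\<close> is the maximum of
  its Rayleigh quotient, and \<open>T\<close> contracts by \<open>\<rho> \<in> [0, 1]\<close>. Projections have bounded entries, so
  every expectation exists once the pseudoinverse is known to be measurable, and there the
  Tikhonov-regularised inverses, which are rational functions of the sketch, converge to the projection.
\<close>

text \<open>No eigendecomposition and no matrix square root is used. A semidefinite form enters
  through its Cauchy-Schwarz inequality, which also turns the Rayleigh bound into a norm bound; the
  one eigenvalue that matters is found where a shifted form becomes singular. The pseudoinverse
  shapes the rest. It is given by a definite description, so its existence, proved here for
  symmetric matrices, must precede every statement about it. It is also discontinuous where the rank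
  drops, so the projections do not become measurable by continuity; and since the number of columns
  is random, measurability is checked on countably many pieces, one for each number of columns. The
  recursion yields the factor \<open>\<rho>^(k+1)\<close> after \<open>k + 1\<close> steps; the
  stated \<open>\<rho>^k\<close> is weaker because \<open>0 \<le> \<rho> \<le> 1\<close>.\<close>

no_notation inner (infix "\<bullet>" 70)
unbundle no vec_syntax

text \<open>The premises are bare equations between dimensions, which \<open>simp\<close> can
  discharge; carrier premises would leave inner dimensions to be instantiated. Long products are
  reassociated with this rule throughout.\<close>

lemma mult_mat_assoc_dim:
  fixes A B C :: "real mat"
  shows "dim_col A = dim_row B \<Longrightarrow> dim_col B = dim_row C \<Longrightarrow> A * B * C = A * (B * C)"
  by (rule assoc_mult_mat[of _ "dim_row A" "dim_col A" _ "dim_col B" _ "dim_col C"]) auto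

lemma transpose_mult_dim:
  fixes A B :: "real mat"
  shows "dim_col A = dim_row B \<Longrightarrow> transpose_mat (A * B) = transpose_mat B * transpose_mat A"
  by (rule transpose_mult[of _ "dim_row A" "dim_col A" _ "dim_col B"]) auto

lemma mult_mat_vec_assoc_dim:
  fixes A B :: "real mat"
  shows "dim_col A = dim_row B \<Longrightarrow> dim_col B = dim_vec v \<Longrightarrow> A * B *\<^sub>v v = A *\<^sub>v (B *\<^sub>v v)"
  by (rule assoc_mult_mat_vec[of _ "dim_row A" "dim_col A" _ "dim_col B"]) auto

lemma mult_mat_zero_vec:
  assumes "A \<in> carrier_mat r c"
  shows "A *\<^sub>v 0\<^sub>v c = (0\<^sub>v r :: real vec)"
  using assms by (intro eq_vecI) auto

lemma minus_vec_eq_zeroD: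
  assumes "a \<in> carrier_vec n" "b \<in> carrier_vec n" "a - b = (0\<^sub>v n :: real vec)"
  shows "a = b"
proof (rule eq_vecI)
  fix i assume i: "i < dim_vec b"
  then have "a $ i - b $ i = (a - b) $ i" by simp
  also have "\<dots> = 0" using assms i by simp
  finally show "a $ i = b $ i" by simp
qed (use assms in auto)

section \<open>Quadratic forms\<close>

definition psd :: "nat \<Rightarrow> real mat \<Rightarrow> bool" where
  "psd n H \<longleftrightarrow> H \<in> carrier_mat n n \<and> transpose_mat H = H \<and>
     (\<forall>v\<in>carrier_vec n. 0 \<le> v \<bullet> (H *\<^sub>v v))"

lemma psdD:
  assumes "psd n H"
  shows "H \<in> carrier_mat n n" "transpose_mat H = H" "v \<in> carrier_vec n \<Longrightarrow> 0 \<le> v \<bullet> (H *\<^sub>v v)"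
  using assms by (auto simp: psd_def)

lemma sym_pos_defD:
  assumes "sym_pos_def n H"
  shows "H \<in> carrier_mat n n" "transpose_mat H = H"
    "v \<in> carrier_vec n \<Longrightarrow> v \<noteq> 0\<^sub>v n \<Longrightarrow> 0 < v \<bullet> (H *\<^sub>v v)"
  using assms by (auto simp: sym_pos_def_def)

lemma sym_pos_def_psd:
  assumes "sym_pos_def n H"
  shows "psd n H"
  unfolding psd_def
proof (intro conjI ballI)
  note H = sym_pos_defD[OF assms]
  show "H \<in> carrier_mat n n" "transpose_mat H = H" using H by auto
  fix v :: "real vec" assume v: "v \<in> carrier_vec n"
  show "0 \<le> v \<bullet> (H *\<^sub>v v)"
  proof (cases "v = 0\<^sub>v n")
    case True
    then show ?thesis using H(1) by simp
  next
    case False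
    then show ?thesis using H(3)[OF v] by simp
  qed
qed

lemma scalar_prod_self_nonneg: "0 \<le> v \<bullet> (v :: real vec)"
  unfolding scalar_prod_def by (rule sum_nonneg) simp

lemma scalar_prod_mult_mat_vec:
  assumes "A \<in> carrier_mat r c" "x \<in> carrier_vec r" "y \<in> carrier_vec c"
  shows "x \<bullet> (A *\<^sub>v y) = (transpose_mat A *\<^sub>v x) \<bullet> (y :: real vec)"
  using transpose_vec_mult_scalar[OF assms(1,3,2)] by simp

lemma symmetric_form_commute:
  assumes "H \<in> carrier_mat n n" "transpose_mat H = H" "v \<in> carrier_vec n" "w \<in> carrier_vec n"
  shows "v \<bullet> (H *\<^sub>v w) = w \<bullet> (H *\<^sub>v (v :: real vec))"
  using scalar_prod_mult_mat_vec[OF assms(1,3,4)] assms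
  by (simp add: comm_scalar_prod[of _ n])

text \<open>Evaluate the polynomial at its minimiser \<open>-b / c\<close>; in the affine case only
  a constant one stays nonnegative.\<close>

lemma quadratic_nonneg_discriminant:
  fixes a b c :: real
  assumes "\<And>t. 0 \<le> a + 2 * b * t + c * t\<^sup>2" and c: "0 \<le> c"
  shows "b\<^sup>2 \<le> a * c"
proof (cases "c = 0")
  case True
  have "b = 0"
  proof (rule ccontr)
    assume "b \<noteq> 0"
    \<comment> \<open>Chosen so that the affine polynomial takes the value -1.\<close>
    then show False using assms(1)[of "-(a + 1) / (2 * b)"] True by simp
  qed
  then show ?thesis using True by simp
next
  case False
  have "0 \<le> a + 2 * b * (-b / c) + c * (-b / c)\<^sup>2" by (rule assms)
  then show ?thesis using False c by (simp add: field_simps power2_eq_square)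
qed

text \<open>The form is nonnegative along the line \<open>x + t y\<close>, a quadratic polynomial in
  \<open>t\<close>. Arguing by its discriminant avoids dividing by
  \<open>y \<bullet> (H *\<^sub>v y)\<close>, which may vanish for a semidefinite form.\<close>

lemma psd_Cauchy_Schwarz:
  assumes H: "psd n H" and x: "x \<in> carrier_vec n" and y: "y \<in> carrier_vec n"
  shows "(x \<bullet> (H *\<^sub>v y))\<^sup>2 \<le> (x \<bullet> (H *\<^sub>v x)) * (y \<bullet> (H *\<^sub>v y))"
proof (rule quadratic_nonneg_discriminant)
  fix t
  note Hc = psdD(1)[OF H]
  have "0 \<le> (x + t \<cdot>\<^sub>v y) \<bullet> (H *\<^sub>v (x + t \<cdot>\<^sub>v y))"
    by (rule psdD(3)[OF H]) (use x y in auto)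
  also have "\<dots> = x \<bullet> (H *\<^sub>v x) + t * (x \<bullet> (H *\<^sub>v y)) + (t * (y \<bullet> (H *\<^sub>v x)) + t * (t * (y \<bullet> (H *\<^sub>v y))))"
    using Hc x y
    by (simp add: mult_add_distrib_mat_vec[of _ n n] mult_mat_vec[of _ n n]
        add_scalar_prod_distrib[of _ n] scalar_prod_add_distrib[of _ n] algebra_simps)
  also have "y \<bullet> (H *\<^sub>v x) = x \<bullet> (H *\<^sub>v y)"
    by (rule symmetric_form_commute[OF Hc psdD(2)[OF H] y x])
  finally show "0 \<le> x \<bullet> (H *\<^sub>v x) + 2 * (x \<bullet> (H *\<^sub>v y)) * t + y \<bullet> (H *\<^sub>v y) * t\<^sup>2"
    by (simp add: power2_eq_square algebra_simps)
qed (rule psdD(3)[OF H y])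

lemma scalar_prod_self_eq_0:
  assumes "v \<in> carrier_vec n" "v \<bullet> v = (0 :: real)"
  shows "v = 0\<^sub>v n"
proof (rule eq_vecI)
  fix i assume "i < dim_vec (0\<^sub>v n :: real vec)"
  then have i: "i < dim_vec v" using assms by auto
  have "\<forall>i\<in>{0..<dim_vec v}. v $ i * v $ i = 0"
    using assms(2) unfolding scalar_prod_def by (subst (asm) sum_nonneg_eq_0_iff) auto
  then show "v $ i = 0\<^sub>v n $ i" using i assms(1) by auto
qed (use assms in auto)

text \<open>Cauchy-Schwarz for \<open>x\<close> and \<open>H x\<close>: by symmetry the mixed term
  is the squared Euclidean length of \<open>H x\<close>, and the factor belonging to
  \<open>x\<close> is zero.\<close>

lemma psd_kernel:
  assumes H: "psd n H" and x: "x \<in> carrier_vec n" and 0: "x \<bullet> (H *\<^sub>v x) = 0"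
  shows "H *\<^sub>v x = 0\<^sub>v n"
proof -
  have Hx: "H *\<^sub>v x \<in> carrier_vec n" using psdD(1)[OF H] x by (rule mult_mat_vec_carrier)
  have "(H *\<^sub>v x) \<bullet> (H *\<^sub>v x) = x \<bullet> (H *\<^sub>v (H *\<^sub>v x))"
    using symmetric_form_commute[OF psdD(1,2)[OF H] Hx x] .
  moreover have "(x \<bullet> (H *\<^sub>v (H *\<^sub>v x)))\<^sup>2 \<le> 0"
    using psd_Cauchy_Schwarz[OF H x Hx] 0 by simp
  ultimately show ?thesis using scalar_prod_self_eq_0[OF Hx] by simp
qed

section \<open>Nonsingular matrices and their inverses\<close>

lemma det_nonzero_if_injective:
  assumes H: "H \<in> carrier_mat n n"
    and inj: "\<And>v. v \<in> carrier_vec n \<Longrightarrow> H *\<^sub>v v = 0\<^sub>v n \<Longrightarrow> v = 0\<^sub>v n"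
  shows "det H \<noteq> (0 :: real)"
  using det_0_iff_vec_prod_zero[OF H] inj by auto

text \<open>Cramer's rule. The entries are rational in the entries of \<open>H\<close>, so
  measurability can be read off, which the elimination behind \<open>mat_inverse\<close> does not
  offer. At a singular \<open>H\<close> the value is the zero matrix.\<close>

definition det_inv :: "real mat \<Rightarrow> real mat" where
  "det_inv H = (1 / det H) \<cdot>\<^sub>m adj_mat H"

lemma det_inv:
  assumes H: "H \<in> carrier_mat n n" and d: "det H \<noteq> 0"
  shows "det_inv H \<in> carrier_mat n n" "H * det_inv H = 1\<^sub>m n" "det_inv H * H = 1\<^sub>m n"
proof -
  note a = adj_mat[OF H]
  show "det_inv H \<in> carrier_mat n n" using a by (auto simp: det_inv_def)
  have "H * det_inv H = (1 / det H) \<cdot>\<^sub>m (H * adj_mat H)"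
    unfolding det_inv_def by (rule mult_smult_distrib[OF H a(1)])
  also have "\<dots> = 1\<^sub>m n" unfolding a(2) using d by (intro eq_matI) auto
  finally show "H * det_inv H = 1\<^sub>m n" .
  have "det_inv H * H = (1 / det H) \<cdot>\<^sub>m (adj_mat H * H)"
    unfolding det_inv_def by (rule mult_smult_assoc_mat[OF a(1) H])
  also have "\<dots> = 1\<^sub>m n" unfolding a(3) using d by (intro eq_matI) auto
  finally show "det_inv H * H = 1\<^sub>m n" .
qed

text \<open>\<open>mat_inverse\<close> returns \<open>None\<close> only for a matrix that is not a
  unit of the matrix ring, and \<open>det_inv\<close> exhibits an inverse there.\<close>

lemma mat_inv:
  assumes H: "H \<in> carrier_mat n n" and d: "det H \<noteq> 0"
  shows "mat_inv H \<in> carrier_mat n n" "H * mat_inv H = 1\<^sub>m n" "mat_inv H * H = 1\<^sub>m n"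
proof -
  have "H \<in> Units (ring_mat TYPE(real) n undefined)"
    unfolding Units_def using det_inv[OF H d] H by (auto simp: ring_mat_def)
  then obtain B where "mat_inverse H = Some B"
    using mat_inverse(1)[OF H, where b = undefined] by (cases "mat_inverse H") auto
  with mat_inverse(2)[OF H this]
  show "mat_inv H \<in> carrier_mat n n" "H * mat_inv H = 1\<^sub>m n" "mat_inv H * H = 1\<^sub>m n"
    by (auto simp: mat_inv_def)
qed

lemma inverse_unique:
  fixes H :: "real mat"
  assumes "H \<in> carrier_mat n n" "B \<in> carrier_mat n n" "C \<in> carrier_mat n n"
    "B * H = 1\<^sub>m n" "H * C = 1\<^sub>m n"
  shows "B = C"
proof -
  have "B = B * (H * C)" using assms by simp
  also have "\<dots> = (B * H) * C" using assms(1-3) by simp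
  also have "\<dots> = C" unfolding assms(4) using assms by simp
  finally show ?thesis .
qed

lemma symmetric_inverse:
  fixes H :: "real mat"
  assumes H: "H \<in> carrier_mat n n" "transpose_mat H = H" and B: "B \<in> carrier_mat n n"
    "H * B = 1\<^sub>m n" "B * H = 1\<^sub>m n"
  shows "transpose_mat B = B"
proof (rule inverse_unique[OF H(1)])
  have "transpose_mat (H * B) = transpose_mat B * transpose_mat H"
    by (rule transpose_mult[OF H(1) B(1)])
  then show "transpose_mat B * H = 1\<^sub>m n" using B(2) H(2) by simp
qed (use B in auto)

lemma sym_pos_def_det:
  assumes "sym_pos_def n H"
  shows "det H \<noteq> 0"
proof (rule det_nonzero_if_injective[OF sym_pos_defD(1)[OF assms]])
  fix v assume v: "v \<in> carrier_vec n" "H *\<^sub>v v = 0\<^sub>v n"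
  then show "v = 0\<^sub>v n" using sym_pos_defD(3)[OF assms v(1)] by auto
qed

text \<open>With \<open>w = B v\<close> one has \<open>H w = v\<close>, so the form of
  \<open>B\<close> at \<open>v\<close> is the form of \<open>H\<close> at \<open>w\<close>.\<close>

lemma sym_pos_def_inverse:
  assumes H: "sym_pos_def n H" and B: "B \<in> carrier_mat n n" "H * B = 1\<^sub>m n" "B * H = 1\<^sub>m n"
  shows "sym_pos_def n B"
  unfolding sym_pos_def_def
proof (intro conjI ballI impI)
  note Hc = sym_pos_defD[OF H]
  show "B \<in> carrier_mat n n" by (rule B)
  show "transpose_mat B = B" by (rule symmetric_inverse[OF Hc(1,2) B])
  fix v :: "real vec" assume v: "v \<in> carrier_vec n" "v \<noteq> 0\<^sub>v n"
  define w where "w = B *\<^sub>v v"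
  have w: "w \<in> carrier_vec n" unfolding w_def using B(1) v(1) by (rule mult_mat_vec_carrier)
  have "H *\<^sub>v w = (H * B) *\<^sub>v v" unfolding w_def using Hc(1) B(1) v by simp
  then have Hw: "H *\<^sub>v w = v" using B(2) v by simp
  have "w \<noteq> 0\<^sub>v n"
  proof
    assume "w = 0\<^sub>v n"
    then show False using Hw mult_mat_zero_vec[OF Hc(1)] v(2) by simp
  qed
  from Hc(3)[OF w this] show "0 < v \<bullet> (B *\<^sub>v v)"
    unfolding Hw w_def[symmetric] using comm_scalar_prod[OF w v(1)] by simp
qed

text \<open>Cauchy--Schwarz for the form, applied to \<open>v\<close> and \<open>H\<^sup>-\<^sup>1 e\<^sub>i\<close>.\<close>

lemma sym_pos_def_index_bound:
  assumes H: "sym_pos_def n H" and B: "B \<in> carrier_mat n n" "H * B = 1\<^sub>m n" "B * H = 1\<^sub>m n"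
    and v: "v \<in> carrier_vec n" and i: "i < n"
  shows "(v $ i)\<^sup>2 \<le> B $$ (i, i) * (v \<bullet> (H *\<^sub>v v))"
proof -
  note Hc = sym_pos_defD[OF H]
  define w where "w = B *\<^sub>v unit_vec n i"
  have w: "w \<in> carrier_vec n" using B unfolding w_def by auto
  have "H *\<^sub>v w = (H * B) *\<^sub>v unit_vec n i" unfolding w_def using Hc(1) B(1) by simp
  then have Hw: "H *\<^sub>v w = unit_vec n i" using B(2) by simp
  have "v \<bullet> (H *\<^sub>v w) = v $ i" unfolding Hw using v i by simp
  moreover have "w \<bullet> (H *\<^sub>v w) = B $$ (i, i)"
    unfolding Hw using w i B(1) by (simp add: w_def)
  ultimately show ?thesis
    using psd_Cauchy_Schwarz[OF sym_pos_def_psd[OF H] v w] by (simp add: mult.commute)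
qed

text \<open>Summing the coordinate bounds gives the trace of the inverse as a constant, without
  compactness of the sphere. Passing to \<open>\<bar>K\<bar> + 1\<close> secures positivity, also
  for \<open>n = 0\<close>.\<close>

lemma sym_pos_def_coercive:
  assumes H: "sym_pos_def n H"
  obtains K where "K > 0" "\<And>v. v \<in> carrier_vec n \<Longrightarrow> v \<bullet> v \<le> K * (v \<bullet> (H *\<^sub>v v))"
proof -
  note Hc = sym_pos_defD[OF H]
  note B = mat_inv[OF Hc(1) sym_pos_def_det[OF H]]
  define K where "K = (\<Sum>i<n. mat_inv H $$ (i, i))"
  have "v \<bullet> v \<le> (\<bar>K\<bar> + 1) * (v \<bullet> (H *\<^sub>v v))" if v: "v \<in> carrier_vec n" for v
  proof -
    have "v \<bullet> v = (\<Sum>i<n. (v $ i)\<^sup>2)"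
      using v unfolding scalar_prod_def by (auto simp: power2_eq_square lessThan_atLeast0 intro!: sum.cong)
    also have "\<dots> \<le> (\<Sum>i<n. mat_inv H $$ (i, i) * (v \<bullet> (H *\<^sub>v v)))"
      by (rule sum_mono) (use sym_pos_def_index_bound[OF H B v] in auto)
    also have "\<dots> = K * (v \<bullet> (H *\<^sub>v v))" by (simp add: K_def sum_distrib_right)
    also have "\<dots> \<le> (\<bar>K\<bar> + 1) * (v \<bullet> (H *\<^sub>v v))"
      by (rule mult_right_mono) (use psdD(3)[OF sym_pos_def_psd[OF H] v] in auto)
    finally show ?thesis .
  qed
  then show ?thesis by (intro that[of "\<bar>K\<bar> + 1"]) auto
qed

section \<open>Rayleigh quotients\<close>

lemma quadratic_form_sum:
  fixes A :: "real mat"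
  assumes "A \<in> carrier_mat n n" "v \<in> carrier_vec n"
  shows "v \<bullet> (A *\<^sub>v v) = (\<Sum>i<n. \<Sum>j<n. v $ i * A $$ (i, j) * v $ j)"
  using assms unfolding scalar_prod_def
  by (auto simp: scalar_prod_def lessThan_atLeast0 sum_distrib_left mult.assoc intro!: sum.cong)

text \<open>A crude constant, the sum of the absolute values of all entries, is enough: it only
  feeds the choice of \<open>\<delta>\<close> in \<open>lambda_max_Rayleigh\<close>.\<close>

lemma quadratic_form_le:
  fixes A :: "real mat"
  assumes A: "A \<in> carrier_mat n n"
  obtains K where "K \<ge> 0" "\<And>v. v \<in> carrier_vec n \<Longrightarrow> v \<bullet> (A *\<^sub>v v) \<le> K * (v \<bullet> v)"
proof -
  define K where "K = (\<Sum>i<n. \<Sum>j<n. \<bar>A $$ (i, j)\<bar>)"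
  have "v \<bullet> (A *\<^sub>v v) \<le> K * (v \<bullet> v)" if v: "v \<in> carrier_vec n" for v
  proof -
    have vv: "v \<bullet> v = (\<Sum>i<n. (v $ i)\<^sup>2)"
      using v unfolding scalar_prod_def
      by (auto simp: power2_eq_square lessThan_atLeast0 intro!: sum.cong)
    have le: "(v $ i)\<^sup>2 \<le> v \<bullet> v" if "i < n" for i
      unfolding vv using that by (intro member_le_sum) auto
    have "v \<bullet> (A *\<^sub>v v) = (\<Sum>i<n. \<Sum>j<n. v $ i * A $$ (i, j) * v $ j)"
      by (rule quadratic_form_sum[OF A v])
    also have "\<dots> \<le> (\<Sum>i<n. \<Sum>j<n. \<bar>A $$ (i, j)\<bar> * (v \<bullet> v))"
    proof (intro sum_mono)
      fix i j assume "i \<in> {..<n}" "j \<in> {..<n}"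
      then have ij: "i < n" "j < n" by auto
      have "\<bar>v $ i * v $ j\<bar> \<le> v \<bullet> v"
      proof -
        have "0 \<le> (\<bar>v $ i\<bar> - \<bar>v $ j\<bar>)\<^sup>2" by simp
        then have "2 * (\<bar>v $ i\<bar> * \<bar>v $ j\<bar>) \<le> (v $ i)\<^sup>2 + (v $ j)\<^sup>2"
          by (simp add: power2_diff)
        then show ?thesis using le[OF ij(1)] le[OF ij(2)] by (simp add: abs_mult)
      qed
      then have "\<bar>A $$ (i, j)\<bar> * \<bar>v $ i * v $ j\<bar> \<le> \<bar>A $$ (i, j)\<bar> * (v \<bullet> v)"
        by (intro mult_left_mono) auto
      moreover have "v $ i * A $$ (i, j) * v $ j \<le> \<bar>v $ i * A $$ (i, j) * v $ j\<bar>" by simp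
      ultimately show "v $ i * A $$ (i, j) * v $ j \<le> \<bar>A $$ (i, j)\<bar> * (v \<bullet> v)"
        by (simp add: abs_mult mult_ac)
    qed
    also have "\<dots> = K * (v \<bullet> v)" by (simp add: K_def sum_distrib_right)
    finally show ?thesis .
  qed
  moreover have "K \<ge> 0" unfolding K_def by (intro sum_nonneg) auto
  ultimately show ?thesis by (intro that[of K]) auto
qed

lemma spectrum_iff:
  fixes T :: "real mat"
  assumes "T \<in> carrier_mat n n"
  shows "k \<in> spectrum T \<longleftrightarrow> (\<exists>v\<in>carrier_vec n. v \<noteq> 0\<^sub>v n \<and> T *\<^sub>v v = k \<cdot>\<^sub>v v)"
  using assms by (auto simp: spectrum_def eigenvalue_def eigenvector_def)

text \<open>If the supremum \<open>t\<close> of the Rayleigh quotient were not attained, \<open>t H - H T\<close> would be a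
  nonsingular positive semidefinite form, hence coercive, and \<open>t\<close> could be decreased.\<close>

lemma lambda_max_Rayleigh:
  assumes H: "sym_pos_def n H" and T: "T \<in> carrier_mat n n"
    and HT_sym: "transpose_mat (H * T) = H * T" and n: "n > 0"
    and le1: "\<And>v. v \<in> carrier_vec n \<Longrightarrow> v \<bullet> (H * T *\<^sub>v v) \<le> v \<bullet> (H *\<^sub>v v)"
  shows "lambda_max T \<in> spectrum T"
    and "v \<in> carrier_vec n \<Longrightarrow> v \<bullet> (H * T *\<^sub>v v) \<le> lambda_max T * (v \<bullet> (H *\<^sub>v v))"
proof -
  note Hc = sym_pos_defD[OF H]
  have HT: "H * T \<in> carrier_mat n n" using Hc(1) T by simp
  define f :: "real vec \<Rightarrow> real" where "f v = (v \<bullet> (H * T *\<^sub>v v)) / (v \<bullet> (H *\<^sub>v v))" for v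
  define V :: "real vec set" where "V = {v \<in> carrier_vec n. v \<noteq> 0\<^sub>v n}"
  define t where "t = Sup (f ` V)"
  have pos: "0 < v \<bullet> (H *\<^sub>v v)" if "v \<in> V" for v using Hc(3) that by (auto simp: V_def)
  have "unit_vec n 0 \<in> V" using n by (auto simp: V_def)
  then have ne: "f ` V \<noteq> {}" by blast
  \<comment> \<open>\<open>le1\<close> makes the supremum finite.\<close>
  have bdd: "bdd_above (f ` V)"
  proof (rule bdd_aboveI2)
    fix v assume v: "v \<in> V"
    then show "f v \<le> 1" using pos[OF v] le1[of v] by (auto simp: f_def V_def)
  qed
  have le_t: "v \<bullet> (H * T *\<^sub>v v) \<le> t * (v \<bullet> (H *\<^sub>v v))" if v: "v \<in> carrier_vec n" for v
  proof (cases "v = 0\<^sub>v n")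
    case True
    then show ?thesis by (simp add: mult_mat_zero_vec[OF HT] mult_mat_zero_vec[OF Hc(1)])
  next
    case False
    with v have "v \<in> V" by (simp add: V_def)
    then have "f v \<le> t" unfolding t_def by (intro cSup_upper bdd imageI)
    then show ?thesis using pos[OF \<open>v \<in> V\<close>] by (simp add: f_def field_simps)
  qed
  define Q where "Q = t \<cdot>\<^sub>m H - H * T"
  have Q: "Q \<in> carrier_mat n n" unfolding Q_def using HT by (rule minus_carrier_mat)
  have Qv: "Q *\<^sub>v v = t \<cdot>\<^sub>v (H *\<^sub>v v) - H * T *\<^sub>v v" if "v \<in> carrier_vec n" for v
  proof -
    have "Q *\<^sub>v v = (t \<cdot>\<^sub>m H) *\<^sub>v v - H * T *\<^sub>v v"
      unfolding Q_def by (rule minus_mult_distrib_mat_vec) (use Hc(1) HT that in auto)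
    also have "(t \<cdot>\<^sub>m H) *\<^sub>v v = t \<cdot>\<^sub>v (H *\<^sub>v v)"
      using Hc(1) that by (intro eq_vecI) (auto simp: smult_scalar_prod_distrib[of _ n])
    finally show ?thesis .
  qed
  have vQv: "v \<bullet> (Q *\<^sub>v v) = t * (v \<bullet> (H *\<^sub>v v)) - v \<bullet> (H * T *\<^sub>v v)"
    if v: "v \<in> carrier_vec n" for v :: "real vec"
  proof -
    have "H *\<^sub>v v \<in> carrier_vec n" "H * T *\<^sub>v v \<in> carrier_vec n"
      using Hc(1) HT v by (auto intro: mult_mat_vec_carrier)
    then show ?thesis unfolding Qv[OF v] using v by (simp add: scalar_prod_minus_distrib[of _ n])
  qed
  have Qpsd: "psd n Q"
    unfolding psd_def
  proof (intro conjI ballI)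
    have "transpose_mat Q = transpose_mat (t \<cdot>\<^sub>m H) - transpose_mat (H * T)"
      unfolding Q_def by (rule transpose_minus) (use Hc(1) HT in auto)
    also have "transpose_mat (t \<cdot>\<^sub>m H) = t \<cdot>\<^sub>m transpose_mat H" by (intro eq_matI) auto
    finally show "transpose_mat Q = Q" by (simp only: Hc(2) HT_sym Q_def)
  qed (use Q vQv le_t in auto)
  have dQ: "det Q = 0"
  proof (rule ccontr)
    assume d: "det Q \<noteq> 0"
    have "sym_pos_def n Q"
      unfolding sym_pos_def_def
    proof (intro conjI ballI impI)
      fix v :: "real vec" assume v: "v \<in> carrier_vec n" "v \<noteq> 0\<^sub>v n"
      have "v \<bullet> (Q *\<^sub>v v) \<noteq> 0"
        using psd_kernel[OF Qpsd v(1)] det_0_iff_vec_prod_zero[OF Q] d v by auto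
      then show "0 < v \<bullet> (Q *\<^sub>v v)" using psdD(3)[OF Qpsd v(1)] by simp
    qed (use psdD[OF Qpsd] in auto)
    then obtain K where K: "K > 0" "\<And>v. v \<in> carrier_vec n \<Longrightarrow> v \<bullet> v \<le> K * (v \<bullet> (Q *\<^sub>v v))"
      using sym_pos_def_coercive by blast
    obtain L where L: "L \<ge> 0" "\<And>v. v \<in> carrier_vec n \<Longrightarrow> v \<bullet> (H *\<^sub>v v) \<le> L * (v \<bullet> v)"
      using quadratic_form_le[OF Hc(1)] by blast
    \<comment> \<open>\<open>H\<close> is at most \<open>L\<close> times the Euclidean form, which
      is at most \<open>K\<close> times the form of \<open>Q\<close>; hence
      \<open>\<delta> H\<close> lies below \<open>Q\<close>, and \<open>t - \<delta>\<close> still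
      bounds every quotient. \<open>L + 1\<close> keeps the denominator positive when
      \<open>L = 0\<close>.\<close>
    define \<delta> where "\<delta> = 1 / ((L + 1) * K)"
    have \<delta>: "\<delta> > 0" using K(1) L(1) by (simp add: \<delta>_def)
    have "f v \<le> t - \<delta>" if v: "v \<in> V" for v
    proof -
      have v': "v \<in> carrier_vec n" using v by (simp add: V_def)
      have Q0: "0 \<le> v \<bullet> (Q *\<^sub>v v)" using psdD(3)[OF Qpsd v'] .
      have "v \<bullet> (H *\<^sub>v v) \<le> L * (K * (v \<bullet> (Q *\<^sub>v v)))"
        using L(2)[OF v'] mult_left_mono[OF K(2)[OF v'] L(1)] by linarith
      also have "\<dots> \<le> (L + 1) * K * (v \<bullet> (Q *\<^sub>v v))"
        using K(1) Q0 by (simp add: algebra_simps)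
      finally have "\<delta> * (v \<bullet> (H *\<^sub>v v)) \<le> v \<bullet> (Q *\<^sub>v v)"
        using K(1) L(1) by (simp add: \<delta>_def pos_divide_le_eq mult.commute)
      then have "v \<bullet> (H * T *\<^sub>v v) \<le> (t - \<delta>) * (v \<bullet> (H *\<^sub>v v))"
        unfolding vQv[OF v'] by (simp add: algebra_simps)
      then show ?thesis using pos[OF v] by (simp add: f_def field_simps)
    qed
    then have "t \<le> t - \<delta>" unfolding t_def by (intro cSup_least[OF ne]) auto
    then show False using \<delta> by simp
  qed
  have t_eig: "t \<in> spectrum T"
  proof -
    \<comment> \<open>A null vector of \<open>Q\<close> satisfies \<open>t H v = H T v\<close>;
      cancelling \<open>H\<close> makes it an eigenvector of \<open>T\<close>.\<close>
    obtain v where v: "v \<in> carrier_vec n" "v \<noteq> 0\<^sub>v n" "Q *\<^sub>v v = 0\<^sub>v n"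
      using dQ det_0_iff_vec_prod_zero[OF Q] by auto
    show ?thesis
      unfolding spectrum_iff[OF T]
    proof (intro bexI conjI)
      note B = mat_inv[OF Hc(1) sym_pos_def_det[OF H]]
      have Hv: "H *\<^sub>v v \<in> carrier_vec n" "H * T *\<^sub>v v \<in> carrier_vec n" "T *\<^sub>v v \<in> carrier_vec n"
        using Hc(1) HT T v by (auto intro: mult_mat_vec_carrier)
      have "t \<cdot>\<^sub>v (H *\<^sub>v v) - H * T *\<^sub>v v = 0\<^sub>v n" using Qv[OF v(1)] v(3) by simp
      then have "t \<cdot>\<^sub>v (H *\<^sub>v v) = H * T *\<^sub>v v"
        by (rule minus_vec_eq_zeroD[OF _ Hv(2), rotated]) (simp only: smult_carrier_vec Hv(1))
      then have e: "H *\<^sub>v (T *\<^sub>v v) = t \<cdot>\<^sub>v (H *\<^sub>v v)"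
        unfolding assoc_mult_mat_vec[OF Hc(1) T v(1)] by (rule sym)
      have cancel: "mat_inv H *\<^sub>v (H *\<^sub>v u) = u" if u: "u \<in> carrier_vec n" for u
        unfolding assoc_mult_mat_vec[OF B(1) Hc(1) u, symmetric] B(3) using u by simp
      have "T *\<^sub>v v = mat_inv H *\<^sub>v (t \<cdot>\<^sub>v (H *\<^sub>v v))"
        unfolding e[symmetric] cancel[OF Hv(3)] ..
      then show "T *\<^sub>v v = t \<cdot>\<^sub>v v"
        unfolding mult_mat_vec[OF B(1) Hv(1)] cancel[OF v(1)] .
    qed (use v in auto)
  qed
  \<comment> \<open>An eigenvalue is the Rayleigh quotient of its eigenvector.\<close>
  have "k \<le> t" if k: "k \<in> spectrum T" for k
  proof -
    obtain w where w: "w \<in> carrier_vec n" "w \<noteq> 0\<^sub>v n" "T *\<^sub>v w = k \<cdot>\<^sub>v w"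
      using k unfolding spectrum_iff[OF T] by auto
    have "H * T *\<^sub>v w = H *\<^sub>v (k \<cdot>\<^sub>v w)" using Hc(1) T w by simp
    also have "\<dots> = k \<cdot>\<^sub>v (H *\<^sub>v w)" by (rule mult_mat_vec[OF Hc(1) w(1)])
    finally have "w \<bullet> (H * T *\<^sub>v w) = k * (w \<bullet> (H *\<^sub>v w))" using Hc(1) w(1) by simp
    then show ?thesis using le_t[OF w(1)] Hc(3)[OF w(1,2)] by simp
  qed
  then have "lambda_max T = t"
    unfolding lambda_max_def using card_finite_spectrum[OF T] t_eig by (intro Max_eqI) auto
  then show "lambda_max T \<in> spectrum T"
    "v \<in> carrier_vec n \<Longrightarrow> v \<bullet> (H * T *\<^sub>v v) \<le> lambda_max T * (v \<bullet> (H *\<^sub>v v))"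
    using t_eig le_t by auto
qed

text \<open>Let \<open>a\<close> and \<open>b\<close> be the squared \<open>H\<close>-norms of
  \<open>u = T v\<close> and \<open>v\<close>. Since \<open>a\<close> is the
  \<open>H T\<close>-product of \<open>u\<close> and \<open>v\<close>, Cauchy-Schwarz for the form
  of \<open>H T\<close> and the Rayleigh bound on both factors give
  \<open>a^2 \<le> \<rho> a * \<rho> b\<close>; dividing by \<open>a\<close> leaves the claim. The
  bounds 0 and 1 are read off at an eigenvector for \<open>\<rho>\<close>.\<close>

lemma lambda_max_contraction:
  assumes H: "sym_pos_def n H" and T: "T \<in> carrier_mat n n"
    and psd: "psd n (H * T)" and n: "n > 0"
    and le1: "\<And>v. v \<in> carrier_vec n \<Longrightarrow> v \<bullet> (H * T *\<^sub>v v) \<le> v \<bullet> (H *\<^sub>v v)"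
  shows "0 \<le> lambda_max T" "lambda_max T \<le> 1"
    "v \<in> carrier_vec n \<Longrightarrow>
      (T *\<^sub>v v) \<bullet> (H *\<^sub>v (T *\<^sub>v v)) \<le> (lambda_max T)\<^sup>2 * (v \<bullet> (H *\<^sub>v v))"
proof -
  note Hc = sym_pos_defD[OF H]
  have R1: "lambda_max T \<in> spectrum T"
    by (rule lambda_max_Rayleigh(1)[OF H T psdD(2)[OF psd] n]) (rule le1)
  have R2: "u \<bullet> (H * T *\<^sub>v u) \<le> lambda_max T * (u \<bullet> (H *\<^sub>v u))"
    if "u \<in> carrier_vec n" for u
    by (rule lambda_max_Rayleigh(2)[OF H T psdD(2)[OF psd] n _ that]) (rule le1)
  define \<rho> where "\<rho> = lambda_max T"
  obtain w where w: "w \<in> carrier_vec n" "w \<noteq> 0\<^sub>v n" "T *\<^sub>v w = \<rho> \<cdot>\<^sub>v w"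
    using R1 unfolding spectrum_iff[OF T] \<rho>_def by auto
  have "H * T *\<^sub>v w = H *\<^sub>v (\<rho> \<cdot>\<^sub>v w)" using Hc(1) T w by simp
  also have "\<dots> = \<rho> \<cdot>\<^sub>v (H *\<^sub>v w)" by (rule mult_mat_vec[OF Hc(1) w(1)])
  finally have e: "w \<bullet> (H * T *\<^sub>v w) = \<rho> * (w \<bullet> (H *\<^sub>v w))" using Hc(1) w(1) by simp
  have wp: "0 < w \<bullet> (H *\<^sub>v w)" using Hc(3)[OF w(1,2)] .
  have \<rho>0: "0 \<le> \<rho>" using psdD(3)[OF psd w(1)] wp unfolding e by (simp add: zero_le_mult_iff)
  then show "0 \<le> lambda_max T" by (simp add: \<rho>_def)
  show "lambda_max T \<le> 1" using le1[OF w(1)] wp unfolding e by (simp add: \<rho>_def)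
  assume v: "v \<in> carrier_vec n"
  define u where "u = T *\<^sub>v v"
  have u: "u \<in> carrier_vec n" unfolding u_def using T v by (rule mult_mat_vec_carrier)
  define a where "a = u \<bullet> (H *\<^sub>v u)"
  define b where "b = v \<bullet> (H *\<^sub>v v)"
  have a0: "0 \<le> a" "0 \<le> b" unfolding a_def b_def using psdD(3)[OF sym_pos_def_psd[OF H]] u v by auto
  have "H * T *\<^sub>v v = H *\<^sub>v u" using Hc(1) T v by (simp add: u_def)
  then have "a\<^sup>2 \<le> (u \<bullet> (H * T *\<^sub>v u)) * (v \<bullet> (H * T *\<^sub>v v))"
    using psd_Cauchy_Schwarz[OF psd u v] by (simp add: a_def)
  also have "\<dots> \<le> (\<rho> * a) * (\<rho> * b)"
    unfolding a_def b_def \<rho>_def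
    by (rule mult_mono[OF R2[OF u] R2[OF v]])
      (use psdD(3)[OF psd v] \<rho>0 a0 in \<open>auto simp: a_def \<rho>_def\<close>)
  finally have "a * a \<le> a * (\<rho>\<^sup>2 * b)" by (simp add: power2_eq_square mult_ac)
  then have "a \<le> \<rho>\<^sup>2 * b"
    using a0 by (cases "a = 0") auto
  then show "(T *\<^sub>v v) \<bullet> (H *\<^sub>v (T *\<^sub>v v)) \<le> (lambda_max T)\<^sup>2 * (v \<bullet> (H *\<^sub>v v))"
    by (simp add: a_def b_def u_def \<rho>_def)
qed

text \<open>The spectrum is reflected by sending \<open>k\<close> to \<open>1 - k\<close>, which
  exchanges maximum and minimum. Nonemptiness keeps \<open>Max\<close> and \<open>Min\<close> away
  from the empty set, where they are unspecified.\<close>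

lemma lambda_max_one_minus:
  fixes T :: "real mat"
  assumes T: "T \<in> carrier_mat n n" and ne: "spectrum (1\<^sub>m n - T) \<noteq> {}"
  shows "lambda_max (1\<^sub>m n - T) = 1 - lambda_min T"
proof -
  have T': "1\<^sub>m n - T \<in> carrier_mat n n" using T by (rule minus_carrier_mat)
  have iff: "(1\<^sub>m n - T) *\<^sub>v v = k \<cdot>\<^sub>v v \<longleftrightarrow> T *\<^sub>v v = (1 - k) \<cdot>\<^sub>v v"
    if v: "v \<in> carrier_vec n" for v :: "real vec" and k
  proof -
    have "(1\<^sub>m n - T) *\<^sub>v v = v - T *\<^sub>v v"
      using T v by (simp add: minus_mult_distrib_mat_vec[of _ n n])
    then have c: "((1\<^sub>m n - T) *\<^sub>v v) $ i = v $ i - (T *\<^sub>v v) $ i" if "i < n" for i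
      using T v that by simp
    have "(1\<^sub>m n - T) *\<^sub>v v = k \<cdot>\<^sub>v v \<longleftrightarrow> (\<forall>i<n. ((1\<^sub>m n - T) *\<^sub>v v) $ i = k * v $ i)"
      using T v by (auto simp: Matrix.vec_eq_iff simp del: index_mult_mat_vec)
    also have "\<dots> \<longleftrightarrow> (\<forall>i<n. (T *\<^sub>v v) $ i = (1 - k) * v $ i)"
      by (intro all_cong) (simp only: c, auto simp: algebra_simps)
    also have "\<dots> \<longleftrightarrow> T *\<^sub>v v = (1 - k) \<cdot>\<^sub>v v"
      using T v by (auto simp: Matrix.vec_eq_iff simp del: index_mult_mat_vec)
    finally show ?thesis .
  qed
  have spec: "k \<in> spectrum (1\<^sub>m n - T) \<longleftrightarrow> 1 - k \<in> spectrum T" for k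
    unfolding spectrum_iff[OF T'] spectrum_iff[OF T] using iff by auto
  have fin: "finite (spectrum T)" using card_finite_spectrum[OF T] by auto
  have im: "spectrum (1\<^sub>m n - T) = (\<lambda>k. 1 - k) ` spectrum T"
  proof (intro Set.set_eqI iffI)
    fix k assume "k \<in> spectrum (1\<^sub>m n - T)"
    then show "k \<in> (\<lambda>k. 1 - k) ` spectrum T" by (intro image_eqI[of _ _ "1 - k"]) (auto simp: spec)
  qed (auto simp: spec)
  have ne': "spectrum T \<noteq> {}" using ne im by auto
  show ?thesis
    unfolding lambda_max_def lambda_min_def im
    using fin Min_in[OF fin ne'] by (intro Max_eqI) auto
qed

section \<open>Pseudoinverses\<close>

lemma is_pinvD:
  assumes "is_pinv M N"
  shows "N \<in> carrier_mat (dim_col M) (dim_row M)" "dim_row N = dim_col M" "dim_col N = dim_row M"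
    "M * N * M = M" "N * M * N = N"
    "transpose_mat (M * N) = M * N" "transpose_mat (N * M) = N * M"
  using assms by (auto simp: is_pinv_def)

text \<open>In \<open>M N = (M N') (M N)\<close> transposition reverses the two symmetric factors,
  so \<open>M N = M N'\<close>; likewise \<open>N M = N' M\<close>. Then
  \<open>N = N M N = N M N' = N' M N' = N'\<close>.\<close>

lemma is_pinv_unique:
  assumes "is_pinv M N" "is_pinv M N'"
  shows "N = N'"
proof -
  note n = is_pinvD[OF assms(1)] and n' = is_pinvD[OF assms(2)]
  have "M * N = (M * N' * M) * N" using n'(4) by simp
  also have "\<dots> = (M * N') * (M * N)" using n(2,3) n'(2,3) by (simp add: mult_mat_assoc_dim)
  finally have "transpose_mat (M * N) = transpose_mat ((M * N') * (M * N))" by simp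
  also have "\<dots> = transpose_mat (M * N) * transpose_mat (M * N')"
    by (rule transpose_mult_dim) (use n(2,3) n'(2,3) in simp)
  also have "\<dots> = (M * N) * (M * N')" using n(6) n'(6) by simp
  also have "\<dots> = (M * N * M) * N'" using n(2,3) n'(2,3) by (simp add: mult_mat_assoc_dim)
  finally have 1: "M * N = M * N'" using n(4,6) by simp
  have "N * M = N * (M * N' * M)" using n'(4) by simp
  also have "\<dots> = (N * M) * (N' * M)" using n(2,3) n'(2,3) by (simp add: mult_mat_assoc_dim)
  finally have "transpose_mat (N * M) = transpose_mat ((N * M) * (N' * M))" by simp
  also have "\<dots> = transpose_mat (N' * M) * transpose_mat (N * M)"
    by (rule transpose_mult_dim) (use n(2,3) n'(2,3) in simp)
  also have "\<dots> = (N' * M) * (N * M)" using n(7) n'(7) by simp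
  also have "\<dots> = N' * (M * N * M)" using n(2,3) n'(2,3) by (simp add: mult_mat_assoc_dim)
  finally have 2: "N * M = N' * M" using n(4,7) by simp
  have "N = N * (M * N)" using n(2,3,5) by (simp add: mult_mat_assoc_dim)
  also have "\<dots> = N * M * N'" unfolding 1 using n(2,3) n'(2,3) by (simp add: mult_mat_assoc_dim)
  also have "\<dots> = N'" unfolding 2 by (rule n'(5))
  finally show ?thesis .
qed

lemma pinv_eq:
  assumes "is_pinv M N"
  shows "pinv M = N"
  unfolding pinv_def using assms is_pinv_unique by blast

text \<open>The range of \<open>Q\<close> lies in the kernel of \<open>M\<close> but may be smaller:
  the projection is grown one dimension at a time, and the intermediate stages have to
  qualify.\<close>

definition orth_proj_on_kernel :: "real mat \<Rightarrow> nat \<Rightarrow> real mat \<Rightarrow> bool" where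
  "orth_proj_on_kernel M c Q \<longleftrightarrow> Q \<in> carrier_mat c c \<and> transpose_mat Q = Q \<and> Q * Q = Q \<and> M * Q = 0\<^sub>m c c"

text \<open>The trace of a projection is its rank, hence a measure of progress. Symmetry and
  idempotence give \<open>Q_ii = sum_j Q_ij^2 \<ge> Q_ii^2\<close>, so every diagonal entry is at
  most 1.\<close>

lemma orth_proj_trace_le:
  assumes "Q \<in> carrier_mat c c" "transpose_mat Q = Q" "Q * Q = (Q :: real mat)"
  shows "mat_trace Q \<le> c"
proof -
  have "Q $$ (i, i) \<le> 1" if i: "i < c" for i
  proof -
    have "Q $$ (i, i) = (Q * Q) $$ (i, i)" using assms(3) by simp
    also have "\<dots> = (\<Sum>j<c. Q $$ (i, j) * Q $$ (j, i))"
      using assms(1) i by (simp add: scalar_prod_def lessThan_atLeast0)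
    also have "\<dots> = (\<Sum>j<c. (Q $$ (i, j))\<^sup>2)"
    proof (rule sum.cong)
      fix j assume "j \<in> {..<c}"
      then have "transpose_mat Q $$ (j, i) = Q $$ (i, j)" using assms(1) i by simp
      then show "Q $$ (i, j) * Q $$ (j, i) = (Q $$ (i, j))\<^sup>2"
        using assms(2) by (simp add: power2_eq_square)
    qed simp
    also have "\<dots> \<ge> (Q $$ (i, i))\<^sup>2" using i by (intro member_le_sum) auto
    finally have "Q $$ (i, i) * Q $$ (i, i) \<le> Q $$ (i, i) * 1" by (simp add: power2_eq_square)
    then show ?thesis by (cases "0 < Q $$ (i, i)") (auto simp: mult_le_cancel_left_pos)
  qed
  then have "(\<Sum>i<c. Q $$ (i, i)) \<le> (\<Sum>i<c. 1)" by (intro sum_mono) auto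
  then show ?thesis using assms(1) by (simp add: mat_trace_def)
qed

text \<open>As long as \<open>Q\<close> misses a vector of the kernel, its range can be enlarged by the component
  of that vector orthogonal to the range, and the trace grows by one.\<close>

lemma orth_proj_extend:
  assumes Q: "orth_proj_on_kernel M c Q" and M: "M \<in> carrier_mat c c"
    and x: "x \<in> carrier_vec c" "M *\<^sub>v x = 0\<^sub>v c" "Q *\<^sub>v x \<noteq> x"
  obtains Q' where "orth_proj_on_kernel M c Q'" "mat_trace Q' = mat_trace Q + 1"
proof -
  have Qc: "Q \<in> carrier_mat c c" and Qt: "transpose_mat Q = Q" and QQ: "Q * Q = Q"
    and MQ: "M * Q = 0\<^sub>m c c" using Q by (auto simp: orth_proj_on_kernel_def)
  have Qx: "Q *\<^sub>v x \<in> carrier_vec c" using Qc x(1) by (rule mult_mat_vec_carrier)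
  define u where "u = x - Q *\<^sub>v x"
  have u: "u \<in> carrier_vec c" using x(1) Qx by (simp add: u_def)
  have "u \<noteq> 0\<^sub>v c"
  proof
    assume "u = 0\<^sub>v c"
    then have "x = Q *\<^sub>v x" unfolding u_def by (rule minus_vec_eq_zeroD[OF x(1) Qx])
    then show False using x(3) by simp
  qed
  then have d: "u \<bullet> u \<noteq> 0" using scalar_prod_self_eq_0[OF u] by auto
  have "Q *\<^sub>v (Q *\<^sub>v x) = (Q * Q) *\<^sub>v x" using Qc x by simp
  then have Qu: "Q *\<^sub>v u = 0\<^sub>v c"
    using Qc x(1) Qx unfolding u_def QQ by (simp add: mult_minus_distrib_mat_vec[of _ c c])
  have "M *\<^sub>v (Q *\<^sub>v x) = (M * Q) *\<^sub>v x" using M Qc x by simp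
  also have "\<dots> = 0\<^sub>v c" unfolding MQ using x by (intro eq_vecI) auto
  finally have Mu: "M *\<^sub>v u = 0\<^sub>v c"
    using M x(1,2) Qx unfolding u_def by (simp add: mult_minus_distrib_mat_vec[of _ c c])
  \<comment> \<open>The orthogonal projection onto the line of \<open>u\<close>; its trace is
    1.\<close>
  define P where "P = mat c c (\<lambda>(i, j). u $ i * u $ j / (u \<bullet> u))"
  have P: "P \<in> carrier_mat c c" by (simp add: P_def)
  have Pt: "transpose_mat P = P" by (intro eq_matI) (auto simp: P_def mult.commute)
  \<comment> \<open>Every column of \<open>P\<close> is a multiple of \<open>u\<close>, so whatever
    annihilates \<open>u\<close> annihilates \<open>P\<close>.\<close>
  have colP: "A * P = 0\<^sub>m c c" if A: "A \<in> carrier_mat c c" and Au: "A *\<^sub>v u = 0\<^sub>v c" for A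
  proof (rule eq_matI)
    fix i j assume ij: "i < dim_row (0\<^sub>m c c :: real mat)" "j < dim_col (0\<^sub>m c c :: real mat)"
    then have "(A * P) $$ (i, j) = (\<Sum>k\<in>{0..<c}. A $$ (i, k) * (u $ k * u $ j / (u \<bullet> u)))"
      using A P by (auto simp: scalar_prod_def P_def)
    also have "\<dots> = (\<Sum>k\<in>{0..<c}. A $$ (i, k) * u $ k) * u $ j / (u \<bullet> u)"
      by (simp add: sum_distrib_left sum_distrib_right sum_divide_distrib mult_ac)
    also have "(\<Sum>k\<in>{0..<c}. A $$ (i, k) * u $ k) = (A *\<^sub>v u) $ i"
      using A u ij by (simp add: scalar_prod_def)
    finally show "(A * P) $$ (i, j) = 0\<^sub>m c c $$ (i, j)" using Au ij by simp
  qed (use A P in auto)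
  have QP: "Q * P = 0\<^sub>m c c" by (rule colP[OF Qc Qu])
  have MP: "M * P = 0\<^sub>m c c" by (rule colP[OF M Mu])
  have "transpose_mat (Q * P) = P * Q" using transpose_mult[OF Qc P] Qt Pt by simp
  then have PQ: "P * Q = 0\<^sub>m c c" unfolding QP by simp
  have PP: "P * P = P"
  proof (rule eq_matI)
    fix i j assume ij: "i < dim_row P" "j < dim_col P"
    then have "(P * P) $$ (i, j) = (\<Sum>k\<in>{0..<c}. (u $ i * u $ k / (u \<bullet> u)) * (u $ k * u $ j / (u \<bullet> u)))"
      by (auto simp: scalar_prod_def P_def)
    also have "\<dots> = (\<Sum>k\<in>{0..<c}. u $ k * u $ k) * (u $ i * u $ j / ((u \<bullet> u) * (u \<bullet> u)))"
      by (simp add: sum_distrib_left sum_distrib_right sum_divide_distrib mult_ac)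
    also have "(\<Sum>k\<in>{0..<c}. u $ k * u $ k) = u \<bullet> u" using u by (simp add: scalar_prod_def)
    finally show "(P * P) $$ (i, j) = P $$ (i, j)" using d ij by (simp add: P_def)
  qed auto
  show ?thesis
  proof (rule that[of "Q + P"])
    have "(Q + P) * (Q + P) = Q * (Q + P) + P * (Q + P)"
      by (rule add_mult_distrib_mat) (use Qc P in auto)
    also have "Q * (Q + P) = Q * Q + Q * P" by (rule mult_add_distrib_mat) (use Qc P in auto)
    also have "P * (Q + P) = P * Q + P * P" by (rule mult_add_distrib_mat) (use Qc P in auto)
    finally have "(Q + P) * (Q + P) = Q + P" unfolding QQ QP PQ PP using Qc P by simp
    moreover have "M * (Q + P) = M * Q + M * P" by (rule mult_add_distrib_mat) (use M Qc P in auto)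
    ultimately show "orth_proj_on_kernel M c (Q + P)"
      using Qc P Qt Pt MQ MP by (simp add: orth_proj_on_kernel_def transpose_add[of _ c c])
    have "mat_trace P = (\<Sum>i\<in>{0..<c}. u $ i * u $ i) / (u \<bullet> u)"
      by (simp add: mat_trace_def P_def sum_divide_distrib lessThan_atLeast0)
    also have "(\<Sum>i\<in>{0..<c}. u $ i * u $ i) = u \<bullet> u" using u by (simp add: scalar_prod_def)
    finally have "mat_trace P = 1" using d by simp
    then show "mat_trace (Q + P) = mat_trace Q + 1"
      using Qc P by (simp add: mat_trace_def sum.distrib)
  qed
qed

text \<open>Otherwise the extension never stops: starting from the zero matrix it yields projections
  of every natural trace, and trace \<open>c + 1\<close> contradicts
  \<open>orth_proj_trace_le\<close>.\<close>

lemma orth_proj_on_kernel_exists: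
  assumes M: "M \<in> carrier_mat c c"
  shows "\<exists>Q. orth_proj_on_kernel M c Q \<and>
    (\<forall>x\<in>carrier_vec c. M *\<^sub>v x = 0\<^sub>v c \<longrightarrow> Q *\<^sub>v x = x)"
proof (rule ccontr)
  assume "\<not> ?thesis"
  then have *: "\<exists>x. x \<in> carrier_vec c \<and> M *\<^sub>v x = 0\<^sub>v c \<and> Q *\<^sub>v x \<noteq> x"
    if "orth_proj_on_kernel M c Q" for Q using that by blast
  have "\<exists>Q. orth_proj_on_kernel M c Q \<and> mat_trace Q = real k" for k
  proof (induction k)
    case 0
    have "orth_proj_on_kernel M c (0\<^sub>m c c)" using M by (auto simp: orth_proj_on_kernel_def)
    moreover have "mat_trace (0\<^sub>m c c) = 0" by (simp add: mat_trace_def)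
    ultimately show ?case by auto
  next
    case (Suc k)
    then obtain Q where Q: "orth_proj_on_kernel M c Q" "mat_trace Q = real k" by auto
    from *[OF Q(1)] obtain x where "x \<in> carrier_vec c" "M *\<^sub>v x = 0\<^sub>v c" "Q *\<^sub>v x \<noteq> x" by auto
    from orth_proj_extend[OF Q(1) M this] obtain Q' where
      "orth_proj_on_kernel M c Q'" "mat_trace Q' = mat_trace Q + 1" by auto
    then show ?case using Q(2) by auto
  qed
  from this[of "Suc c"] obtain Q where "orth_proj_on_kernel M c Q" "mat_trace Q = real (Suc c)" by auto
  then show False using orth_proj_trace_le[of Q c] by (auto simp: orth_proj_on_kernel_def)
qed

text \<open>With \<open>Q\<close> the projection onto the kernel, \<open>R = M + Q\<close> is the
  identity on the kernel and \<open>M\<close> on its orthogonal complement, hence invertible.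
  Removing the kernel part from the inverse leaves \<open>N = R^-1 - Q\<close>, for which
  \<open>M N = N M = 1 - Q\<close>.\<close>

lemma is_pinv_symmetric_exists:
  assumes M: "M \<in> carrier_mat c c" and Mt: "transpose_mat M = M"
  obtains N where "is_pinv M N"
proof -
  obtain Q where Q: "orth_proj_on_kernel M c Q"
    and ker: "\<And>x. x \<in> carrier_vec c \<Longrightarrow> M *\<^sub>v x = 0\<^sub>v c \<Longrightarrow> Q *\<^sub>v x = x"
    using orth_proj_on_kernel_exists[OF M] by blast
  have Qc: "Q \<in> carrier_mat c c" and Qt: "transpose_mat Q = Q" and QQ: "Q * Q = Q"
    and MQ: "M * Q = 0\<^sub>m c c" using Q by (auto simp: orth_proj_on_kernel_def)
  have "transpose_mat (M * Q) = Q * M" using transpose_mult[OF M Qc] Qt Mt by simp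
  then have QM: "Q * M = 0\<^sub>m c c" unfolding MQ by simp
  define R where "R = M + Q"
  have R: "R \<in> carrier_mat c c" using M Qc by (simp add: R_def)
  have Rt: "transpose_mat R = R" using M Qc Mt Qt by (simp add: R_def transpose_add[of _ c c])
  have QR: "Q * R = Q"
  proof -
    have "Q * R = Q * M + Q * Q" unfolding R_def by (rule mult_add_distrib_mat) (use M Qc in auto)
    then show ?thesis unfolding QM QQ using Qc by simp
  qed
  have RQ: "R * Q = Q"
  proof -
    have "R * Q = M * Q + Q * Q" unfolding R_def by (rule add_mult_distrib_mat) (use M Qc in auto)
    then show ?thesis unfolding MQ QQ using Qc by simp
  qed
  have det: "det R \<noteq> 0"
  proof (rule det_nonzero_if_injective[OF R])
    \<comment> \<open>\<open>Q R = Q\<close> gives \<open>Q x = 0\<close>, then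
      \<open>R x = 0\<close> gives \<open>M x = 0\<close>, and \<open>Q\<close> fixes the kernel, so
      \<open>x = Q x = 0\<close>.\<close>
    fix x assume x: "x \<in> carrier_vec c" "R *\<^sub>v x = 0\<^sub>v c"
    have "(Q * R) *\<^sub>v x = Q *\<^sub>v (R *\<^sub>v x)" by (rule assoc_mult_mat_vec[OF Qc R x(1)])
    then have "Q *\<^sub>v x = Q *\<^sub>v (R *\<^sub>v x)" unfolding QR .
    then have Qx: "Q *\<^sub>v x = 0\<^sub>v c" unfolding x(2) using mult_mat_zero_vec[OF Qc] by simp
    have "R *\<^sub>v x = M *\<^sub>v x + Q *\<^sub>v x"
      unfolding R_def by (rule add_mult_distrib_mat_vec) (use M Qc x in auto)
    moreover have "M *\<^sub>v x \<in> carrier_vec c" using M x(1) by (rule mult_mat_vec_carrier)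
    ultimately have "M *\<^sub>v x = 0\<^sub>v c" unfolding x(2) Qx by simp
    from ker[OF x(1) this] show "x = 0\<^sub>v c" using Qx by simp
  qed
  define B where "B = mat_inv R"
  note B = mat_inv[OF R det, folded B_def]
  have Bt: "transpose_mat B = B" by (rule symmetric_inverse[OF R Rt B])
  have BQ: "B * Q = Q"
  proof -
    have "B * Q = B * (R * Q)" unfolding RQ ..
    also have "\<dots> = (B * R) * Q" using B(1) R Qc by simp
    finally show ?thesis unfolding B(3) using Qc by simp
  qed
  have MB: "M * B = 1\<^sub>m c - Q"
  proof -
    have "transpose_mat (B * Q) = Q * B" using transpose_mult[OF B(1) Qc] Qt Bt by simp
    then have QB: "Q * B = Q" unfolding BQ Qt by simp
    have "R * B = M * B + Q * B" unfolding R_def by (rule add_mult_distrib_mat) (use M Qc B in auto)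
    then have e: "1\<^sub>m c = M * B + Q" unfolding QB B(2) .
    show ?thesis unfolding e using M B(1) Qc by (intro eq_matI) auto
  qed
  define N where "N = B - Q"
  have N: "N \<in> carrier_mat c c" unfolding N_def by (rule minus_carrier_mat[OF Qc])
  have Nt: "transpose_mat N = N" using B(1) Qc Bt Qt by (simp add: N_def transpose_minus[of _ c c])
  have MN: "M * N = 1\<^sub>m c - Q"
  proof -
    have "M * N = M * B - M * Q" unfolding N_def by (rule mult_minus_distrib_mat) (use M B Qc in auto)
    then show ?thesis unfolding MQ MB using Qc by (intro eq_matI) auto
  qed
  have IQ: "transpose_mat (1\<^sub>m c - Q) = 1\<^sub>m c - Q" using Qc Qt by (simp add: transpose_minus[of _ c c])
  have "transpose_mat (M * N) = N * M" using transpose_mult[OF M N] Nt Mt by simp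
  then have NM: "N * M = 1\<^sub>m c - Q" unfolding MN IQ by simp
  have IM: "(1\<^sub>m c - Q) * M = M"
  proof -
    have "(1\<^sub>m c - Q) * M = 1\<^sub>m c * M - Q * M" by (rule minus_mult_distrib_mat) (use M Qc in auto)
    then show ?thesis unfolding QM using M by (intro eq_matI) auto
  qed
  have IN: "(1\<^sub>m c - Q) * N = N"
  proof -
    have "Q * N = Q * B - Q * Q" unfolding N_def by (rule mult_minus_distrib_mat) (use B Qc in auto)
    moreover have "transpose_mat (B * Q) = Q * B" using transpose_mult[OF B(1) Qc] Qt Bt by simp
    ultimately have QN: "Q * N = 0\<^sub>m c c" unfolding BQ QQ Qt using Qc by simp
    have "(1\<^sub>m c - Q) * N = 1\<^sub>m c * N - Q * N" by (rule minus_mult_distrib_mat) (use N Qc in auto)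
    then show ?thesis unfolding QN using N by (intro eq_matI) auto
  qed
  have "is_pinv M N"
    unfolding is_pinv_def MN NM IM IN IQ using N M by simp
  then show ?thesis by (rule that)
qed

text \<open>For symmetric \<open>M\<close> the transpose of a pseudoinverse satisfies the same
  Penrose conditions; uniqueness makes the pseudoinverse symmetric.\<close>

lemma pinv_symmetric:
  assumes M: "M \<in> carrier_mat c c" and Mt: "transpose_mat M = M"
  shows "pinv M \<in> carrier_mat c c" "transpose_mat (pinv M) = pinv M"
    "M * pinv M * M = M" "pinv M * M * pinv M = pinv M"
proof -
  obtain N where N: "is_pinv M N" using is_pinv_symmetric_exists[OF M Mt] .
  note n = is_pinvD[OF N]
  have dim: "dim_row M = c" "dim_col M = c" "dim_row N = c" "dim_col N = c" using M n(2,3) by auto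
  have "is_pinv M (transpose_mat N)"
    unfolding is_pinv_def
  proof (intro conjI)
    have 1: "M * transpose_mat N = N * M"
      using n(7) transpose_mult_dim[of N M] dim Mt by simp
    have 2: "transpose_mat N * M = M * N"
      using n(6) transpose_mult_dim[of M N] dim Mt by simp
    show "M * transpose_mat N * M = M" unfolding 1
      using n(4) n(7) transpose_mult_dim[of "M" "N * M"] transpose_mult_dim[of N M] dim Mt 1
      by (simp add: mult_mat_assoc_dim)
    show "transpose_mat N * M * transpose_mat N = transpose_mat N"
      using arg_cong[OF n(5), of transpose_mat] dim Mt
      by (simp add: transpose_mult_dim mult_mat_assoc_dim)
    show "transpose_mat (M * transpose_mat N) = M * transpose_mat N" unfolding 1 by (rule n(7))
    show "transpose_mat (transpose_mat N * M) = transpose_mat N * M" unfolding 2 by (rule n(6))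
  qed (use dim in auto)
  from is_pinv_unique[OF N this] pinv_eq[OF N] n(1,4,5) dim
  show "pinv M \<in> carrier_mat c c" "transpose_mat (pinv M) = pinv M"
    "M * pinv M * M = M" "pinv M * M * pinv M = pinv M" by auto
qed

section \<open>Weighted projections\<close>

text \<open>The common shape of both factors: \<open>Z1'\<close> has \<open>W = G^-1\<close> and
  \<open>V = A^T S\<close>, while \<open>Z2\<close> has \<open>W = 1\<close> and
  \<open>V = B P\<close>. For positive definite \<open>W\<close> it is the projection onto the range
  of \<open>W V\<close> that is orthogonal for the inner product of \<open>W^-1\<close>.\<close>

definition weighted_proj :: "real mat \<Rightarrow> real mat \<Rightarrow> real mat" where
  "weighted_proj W V = W * V * pinv (transpose_mat V * W * V) * transpose_mat V"

lemma gram_symmetric: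
  fixes V W :: "real mat"
  assumes W: "W \<in> carrier_mat m m" "transpose_mat W = W" and V: "V \<in> carrier_mat m c"
  shows "transpose_mat V * W * V \<in> carrier_mat c c"
    "transpose_mat (transpose_mat V * W * V) = transpose_mat V * W * V"
proof -
  have d: "dim_row W = m" "dim_col W = m" "dim_row V = m" "dim_col V = c" using W V by auto
  show "transpose_mat V * W * V \<in> carrier_mat c c" using W V by auto
  show "transpose_mat (transpose_mat V * W * V) = transpose_mat V * W * V"
    by (simp add: transpose_mult_dim mult_mat_assoc_dim d W)
qed

text \<open>With \<open>N\<close> the pseudoinverse of \<open>M = V^T W V\<close>, idempotence is
  the Penrose identity \<open>N M N = N\<close>. Self-adjointness holds because
  \<open>G W = 1\<close> collapses the product with \<open>G\<close> to \<open>V N V^T\<close>, and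
  \<open>N\<close> is symmetric.\<close>

lemma weighted_proj:
  assumes W: "W \<in> carrier_mat m m" "transpose_mat W = W" and V: "V \<in> carrier_mat m c"
  shows "weighted_proj W V \<in> carrier_mat m m"
    and "weighted_proj W V * weighted_proj W V = weighted_proj W V"
    and "G \<in> carrier_mat m m \<Longrightarrow> G * W = 1\<^sub>m m \<Longrightarrow>
      transpose_mat (G * weighted_proj W V) = G * weighted_proj W V"
proof -
  define M where "M = transpose_mat V * W * V"
  note M = gram_symmetric[OF W V, folded M_def]
  note N = pinv_symmetric[OF M]
  define N where "N = pinv M"
  have d: "dim_row W = m" "dim_col W = m" "dim_row V = m" "dim_col V = c"
    "dim_row N = c" "dim_col N = c" "dim_row M = c" "dim_col M = c"
    using W V N(1) M(1) by (auto simp: N_def)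
  have Z: "weighted_proj W V = W * (V * (N * transpose_mat V))"
    unfolding weighted_proj_def M_def[symmetric] N_def[symmetric] by (simp add: mult_mat_assoc_dim d)
  show "weighted_proj W V \<in> carrier_mat m m" unfolding Z by (intro carrier_matI) (simp_all add: d)
  have "weighted_proj W V * weighted_proj W V = W * (V * (N * M * N * transpose_mat V))"
    unfolding Z unfolding M_def by (simp add: mult_mat_assoc_dim d)
  then show "weighted_proj W V * weighted_proj W V = weighted_proj W V"
    unfolding Z N(4)[folded N_def] .
  assume G: "G \<in> carrier_mat m m" "G * W = 1\<^sub>m m"
  have dG: "dim_row G = m" "dim_col G = m" using G by auto
  have "G * weighted_proj W V = (G * W) * (V * (N * transpose_mat V))"
    unfolding Z by (simp add: mult_mat_assoc_dim d dG)
  also have "\<dots> = V * (N * transpose_mat V)"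
    unfolding G(2) by (rule left_mult_one_mat) (intro carrier_matI; simp add: d)
  finally have e: "G * weighted_proj W V = V * (N * transpose_mat V)" .
  show "transpose_mat (G * weighted_proj W V) = G * weighted_proj W V"
    unfolding e using N(2)[folded N_def] by (simp add: transpose_mult_dim mult_mat_assoc_dim d)
qed

text \<open>Idempotence and the symmetry of \<open>H K\<close> turn the form at \<open>x\<close>
  into the form of \<open>H\<close> at \<open>K x\<close>.\<close>

lemma self_adjoint_idempotent_psd:
  assumes H: "psd n H" and K: "K \<in> carrier_mat n n"
    and HK: "transpose_mat (H * K) = H * K" and KK: "K * K = K"
  shows "psd n (H * K)"
  unfolding psd_def
proof (intro conjI ballI)
  note Hc = psdD[OF H]
  show c: "H * K \<in> carrier_mat n n" using Hc(1) K by simp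
  fix x :: "real vec" assume x: "x \<in> carrier_vec n"
  define y where "y = K *\<^sub>v x"
  have y: "y \<in> carrier_vec n" unfolding y_def using K x by (rule mult_mat_vec_carrier)
  have "H * K *\<^sub>v x = H * K *\<^sub>v y"
  proof -
    have "H * K *\<^sub>v y = (H * K * K) *\<^sub>v x"
      unfolding y_def by (rule assoc_mult_mat_vec[OF c K x, symmetric])
    also have "H * K * K = H * (K * K)" by (rule assoc_mult_mat[OF Hc(1) K K])
    finally show ?thesis unfolding KK by simp
  qed
  then have "x \<bullet> (H * K *\<^sub>v x) = (H * K *\<^sub>v x) \<bullet> y"
    using scalar_prod_mult_mat_vec[OF c x y] HK by simp
  also have "(H * K *\<^sub>v x) \<bullet> y = (H *\<^sub>v y) \<bullet> y"
    using assoc_mult_mat_vec[OF Hc(1) K x] by (simp only: y_def)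
  also have "(H *\<^sub>v y) \<bullet> y = y \<bullet> (H *\<^sub>v y)"
    by (rule comm_scalar_prod[OF mult_mat_vec_carrier[OF Hc(1) y] y])
  finally show "0 \<le> x \<bullet> (H * K *\<^sub>v x)" using Hc(3)[OF y] by simp
qed (rule HK)

lemma mult_one_minus_vec:
  fixes H K :: "real mat"
  assumes H: "H \<in> carrier_mat n n" and K: "K \<in> carrier_mat n n" and x: "x \<in> carrier_vec n"
  shows "x \<bullet> (H * (1\<^sub>m n - K) *\<^sub>v x) = x \<bullet> (H *\<^sub>v x) - x \<bullet> (H * K *\<^sub>v x)"
proof -
  have "H * (1\<^sub>m n - K) = H * 1\<^sub>m n - H * K" by (rule mult_minus_distrib_mat) (use H K in auto)
  also have "H * 1\<^sub>m n = H" using H by simp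
  also have "(H - H * K) *\<^sub>v x = H *\<^sub>v x - H * K *\<^sub>v x"
    by (rule minus_mult_distrib_mat_vec[of _ n n]) (use H K x in auto)
  finally have e: "H * (1\<^sub>m n - K) *\<^sub>v x = H *\<^sub>v x - H * K *\<^sub>v x" by simp
  show ?thesis unfolding e
    by (rule scalar_prod_minus_distrib[OF x]) (auto intro!: mult_mat_vec_carrier[of _ n n] H K x mult_carrier_mat[of _ n n])
qed

lemma self_adjoint_one_minus:
  fixes H K :: "real mat"
  assumes H: "H \<in> carrier_mat n n" "transpose_mat H = H" and K: "K \<in> carrier_mat n n"
    and HK: "transpose_mat (H * K) = H * K"
  shows "transpose_mat (H * (1\<^sub>m n - K)) = H * (1\<^sub>m n - K)"
proof -
  have "H * (1\<^sub>m n - K) = H * 1\<^sub>m n - H * K" by (rule mult_minus_distrib_mat) (use H K in auto)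
  also have "H * 1\<^sub>m n = H" using H by simp
  finally have e: "H * (1\<^sub>m n - K) = H - H * K" .
  have "transpose_mat (H - H * K) = transpose_mat H - transpose_mat (H * K)"
    by (rule transpose_minus) (use H K in auto)
  then show ?thesis unfolding e H(2) HK .
qed

text \<open>\<open>1 - K\<close> is again idempotent and self-adjoint for \<open>H\<close>, so its
  form is nonnegative.\<close>

lemma self_adjoint_idempotent_le:
  assumes H: "psd n H" and K: "K \<in> carrier_mat n n"
    and HK: "transpose_mat (H * K) = H * K" and KK: "K * K = K" and x: "x \<in> carrier_vec n"
  shows "x \<bullet> (H * K *\<^sub>v x) \<le> x \<bullet> (H *\<^sub>v x)"
proof -
  note Hc = psdD[OF H]
  define L where "L = 1\<^sub>m n - K"
  have L: "L \<in> carrier_mat n n" unfolding L_def by (rule minus_carrier_mat[OF K])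
  have "L * L = 1\<^sub>m n * L - K * L"
    unfolding L_def by (rule minus_mult_distrib_mat[OF one_carrier_mat K minus_carrier_mat[OF K]])
  also have "K * L = K * 1\<^sub>m n - K * K"
    unfolding L_def by (rule mult_minus_distrib_mat) (use K in auto)
  also have "\<dots> = 0\<^sub>m n n" unfolding KK using K by simp
  also have "1\<^sub>m n * L - 0\<^sub>m n n = L" using L by (intro eq_matI) auto
  finally have LL: "L * L = L" .
  have HL: "transpose_mat (H * L) = H * L"
    unfolding L_def by (rule self_adjoint_one_minus[OF Hc(1,2) K HK])
  have "0 \<le> x \<bullet> (H * L *\<^sub>v x)"
    by (rule psdD(3)[OF self_adjoint_idempotent_psd[OF H L HL LL] x])
  then show ?thesis unfolding L_def mult_one_minus_vec[OF Hc(1) K x] by simp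
qed

text \<open>Column \<open>j\<close> of \<open>K\<close> is the projection of a unit vector, so its
  squared \<open>H\<close>-norm is at most that of the unit vector, \<open>H $$ (j, j)\<close>. The
  bound does not depend on the projection, which makes all random entries uniformly bounded.\<close>

lemma self_adjoint_idempotent_index_bound:
  assumes H: "sym_pos_def n H" and K: "K \<in> carrier_mat n n"
    and HK: "transpose_mat (H * K) = H * K" and KK: "K * K = K" and ij: "i < n" "j < n"
  shows "(K $$ (i, j))\<^sup>2 \<le> mat_inv H $$ (i, i) * H $$ (j, j)"
proof -
  note Hc = sym_pos_defD[OF H]
  note B = mat_inv[OF Hc(1) sym_pos_def_det[OF H]]
  have HKc: "H * K \<in> carrier_mat n n" using Hc(1) K by simp
  define e :: "real vec" where "e = unit_vec n j"
  have e: "e \<in> carrier_vec n" by (simp add: e_def)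
  define v where "v = K *\<^sub>v e"
  have v: "v \<in> carrier_vec n" unfolding v_def using K e by (rule mult_mat_vec_carrier)
  have Hv: "H *\<^sub>v v = H * K *\<^sub>v e" unfolding v_def by (rule assoc_mult_mat_vec[OF Hc(1) K e, symmetric])
  have "v \<bullet> (H *\<^sub>v v) = (H * K *\<^sub>v v) \<bullet> e"
    unfolding Hv using scalar_prod_mult_mat_vec[OF HKc v e] HK by simp
  also have "H * K *\<^sub>v v = H * K * K *\<^sub>v e"
    unfolding v_def by (rule assoc_mult_mat_vec[OF HKc K e, symmetric])
  also have "H * K * K = H * (K * K)" by (rule assoc_mult_mat[OF Hc(1) K K])
  also have "(H * (K * K) *\<^sub>v e) \<bullet> e = e \<bullet> (H * K *\<^sub>v e)"
    unfolding KK by (rule comm_scalar_prod[OF mult_mat_vec_carrier[OF HKc e] e])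
  also have "\<dots> \<le> e \<bullet> (H *\<^sub>v e)"
    by (rule self_adjoint_idempotent_le[OF sym_pos_def_psd[OF H] K HK KK e])
  also have "\<dots> = H $$ (j, j)" using Hc(1) ij by (simp add: e_def)
  finally have le: "v \<bullet> (H *\<^sub>v v) \<le> H $$ (j, j)" .
  have B0: "0 \<le> mat_inv H $$ (i, i)"
  proof -
    have "0 \<le> unit_vec n i \<bullet> (mat_inv H *\<^sub>v unit_vec n i)"
      by (rule psdD(3)[OF sym_pos_def_psd[OF sym_pos_def_inverse[OF H B]]]) simp
    then show ?thesis using B(1) ij by simp
  qed
  have "(v $ i)\<^sup>2 \<le> mat_inv H $$ (i, i) * (v \<bullet> (H *\<^sub>v v))"
    by (rule sym_pos_def_index_bound[OF H B v ij(1)])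
  also have "\<dots> \<le> mat_inv H $$ (i, i) * H $$ (j, j)" using le B0 by (rule mult_left_mono)
  also have "v $ i = K $$ (i, j)" using K ij by (simp add: v_def e_def)
  finally show ?thesis .
qed

section \<open>Kronecker products\<close>

lemma kronecker_carrier [intro]:
  assumes "M \<in> carrier_mat a b" "N \<in> carrier_mat c d"
  shows "kronecker M N \<in> carrier_mat (a * c) (b * d)"
  using assms by (simp add: kronecker_def)

lemma kronecker_index:
  assumes "M \<in> carrier_mat a b" "N \<in> carrier_mat c d" "i < a * c" "j < b * d"
  shows "kronecker M N $$ (i, j) = M $$ (i div c, j div d) * N $$ (i mod c, j mod d)"
  using assms by (simp add: kronecker_def)

lemma div_mod_less_product:
  assumes "i < a * (c :: nat)"
  shows "i div c < a" "i mod c < c"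
proof -
  show "i div c < a" using assms by (simp add: less_mult_imp_div_less)
  have "0 < c" using assms by (cases c) auto
  then show "i mod c < c" by simp
qed

text \<open>Quotient and remainder by \<open>d\<close> enumerate the index pairs block by block;
  this turns sums over Kronecker and stacked indices into double sums.\<close>

lemma sum_product_div_mod:
  fixes h :: "nat \<Rightarrow> nat \<Rightarrow> 'a :: comm_monoid_add"
  shows "(\<Sum>k<b * d. h (k div d) (k mod d)) = (\<Sum>i<b. \<Sum>j<d. h i j)"
proof -
  have "(\<Sum>k<b * d. h (k div d) (k mod d)) = (\<Sum>i<b. \<Sum>k\<in>{i * d..<i * d + d}. h (k div d) (k mod d))"
    by (rule sum.nat_group[symmetric])
  also have "\<dots> = (\<Sum>i<b. \<Sum>j<d. h i j)"
  proof (rule sum.cong[OF refl])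
    fix i
    have "(\<Sum>k\<in>{i * d..<i * d + d}. h (k div d) (k mod d))
      = (\<Sum>k\<in>{0 + i * d..<d + i * d}. h (k div d) (k mod d))" by (simp add: add.commute)
    also have "\<dots> = (\<Sum>j\<in>{0..<d}. h ((j + i * d) div d) ((j + i * d) mod d))"
      by (rule sum.shift_bounds_nat_ivl)
    also have "\<dots> = (\<Sum>j<d. h i j)" unfolding lessThan_atLeast0 by (rule sum.cong) auto
    finally show "(\<Sum>k\<in>{i * d..<i * d + d}. h (k div d) (k mod d)) = (\<Sum>j<d. h i j)" .
  qed
  finally show ?thesis .
qed

lemma mat_mult_index_sum:
  fixes A B :: "real mat"
  assumes "A \<in> carrier_mat r n" "B \<in> carrier_mat n c" "i < r" "j < c"
  shows "(A * B) $$ (i, j) = (\<Sum>k<n. A $$ (i, k) * B $$ (k, j))"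
  using assms by (simp add: scalar_prod_def lessThan_atLeast0)

text \<open>The sum over pairs of inner indices splits into a product of two sums, one for each
  factor.\<close>

lemma kronecker_mult:
  assumes M: "M \<in> carrier_mat a b" and N: "N \<in> carrier_mat c d"
    and M': "M' \<in> carrier_mat b e" and N': "N' \<in> carrier_mat d f"
  shows "kronecker M N * kronecker M' N' = kronecker (M * M') (N * N')"
proof (rule eq_matI)
  note K = kronecker_carrier[OF M N] and K' = kronecker_carrier[OF M' N']
  have MM: "M * M' \<in> carrier_mat a e" and NN: "N * N' \<in> carrier_mat c f" using M N M' N' by auto
  note KK = kronecker_carrier[OF MM NN]
  fix i j assume "i < dim_row (kronecker (M * M') (N * N'))" "j < dim_col (kronecker (M * M') (N * N'))"
  then have i: "i < a * c" and j: "j < e * f" using KK by auto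
  note i' = div_mod_less_product[OF i] and j' = div_mod_less_product[OF j]
  have "(kronecker M N * kronecker M' N') $$ (i, j)
    = (\<Sum>k<b * d. kronecker M N $$ (i, k) * kronecker M' N' $$ (k, j))"
    by (rule mat_mult_index_sum[OF K K' i j])
  also have "\<dots> = (\<Sum>k<b * d. (M $$ (i div c, k div d) * N $$ (i mod c, k mod d)) *
      (M' $$ (k div d, j div f) * N' $$ (k mod d, j mod f)))"
    using i j by (intro sum.cong) (auto simp: kronecker_index[OF M N] kronecker_index[OF M' N'])
  also have "\<dots> = (\<Sum>k<b. \<Sum>l<d. (M $$ (i div c, k) * N $$ (i mod c, l)) *
      (M' $$ (k, j div f) * N' $$ (l, j mod f)))"
    by (rule sum_product_div_mod)
  also have "\<dots> = (\<Sum>k<b. M $$ (i div c, k) * M' $$ (k, j div f)) *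
      (\<Sum>l<d. N $$ (i mod c, l) * N' $$ (l, j mod f))"
    by (simp add: sum_product mult_ac)
  also have "\<dots> = kronecker (M * M') (N * N') $$ (i, j)"
    unfolding kronecker_index[OF MM NN i j]
      mat_mult_index_sum[OF M M' i'(1) j'(1)] mat_mult_index_sum[OF N N' i'(2) j'(2)] ..
  finally show "(kronecker M N * kronecker M' N') $$ (i, j) = kronecker (M * M') (N * N') $$ (i, j)" .
qed (use assms in \<open>simp_all add: kronecker_def\<close>)

lemma kronecker_transpose:
  assumes M: "M \<in> carrier_mat a b" and N: "N \<in> carrier_mat c d"
  shows "transpose_mat (kronecker M N) = kronecker (transpose_mat M) (transpose_mat N)"
proof (rule eq_matI)
  fix i j assume "i < dim_row (kronecker (transpose_mat M) (transpose_mat N))"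
    "j < dim_col (kronecker (transpose_mat M) (transpose_mat N))"
  then have i: "i < b * d" and j: "j < a * c" using M N by (auto simp: kronecker_def)
  note i' = div_mod_less_product[OF i] and j' = div_mod_less_product[OF j]
  have Mt: "transpose_mat M \<in> carrier_mat b a" and Nt: "transpose_mat N \<in> carrier_mat d c"
    using M N by auto
  show "transpose_mat (kronecker M N) $$ (i, j) = kronecker (transpose_mat M) (transpose_mat N) $$ (i, j)"
    unfolding kronecker_index[OF Mt Nt i j]
    using kronecker_carrier[OF M N] M N i j i' j' by (simp add: kronecker_index[OF M N])
qed (use assms in \<open>simp_all add: kronecker_def\<close>)

text \<open>Column stacking, the vectorisation matched to \<^const>\<open>kronecker\<close>.\<close>

definition vectorize :: "nat \<Rightarrow> nat \<Rightarrow> real mat \<Rightarrow> real vec" where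
  "vectorize m n X = vec (n * m) (\<lambda>i. X $$ (i mod m, i div m))"

lemma vectorize_carrier [simp]: "vectorize m n X \<in> carrier_vec (n * m)"
  by (simp add: vectorize_def)

lemma vectorize_index: "i < n * m \<Longrightarrow> vectorize m n X $ i = X $$ (i mod m, i div m)"
  by (simp add: vectorize_def)

lemma vectorize_surj:
  assumes v: "v \<in> carrier_vec (n * m)"
  obtains X where "X \<in> carrier_mat m n" "vectorize m n X = v"
proof
  define X where "X = mat m n (\<lambda>(i, j). v $ (j * m + i))"
  show "X \<in> carrier_mat m n" by (simp add: X_def)
  show "vectorize m n X = v"
  proof (rule eq_vecI)
    fix i assume "i < dim_vec v"
    then have i: "i < n * m" using v by simp
    then show "vectorize m n X $ i = v $ i"
      using div_mod_less_product[OF i] by (simp add: vectorize_index X_def)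
  qed (use v in \<open>simp add: vectorize_def\<close>)
qed

lemma kronecker_vectorize:
  assumes M: "M \<in> carrier_mat n n" and N: "N \<in> carrier_mat m m" and X: "X \<in> carrier_mat m n"
  shows "kronecker M N *\<^sub>v vectorize m n X = vectorize m n (N * X * transpose_mat M)"
proof (rule eq_vecI)
  note K = kronecker_carrier[OF M N]
  have NX: "N * X \<in> carrier_mat m n" and Mt: "transpose_mat M \<in> carrier_mat n n" using N X M by auto
  fix i assume "i < dim_vec (vectorize m n (N * X * transpose_mat M))"
  then have i: "i < n * m" by (simp add: vectorize_def)
  note i' = div_mod_less_product[OF i]
  have "(kronecker M N *\<^sub>v vectorize m n X) $ i = (\<Sum>k<n * m. kronecker M N $$ (i, k) * vectorize m n X $ k)"
    using K i by (simp add: scalar_prod_def lessThan_atLeast0 vectorize_def)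
  also have "\<dots> = (\<Sum>k<n * m. (M $$ (i div m, k div m) * N $$ (i mod m, k mod m)) * X $$ (k mod m, k div m))"
    using i by (intro sum.cong) (auto simp: kronecker_index[OF M N] vectorize_index)
  also have "\<dots> = (\<Sum>k<n. \<Sum>l<m. (M $$ (i div m, k) * N $$ (i mod m, l)) * X $$ (l, k))"
    by (rule sum_product_div_mod)
  also have "\<dots> = (\<Sum>k<n. (N * X) $$ (i mod m, k) * M $$ (i div m, k))"
    using i' by (intro sum.cong)
      (auto simp: mat_mult_index_sum[OF N X] sum_distrib_left sum_distrib_right mult_ac)
  also have "\<dots> = (N * X * transpose_mat M) $$ (i mod m, i div m)"
    unfolding mat_mult_index_sum[OF NX Mt i'(2,1)] using M i' by (intro sum.cong) auto
  finally show "(kronecker M N *\<^sub>v vectorize m n X) $ i = vectorize m n (N * X * transpose_mat M) $ i"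
    using i by (simp add: vectorize_index)
qed (use kronecker_carrier[OF M N] in \<open>simp add: vectorize_def\<close>)

text \<open>The Kronecker product is block diagonal with one copy of \<open>G\<close> per column of
  \<open>X\<close>, so the form splits. Both the identification of the norm and the definiteness of
  the form start here.\<close>

lemma vectorize_form:
  assumes G: "G \<in> carrier_mat m m" and X: "X \<in> carrier_mat m n"
  shows "vectorize m n X \<bullet> (kronecker (1\<^sub>m n) G *\<^sub>v vectorize m n X) =
      (\<Sum>j<n. col X j \<bullet> (G *\<^sub>v col X j))"
proof -
  have GX: "G * X \<in> carrier_mat m n" using G X by simp
  have "kronecker (1\<^sub>m n) G *\<^sub>v vectorize m n X = vectorize m n (G * X * transpose_mat (1\<^sub>m n))"
    by (rule kronecker_vectorize[OF _ G X]) simp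
  also have "G * X * transpose_mat (1\<^sub>m n) = G * X"
    unfolding transpose_one by (rule right_mult_one_mat[OF GX])
  finally have "vectorize m n X \<bullet> (kronecker (1\<^sub>m n) G *\<^sub>v vectorize m n X)
    = (\<Sum>k<n * m. X $$ (k mod m, k div m) * (G * X) $$ (k mod m, k div m))"
    by (simp add: scalar_prod_def lessThan_atLeast0 vectorize_def)
  also have "\<dots> = (\<Sum>j<n. \<Sum>i<m. X $$ (i, j) * (G * X) $$ (i, j))"
    by (rule sum_product_div_mod)
  also have "\<dots> = (\<Sum>j<n. col X j \<bullet> (G *\<^sub>v col X j))"
    using G X by (intro sum.cong) (auto simp: scalar_prod_def lessThan_atLeast0)
  finally show ?thesis .
qed

lemma wfrob_norm_vectorize:
  assumes G: "G \<in> carrier_mat m m" and X: "X \<in> carrier_mat m n"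
  shows "wfrob_norm G X = sqrt (vectorize m n X \<bullet> (kronecker (1\<^sub>m n) G *\<^sub>v vectorize m n X))"
proof -
  have e: "transpose_mat X * G * X = transpose_mat X * (G * X)"
    using G X by (intro assoc_mult_mat) auto
  show ?thesis
    unfolding wfrob_norm_def vectorize_form[OF G X] mat_trace_def e
    using G X by (auto intro!: sum.cong simp: mult_mat_vec_def)
qed

text \<open>A nonzero vector has a nonzero column, which contributes a positive term; the other
  columns contribute nonnegative ones.\<close>

lemma sym_pos_def_kronecker_one:
  assumes G: "sym_pos_def m G"
  shows "sym_pos_def (n * m) (kronecker (1\<^sub>m n) G)"
  unfolding sym_pos_def_def
proof (intro conjI ballI impI)
  note Gc = sym_pos_defD[OF G]
  show "kronecker (1\<^sub>m n) G \<in> carrier_mat (n * m) (n * m)" using Gc(1) by auto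
  show "transpose_mat (kronecker (1\<^sub>m n) G) = kronecker (1\<^sub>m n) G"
    using kronecker_transpose[OF one_carrier_mat Gc(1)] Gc(2) by simp
  fix v :: "real vec" assume v: "v \<in> carrier_vec (n * m)" "v \<noteq> 0\<^sub>v (n * m)"
  obtain X where X: "X \<in> carrier_mat m n" "vectorize m n X = v" by (rule vectorize_surj[OF v(1)])
  have c: "col X j \<in> carrier_vec m" for j using X(1) by auto
  have "\<exists>j<n. col X j \<noteq> 0\<^sub>v m"
  proof (rule ccontr)
    assume "\<not> ?thesis"
    then have z: "col X j = 0\<^sub>v m" if "j < n" for j using that by auto
    have "v = 0\<^sub>v (n * m)"
    proof (rule eq_vecI)
      fix i assume "i < dim_vec (0\<^sub>v (n * m) :: real vec)"
      then have i: "i < n * m" by simp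
      note i' = div_mod_less_product[OF i]
      have "v $ i = col X (i div m) $ (i mod m)" unfolding X(2)[symmetric] using i i' X(1) by (simp add: vectorize_index)
      then show "v $ i = 0\<^sub>v (n * m) $ i" unfolding z[OF i'(1)] using i i' by simp
    qed (use v in simp)
    then show False using v(2) by simp
  qed
  then obtain j where j: "j < n" "col X j \<noteq> 0\<^sub>v m" by auto
  have "0 < (\<Sum>j<n. col X j \<bullet> (G *\<^sub>v col X j))"
    by (rule sum_pos2[of _ j]) (use j Gc(3)[OF c] psdD(3)[OF sym_pos_def_psd[OF G] c] in auto)
  then show "0 < v \<bullet> (kronecker (1\<^sub>m n) G *\<^sub>v v)"
    using vectorize_form[OF Gc(1) X(1)] X(2) by simp
qed

section \<open>Measurability\<close>

text \<open>The dimensions belong to the notion: the entry formulas for sums and products hold only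
  within them, and the type does not record them.\<close>

definition mat_measurable :: "'w measure \<Rightarrow> nat \<Rightarrow> nat \<Rightarrow> ('w \<Rightarrow> real mat) \<Rightarrow> bool" where
  "mat_measurable N r c F \<longleftrightarrow> (\<forall>\<omega>\<in>space N. F \<omega> \<in> carrier_mat r c) \<and>
     (\<forall>i<r. \<forall>j<c. (\<lambda>\<omega>. F \<omega> $$ (i, j)) \<in> borel_measurable N)"

lemma mat_measurableI:
  assumes "\<And>\<omega>. \<omega> \<in> space N \<Longrightarrow> F \<omega> \<in> carrier_mat r c"
    "\<And>i j. i < r \<Longrightarrow> j < c \<Longrightarrow> (\<lambda>\<omega>. F \<omega> $$ (i, j)) \<in> borel_measurable N"
  shows "mat_measurable N r c F"
  using assms by (auto simp: mat_measurable_def)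

lemma mat_measurableD:
  assumes "mat_measurable N r c F"
  shows "\<omega> \<in> space N \<Longrightarrow> F \<omega> \<in> carrier_mat r c"
    "i < r \<Longrightarrow> j < c \<Longrightarrow> (\<lambda>\<omega>. F \<omega> $$ (i, j)) \<in> borel_measurable N"
  using assms by (auto simp: mat_measurable_def)

lemma mat_measurable_const:
  "A \<in> carrier_mat r c \<Longrightarrow> mat_measurable N r c (\<lambda>_. A)"
  by (auto simp: mat_measurable_def)

lemma mat_measurable_transpose:
  assumes F: "mat_measurable N r c F"
  shows "mat_measurable N c r (\<lambda>\<omega>. transpose_mat (F \<omega>))"
proof (rule mat_measurableI)
  fix i j assume ij: "i < c" "j < r"
  have "transpose_mat (F \<omega>) $$ (i, j) = F \<omega> $$ (j, i)" if "\<omega> \<in> space N" for \<omega>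
    using mat_measurableD(1)[OF F that] ij by simp
  then show "(\<lambda>\<omega>. transpose_mat (F \<omega>) $$ (i, j)) \<in> borel_measurable N"
    using mat_measurableD(2)[OF F ij(2,1)] by (subst measurable_cong) auto
qed (use mat_measurableD(1)[OF F] in simp)

lemma mat_measurable_mult:
  assumes F: "mat_measurable N r n F" and G: "mat_measurable N n c G"
  shows "mat_measurable N r c (\<lambda>\<omega>. F \<omega> * G \<omega>)"
proof (rule mat_measurableI)
  fix i j assume ij: "i < r" "j < c"
  have "(\<lambda>\<omega>. \<Sum>k<n. F \<omega> $$ (i, k) * G \<omega> $$ (k, j)) \<in> borel_measurable N"
    using ij mat_measurableD(2)[OF F] mat_measurableD(2)[OF G]
    by (intro borel_measurable_sum borel_measurable_times) auto
  moreover have "(F \<omega> * G \<omega>) $$ (i, j) = (\<Sum>k<n. F \<omega> $$ (i, k) * G \<omega> $$ (k, j))"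
    if "\<omega> \<in> space N" for \<omega>
    by (rule mat_mult_index_sum[OF mat_measurableD(1)[OF F that] mat_measurableD(1)[OF G that] ij])
  ultimately show "(\<lambda>\<omega>. (F \<omega> * G \<omega>) $$ (i, j)) \<in> borel_measurable N"
    by (subst measurable_cong) auto
qed (rule mult_carrier_mat[OF mat_measurableD(1)[OF F] mat_measurableD(1)[OF G]])

lemma mat_measurable_add:
  assumes F: "mat_measurable N r c F" and G: "mat_measurable N r c G"
  shows "mat_measurable N r c (\<lambda>\<omega>. F \<omega> + G \<omega>)"
proof (rule mat_measurableI)
  fix i j assume ij: "i < r" "j < c"
  have "(F \<omega> + G \<omega>) $$ (i, j) = F \<omega> $$ (i, j) + G \<omega> $$ (i, j)" if "\<omega> \<in> space N" for \<omega>
    using mat_measurableD(1)[OF F that] mat_measurableD(1)[OF G that] ij by simp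
  moreover have "(\<lambda>\<omega>. F \<omega> $$ (i, j) + G \<omega> $$ (i, j)) \<in> borel_measurable N"
    using mat_measurableD(2)[OF F ij] mat_measurableD(2)[OF G ij] by (rule borel_measurable_add)
  ultimately show "(\<lambda>\<omega>. (F \<omega> + G \<omega>) $$ (i, j)) \<in> borel_measurable N"
    by (subst measurable_cong) auto
qed (use mat_measurableD(1)[OF F] mat_measurableD(1)[OF G] in auto)

section \<open>Rational functions of a random matrix\<close>

lemma det_measurable:
  assumes F: "mat_measurable N n n F"
  shows "(\<lambda>\<omega>. det (F \<omega>)) \<in> borel_measurable N"
proof -
  have "(\<lambda>\<omega>. \<Sum>p\<in>{p. p permutes {0..<n}}. signof p * (\<Prod>i = 0..<n. F \<omega> $$ (i, p i))) \<in> borel_measurable N"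
    by (intro borel_measurable_sum borel_measurable_times borel_measurable_const borel_measurable_prod
        mat_measurableD(2)[OF F]) (auto simp: permutes_in_image[of _ "{0..<n}", unfolded atLeast0LessThan lessThan_iff] atLeast0LessThan)
  then show ?thesis
    using det_def'[OF mat_measurableD(1)[OF F]] by (subst measurable_cong) auto
qed

lemma adj_mat_measurable:
  assumes F: "mat_measurable N n n F"
  shows "mat_measurable N n n (\<lambda>\<omega>. adj_mat (F \<omega>))"
proof (rule mat_measurableI)
  fix i j assume ij: "i < n" "j < n"
  have "mat_measurable N (n - 1) (n - 1) (\<lambda>\<omega>. mat_delete (F \<omega>) j i)"
  proof (rule mat_measurableI)
    fix a b assume ab: "a < n - 1" "b < n - 1"
    \<comment> \<open>Deleting row \<open>j\<close> and column \<open>i\<close> shifts the later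
      indices by one.\<close>
    define a' b' where "a' = (if a < j then a else Suc a)" and "b' = (if b < i then b else Suc b)"
    have ab': "a' < n" "b' < n" using ab by (auto simp: a'_def b'_def)
    have "mat_delete (F \<omega>) j i $$ (a, b) = F \<omega> $$ (a', b')" if "\<omega> \<in> space N" for \<omega>
      using mat_measurableD(1)[OF F that] ab by (simp add: mat_delete_def a'_def b'_def)
    then show "(\<lambda>\<omega>. mat_delete (F \<omega>) j i $$ (a, b)) \<in> borel_measurable N"
      using mat_measurableD(2)[OF F ab'] by (subst measurable_cong) auto
  qed (rule mat_delete_carrier[OF mat_measurableD(1)[OF F]])
  from det_measurable[OF this]
  have "(\<lambda>\<omega>. (-1) ^ (j + i) * det (mat_delete (F \<omega>) j i)) \<in> borel_measurable N"
    by (intro borel_measurable_times borel_measurable_const)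
  moreover have "adj_mat (F \<omega>) $$ (i, j) = (-1) ^ (j + i) * det (mat_delete (F \<omega>) j i)"
    if "\<omega> \<in> space N" for \<omega>
    using mat_measurableD(1)[OF F that] ij by (simp add: adj_mat_def cofactor_def)
  ultimately show "(\<lambda>\<omega>. adj_mat (F \<omega>) $$ (i, j)) \<in> borel_measurable N"
    by (subst measurable_cong) auto
qed (rule adj_mat(1)[OF mat_measurableD(1)[OF F]])

text \<open>Division by 0 gives 0 and real division is Borel measurable everywhere, so singular
  matrices require no separate treatment.\<close>

lemma det_inv_measurable:
  assumes F: "mat_measurable N n n F"
  shows "mat_measurable N n n (\<lambda>\<omega>. det_inv (F \<omega>))"
proof (rule mat_measurableI)
  note A = adj_mat_measurable[OF F]
  fix i j assume ij: "i < n" "j < n"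
  have "(\<lambda>\<omega>. 1 / det (F \<omega>) * adj_mat (F \<omega>) $$ (i, j)) \<in> borel_measurable N"
    by (intro borel_measurable_times borel_measurable_divide borel_measurable_const
        det_measurable[OF F] mat_measurableD(2)[OF A ij])
  moreover have "det_inv (F \<omega>) $$ (i, j) = 1 / det (F \<omega>) * adj_mat (F \<omega>) $$ (i, j)"
    if "\<omega> \<in> space N" for \<omega>
    using mat_measurableD(1)[OF A that] ij by (simp add: det_inv_def)
  ultimately show "(\<lambda>\<omega>. det_inv (F \<omega>) $$ (i, j)) \<in> borel_measurable N"
    by (subst measurable_cong) auto
next
  fix \<omega> assume "\<omega> \<in> space N"
  then show "det_inv (F \<omega>) \<in> carrier_mat n n"
    using mat_measurableD(1)[OF adj_mat_measurable[OF F]] by (simp add: det_inv_def)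
qed

text \<open>\<open>pinv M * M\<close> projects onto the row space of \<open>M\<close>, which is that
  of \<open>V\<close> because \<open>W\<close> is definite. Concretely, the defect
  \<open>D = V E - V\<close> satisfies \<open>V^T W D = M E - M = 0\<close>, hence
  \<open>D^T W D = 0\<close>, and definiteness kills each column of \<open>D\<close>.\<close>

lemma pinv_gram_range:
  assumes W: "sym_pos_def m W" and V: "V \<in> carrier_mat m c"
  defines "M \<equiv> transpose_mat V * W * V"
  shows "V * (pinv M * M) = V"
proof -
  note Wc = sym_pos_defD[OF W]
  note M = gram_symmetric[OF Wc(1,2) V, folded M_def]
  note N = pinv_symmetric[OF M]
  define E where "E = pinv M * M"
  have E: "E \<in> carrier_mat c c" using N(1) M(1) by (simp add: E_def)
  have ME: "M * E = M" unfolding E_def using N(3) N(1) M(1) by simp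
  have VE: "V * E \<in> carrier_mat m c" using V E by simp
  define D where "D = V * E - V"
  have D: "D \<in> carrier_mat m c" unfolding D_def by (rule minus_carrier_mat[OF V])
  have WD: "W * D \<in> carrier_mat m c" using Wc(1) D by simp
  have "transpose_mat V * W * D = transpose_mat V * W * (V * E) - M"
    unfolding D_def M_def by (rule mult_minus_distrib_mat[OF _ VE V, of _ c]) (use V Wc(1) in auto)
  also have "transpose_mat V * W * (V * E) = M * E"
    unfolding M_def
    by (simp add: mult_mat_assoc_dim carrier_matD[OF V] carrier_matD[OF Wc(1)] carrier_matD[OF E])
  also have "M * E - M = 0\<^sub>m c c" unfolding ME using M(1) by (intro eq_matI) auto
  finally have VWD: "transpose_mat V * W * D = 0\<^sub>m c c" .
  have "transpose_mat D * (W * D) = (transpose_mat (V * E) - transpose_mat V) * (W * D)"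
    unfolding D_def using transpose_minus[OF VE V] by simp
  also have "\<dots> = transpose_mat (V * E) * (W * D) - transpose_mat V * (W * D)"
    by (rule minus_mult_distrib_mat[OF _ _ WD, of _ c]) (simp_all only: transpose_carrier_mat VE V)
  also have "transpose_mat (V * E) * (W * D) = transpose_mat E * (transpose_mat V * W * D)"
    by (simp add: transpose_mult[OF V E] mult_mat_assoc_dim carrier_matD[OF V]
        carrier_matD[OF Wc(1)] carrier_matD[OF E] carrier_matD[OF D])
  also have "transpose_mat V * (W * D) = transpose_mat V * W * D"
    by (simp add: mult_mat_assoc_dim carrier_matD[OF V] carrier_matD[OF Wc(1)] carrier_matD[OF D])
  finally have DWD: "transpose_mat D * (W * D) = 0\<^sub>m c c" unfolding VWD using E by simp
  have "D = 0\<^sub>m m c"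
  proof (rule eq_matI)
    fix i j assume "i < dim_row (0\<^sub>m m c :: real mat)" "j < dim_col (0\<^sub>m m c :: real mat)"
    then have ij: "i < m" "j < c" by auto
    have "col D j \<bullet> (W *\<^sub>v col D j) = (transpose_mat D * (W * D)) $$ (j, j)"
      using D Wc(1) ij by (simp add: mult_mat_vec_def)
    then have "col D j \<bullet> (W *\<^sub>v col D j) = 0" unfolding DWD using ij by simp
    moreover have "col D j \<in> carrier_vec m" using D by auto
    ultimately have "col D j = 0\<^sub>v m" using Wc(3)[of "col D j"] by auto
    then have "col D j $ i = 0" using ij by simp
    then show "D $$ (i, j) = 0\<^sub>m m c $$ (i, j)" using D ij by simp
  qed (use D in auto)
  then have "D $$ (i, j) = 0" if "i < m" "j < c" for i j using that by simp
  moreover have "D $$ (i, j) = (V * E) $$ (i, j) - V $$ (i, j)" if "i < m" "j < c" for i j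
    unfolding D_def using V that by (intro index_minus_mat) auto
  ultimately have "(V * E) $$ (i, j) = V $$ (i, j)" if "i < m" "j < c" for i j using that by simp
  then show ?thesis unfolding E_def[symmetric] using VE V by (intro eq_matI) auto
qed

lemma psd_plus_smult_one:
  assumes M: "psd c M" and \<epsilon>: "\<epsilon> > 0"
  shows "sym_pos_def c (M + \<epsilon> \<cdot>\<^sub>m 1\<^sub>m c)"
    and "x \<in> carrier_vec c \<Longrightarrow> \<epsilon> * (x \<bullet> x) \<le> x \<bullet> ((M + \<epsilon> \<cdot>\<^sub>m 1\<^sub>m c) *\<^sub>v x)"
proof -
  note Mc = psdD[OF M]
  have form: "x \<bullet> ((M + \<epsilon> \<cdot>\<^sub>m 1\<^sub>m c) *\<^sub>v x) = x \<bullet> (M *\<^sub>v x) + \<epsilon> * (x \<bullet> x)"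
    if x: "x \<in> carrier_vec c" for x
  proof -
    have "(M + \<epsilon> \<cdot>\<^sub>m 1\<^sub>m c) *\<^sub>v x = M *\<^sub>v x + (\<epsilon> \<cdot>\<^sub>m 1\<^sub>m c) *\<^sub>v x"
      by (rule add_mult_distrib_mat_vec) (use Mc(1) x in auto)
    also have "(\<epsilon> \<cdot>\<^sub>m 1\<^sub>m c) *\<^sub>v x = \<epsilon> \<cdot>\<^sub>v x"
      using x by (intro eq_vecI) (auto simp: smult_scalar_prod_distrib[of _ c])
    finally have e: "(M + \<epsilon> \<cdot>\<^sub>m 1\<^sub>m c) *\<^sub>v x = M *\<^sub>v x + \<epsilon> \<cdot>\<^sub>v x" .
    have "x \<bullet> (M *\<^sub>v x + \<epsilon> \<cdot>\<^sub>v x) = x \<bullet> (M *\<^sub>v x) + x \<bullet> (\<epsilon> \<cdot>\<^sub>v x)"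
      by (rule scalar_prod_add_distrib[OF x mult_mat_vec_carrier[OF Mc(1) x]]) (use x in simp)
    then show ?thesis unfolding e using x by simp
  qed
  show "x \<in> carrier_vec c \<Longrightarrow> \<epsilon> * (x \<bullet> x) \<le> x \<bullet> ((M + \<epsilon> \<cdot>\<^sub>m 1\<^sub>m c) *\<^sub>v x)" for x
    using form Mc(3) by simp
  show "sym_pos_def c (M + \<epsilon> \<cdot>\<^sub>m 1\<^sub>m c)"
    unfolding sym_pos_def_def
  proof (intro conjI ballI impI)
    show "M + \<epsilon> \<cdot>\<^sub>m 1\<^sub>m c \<in> carrier_mat c c" using Mc(1) by simp
    have "transpose_mat (M + \<epsilon> \<cdot>\<^sub>m 1\<^sub>m c) = transpose_mat M + transpose_mat (\<epsilon> \<cdot>\<^sub>m 1\<^sub>m c)"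
      by (rule transpose_add) (use Mc(1) in auto)
    also have "transpose_mat (\<epsilon> \<cdot>\<^sub>m 1\<^sub>m c) = \<epsilon> \<cdot>\<^sub>m 1\<^sub>m c" by (intro eq_matI) auto
    finally show "transpose_mat (M + \<epsilon> \<cdot>\<^sub>m 1\<^sub>m c) = M + \<epsilon> \<cdot>\<^sub>m 1\<^sub>m c" unfolding Mc(2) .
    fix x :: "real vec" assume x: "x \<in> carrier_vec c" "x \<noteq> 0\<^sub>v c"
    have "x \<bullet> x \<noteq> 0" using scalar_prod_self_eq_0[OF x(1)] x(2) by auto
    then have "0 < x \<bullet> x" using scalar_prod_self_nonneg[of x] by simp
    then show "0 < x \<bullet> ((M + \<epsilon> \<cdot>\<^sub>m 1\<^sub>m c) *\<^sub>v x)"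
      unfolding form[OF x(1)] using Mc(3)[OF x(1)] \<epsilon> by (simp add: add_nonneg_pos)
  qed
qed

text \<open>The eigenvalues of this matrix lie in [0, 1], but the estimate is made on entries. With
  \<open>u = R e_i\<close>, the chain \<open>\<epsilon> R_ii^2 \<le> \<epsilon> (u \<bullet> u)
  \<le> u \<bullet> H u = R_ii\<close> bounds the diagonal, and Cauchy-Schwarz in the form
  \<open>R_ab^2 \<le> R_aa R_bb\<close> bounds the other entries.\<close>

lemma regularized_inverse_bound:
  assumes M: "psd c M" and \<epsilon>: "\<epsilon> > 0" and ab: "a < c" "b < c"
  shows "\<bar>\<epsilon> * det_inv (M + \<epsilon> \<cdot>\<^sub>m 1\<^sub>m c) $$ (a, b)\<bar> \<le> 1"
proof -
  define H where "H = M + \<epsilon> \<cdot>\<^sub>m 1\<^sub>m c"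
  define R where "R = det_inv H"
  note P = psd_plus_smult_one[OF M \<epsilon>, folded H_def]
  note Hc = sym_pos_defD[OF P(1)]
  note R = det_inv[OF Hc(1) sym_pos_def_det[OF P(1)], folded R_def]
  have d: "0 \<le> R $$ (i, i) \<and> \<epsilon> * R $$ (i, i) \<le> 1" if i: "i < c" for i
  proof -
    define u where "u = R *\<^sub>v unit_vec c i"
    have u: "u \<in> carrier_vec c" using R(1) unfolding u_def by auto
    have "H *\<^sub>v u = (H * R) *\<^sub>v unit_vec c i" unfolding u_def using Hc(1) R(1) by simp
    then have Hu: "H *\<^sub>v u = unit_vec c i" unfolding R(2) by simp
    have ui: "u $ i = R $$ (i, i)" using R(1) i by (simp add: u_def)
    have "(u $ i)\<^sup>2 \<le> (\<Sum>k<c. (u $ k)\<^sup>2)" using i by (intro member_le_sum) auto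
    also have "\<dots> = u \<bullet> u" using u by (simp add: scalar_prod_def lessThan_atLeast0 power2_eq_square)
    finally have "\<epsilon> * (R $$ (i, i))\<^sup>2 \<le> \<epsilon> * (u \<bullet> u)" unfolding ui using \<epsilon> by simp
    also have "\<dots> \<le> u \<bullet> (H *\<^sub>v u)" by (rule P(2)[OF u])
    also have "\<dots> = R $$ (i, i)" unfolding Hu using i ui by simp
    finally have *: "\<epsilon> * (R $$ (i, i))\<^sup>2 \<le> R $$ (i, i)" .
    then have nonneg: "0 \<le> R $$ (i, i)" using \<epsilon> by (smt (verit) mult_nonneg_nonneg zero_le_power2)
    have "\<epsilon> * R $$ (i, i) \<le> 1"
    proof (cases "R $$ (i, i) = 0")
      case False
      then have "0 < R $$ (i, i)" using nonneg by simp
      moreover have "(\<epsilon> * R $$ (i, i)) * R $$ (i, i) \<le> 1 * R $$ (i, i)"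
        using * by (simp add: power2_eq_square)
      ultimately show ?thesis using mult_right_le_imp_le by blast
    qed simp
    with nonneg show ?thesis by simp
  qed
  define v where "v = R *\<^sub>v unit_vec c b"
  have v: "v \<in> carrier_vec c" using R(1) unfolding v_def by auto
  have "H *\<^sub>v v = (H * R) *\<^sub>v unit_vec c b" unfolding v_def using Hc(1) R(1) by simp
  then have Hv: "H *\<^sub>v v = unit_vec c b" unfolding R(2) by simp
  have vi: "v $ i = R $$ (i, b)" if "i < c" for i using R(1) ab that by (simp add: v_def)
  have "(R $$ (a, b))\<^sup>2 \<le> R $$ (a, a) * R $$ (b, b)"
    using sym_pos_def_index_bound[OF P(1) R v ab(1)] ab unfolding Hv by (simp add: vi)
  then have "\<epsilon>\<^sup>2 * (R $$ (a, b))\<^sup>2 \<le> \<epsilon>\<^sup>2 * (R $$ (a, a) * R $$ (b, b))" by (intro mult_left_mono) auto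
  also have "\<dots> = (\<epsilon> * R $$ (a, a)) * (\<epsilon> * R $$ (b, b))" by (simp add: power2_eq_square)
  also have "\<dots> \<le> 1 * 1" using d[OF ab(1)] d[OF ab(2)] \<epsilon> by (intro mult_mono) auto
  finally have "(\<epsilon> * R $$ (a, b))\<^sup>2 \<le> 1" by (simp add: power_mult_distrib)
  then show ?thesis unfolding R_def H_def by (simp add: abs_square_le_1)
qed

text \<open>Tikhonov regularisation: \<open>V (M + \<epsilon> I)\<^sup>-\<^sup>1 V\<^sup>T\<close> is a rational function of \<open>V\<close> that differs
  from \<open>V M\<^sup>+ V\<^sup>T\<close> by \<open>O(\<epsilon>)\<close>, because \<open>V = V M\<^sup>+ M\<close> and \<open>\<epsilon> (M + \<epsilon> I)\<^sup>-\<^sup>1\<close> is bounded.\<close>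

lemma regularized_error:
  assumes W: "sym_pos_def m W" and V: "V \<in> carrier_mat m c" and ij: "i < m" "j < m"
  defines "M \<equiv> transpose_mat V * W * V"
  obtains K where "\<And>\<epsilon>. \<epsilon> > 0 \<Longrightarrow>
    \<bar>(V * det_inv (M + \<epsilon> \<cdot>\<^sub>m 1\<^sub>m c) * transpose_mat V) $$ (i, j) - (V * pinv M * transpose_mat V) $$ (i, j)\<bar> \<le> \<epsilon> * K"
proof -
  note Wc = sym_pos_defD[OF W]
  note M = gram_symmetric[OF Wc(1,2) V, folded M_def]
  have Mpsd: "psd c M"
    unfolding psd_def
  proof (intro conjI ballI M)
    fix x :: "real vec" assume x: "x \<in> carrier_vec c"
    have Vx: "V *\<^sub>v x \<in> carrier_vec m" using V x by (rule mult_mat_vec_carrier)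
    have "M *\<^sub>v x = transpose_mat V *\<^sub>v (W *\<^sub>v (V *\<^sub>v x))"
      unfolding M_def using V Wc(1) x by (simp add: mult_mat_vec_assoc_dim)
    moreover have "x \<bullet> (transpose_mat V *\<^sub>v (W *\<^sub>v (V *\<^sub>v x))) = (V *\<^sub>v x) \<bullet> (W *\<^sub>v (V *\<^sub>v x))"
      using scalar_prod_mult_mat_vec[of "transpose_mat V" c m x "W *\<^sub>v (V *\<^sub>v x)"]
        mult_mat_vec_carrier[OF Wc(1) Vx] V x by simp
    ultimately show "0 \<le> x \<bullet> (M *\<^sub>v x)"
      using psdD(3)[OF sym_pos_def_psd[OF W] Vx] by simp
  qed
  define N where "N = pinv M"
  note N = pinv_symmetric[OF M, folded N_def]
  \<comment> \<open>\<open>V = Y M\<close> by \<open>pinv_gram_range\<close>, so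
    \<open>V R V^T = Y (M R M) Y^T\<close>: the regularised inverse \<open>R\<close> occurs only
    between two factors \<open>M\<close>, where it stays controlled as \<open>\<epsilon>\<close>
    tends to 0.\<close>
  define Y where "Y = V * N"
  have Y: "Y \<in> carrier_mat m c" using V N(1) by (simp add: Y_def)
  have Yt: "transpose_mat Y = N * transpose_mat V"
    unfolding Y_def using transpose_mult[OF V N(1)] N(2) by simp
  \<comment> \<open>The error will be the entry of \<open>\<epsilon> (Y L Y^T - Y Y^T)\<close>,
    where the entries of \<open>L = \<epsilon> R\<close> are at most 1 in absolute value;
    \<open>K\<close> is the resulting bound, free of \<open>\<epsilon>\<close>.\<close>
  define K where "K = \<bar>(Y * transpose_mat Y) $$ (i, j)\<bar> + (\<Sum>a<c. \<Sum>b<c. \<bar>Y $$ (i, a)\<bar> * \<bar>Y $$ (j, b)\<bar>)"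
  show ?thesis
  proof (rule that[of K])
    fix \<epsilon> :: real assume \<epsilon>: "\<epsilon> > 0"
    define H where "H = M + \<epsilon> \<cdot>\<^sub>m 1\<^sub>m c"
    define R where "R = det_inv H"
    note P = psd_plus_smult_one[OF Mpsd \<epsilon>, folded H_def]
    note Hc = sym_pos_defD[OF P(1)]
    note R = det_inv[OF Hc(1) sym_pos_def_det[OF P(1)], folded R_def]
    have dims: "dim_row V = m" "dim_col V = c" "dim_row N = c" "dim_col N = c" "dim_row R = c"
      "dim_col R = c" "dim_row M = c" "dim_col M = c" "dim_row Y = m" "dim_col Y = c"
      using V N(1) R(1) M(1) Y by auto
    have MR: "M * R = 1\<^sub>m c - \<epsilon> \<cdot>\<^sub>m R"
    proof -
      have "H * R = M * R + (\<epsilon> \<cdot>\<^sub>m 1\<^sub>m c) * R"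
        unfolding H_def by (rule add_mult_distrib_mat) (use M R in auto)
      also have "(\<epsilon> \<cdot>\<^sub>m 1\<^sub>m c) * R = \<epsilon> \<cdot>\<^sub>m (1\<^sub>m c * R)" by (rule mult_smult_assoc_mat) (use R in auto)
      finally have "1\<^sub>m c = M * R + \<epsilon> \<cdot>\<^sub>m R" unfolding R(2) using R(1) by simp
      then show ?thesis using M(1) R(1) by (intro eq_matI) (auto simp del: index_mult_mat(1))
    qed
    have RM: "R * M = 1\<^sub>m c - \<epsilon> \<cdot>\<^sub>m R"
    proof -
      have "R * H = R * M + R * (\<epsilon> \<cdot>\<^sub>m 1\<^sub>m c)"
        unfolding H_def by (rule mult_add_distrib_mat) (use M R in auto)
      also have "R * (\<epsilon> \<cdot>\<^sub>m 1\<^sub>m c) = \<epsilon> \<cdot>\<^sub>m (R * 1\<^sub>m c)" by (rule mult_smult_distrib) (use R in auto)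
      finally have "1\<^sub>m c = R * M + \<epsilon> \<cdot>\<^sub>m R" unfolding R(3) using R(1) by simp
      then show ?thesis using M(1) R(1) by (intro eq_matI) (auto simp del: index_mult_mat(1))
    qed
    define L where "L = \<epsilon> \<cdot>\<^sub>m R"
    have L: "L \<in> carrier_mat c c" using R(1) by (simp add: L_def)
    \<comment> \<open>Using \<open>R M = M R = 1 - \<epsilon> R\<close> once on each side leaves
      \<open>M\<close> and a correction of order \<open>\<epsilon>\<close>.\<close>
    have "M * R * M = M - \<epsilon> \<cdot>\<^sub>m 1\<^sub>m c + \<epsilon> \<cdot>\<^sub>m L"
    proof -
      have "M * R * M = M * (R * M)" using M(1) R(1) by simp
      also have "\<dots> = M * 1\<^sub>m c - M * (\<epsilon> \<cdot>\<^sub>m R)" unfolding RM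
        by (rule mult_minus_distrib_mat) (use M R in auto)
      also have "M * (\<epsilon> \<cdot>\<^sub>m R) = \<epsilon> \<cdot>\<^sub>m (M * R)" by (rule mult_smult_distrib) (use M R in auto)
      finally show ?thesis unfolding MR L_def using M(1) R(1)
        by (intro eq_matI) (auto simp: algebra_simps)
    qed
    then have MRM: "M * R * M = M + \<epsilon> \<cdot>\<^sub>m (L - 1\<^sub>m c)"
      using M(1) L by (intro eq_matI) (auto simp: algebra_simps simp del: index_mult_mat(1))
    have VE: "V = Y * M"
      using pinv_gram_range[OF W V] unfolding M_def[symmetric] N_def[symmetric] Y_def
      by (simp add: mult_mat_assoc_dim dims)
    have VtE: "transpose_mat V = M * transpose_mat Y"
      using transpose_mult[OF Y M(1)] M(2) VE by simp
    have "V * R * transpose_mat V = (Y * M) * R * (M * transpose_mat Y)"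
      using VE VtE by simp
    also have "\<dots> = Y * (M * R * M) * transpose_mat Y" by (simp add: mult_mat_assoc_dim dims)
    also have "\<dots> = (Y * M + \<epsilon> \<cdot>\<^sub>m (Y * (L - 1\<^sub>m c))) * transpose_mat Y"
    proof -
      have "Y * (M + \<epsilon> \<cdot>\<^sub>m (L - 1\<^sub>m c)) = Y * M + Y * (\<epsilon> \<cdot>\<^sub>m (L - 1\<^sub>m c))"
        by (rule mult_add_distrib_mat) (use Y M L in auto)
      also have "Y * (\<epsilon> \<cdot>\<^sub>m (L - 1\<^sub>m c)) = \<epsilon> \<cdot>\<^sub>m (Y * (L - 1\<^sub>m c))"
        by (rule mult_smult_distrib[OF Y]) (use L in auto)
      finally show ?thesis unfolding MRM by simp
    qed
    also have "\<dots> = Y * M * transpose_mat Y + (\<epsilon> \<cdot>\<^sub>m (Y * (L - 1\<^sub>m c))) * transpose_mat Y"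
      by (rule add_mult_distrib_mat) (use Y M L in auto)
    also have "(\<epsilon> \<cdot>\<^sub>m (Y * (L - 1\<^sub>m c))) * transpose_mat Y = \<epsilon> \<cdot>\<^sub>m (Y * (L - 1\<^sub>m c) * transpose_mat Y)"
      by (rule mult_smult_assoc_mat) (use Y L in auto)
    also have "Y * (L - 1\<^sub>m c) = Y * L - Y"
    proof -
      have "Y * (L - 1\<^sub>m c) = Y * L - Y * 1\<^sub>m c" by (rule mult_minus_distrib_mat) (use Y L in auto)
      then show ?thesis using right_mult_one_mat[OF Y] by simp
    qed
    also have "(Y * L - Y) * transpose_mat Y = Y * L * transpose_mat Y - Y * transpose_mat Y"
      by (rule minus_mult_distrib_mat) (use Y L in auto)
    also have "Y * M * transpose_mat Y = V * N * transpose_mat V"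
      using VE Yt by (simp add: mult_mat_assoc_dim dims)
    finally have "(V * R * transpose_mat V) $$ (i, j) - (V * N * transpose_mat V) $$ (i, j)
      = \<epsilon> * ((Y * L * transpose_mat Y) $$ (i, j) - (Y * transpose_mat Y) $$ (i, j))"
      using ij dims L by (simp del: index_mult_mat(1) add: index_mult_mat(2,3))
    moreover have "\<bar>(Y * L * transpose_mat Y) $$ (i, j)\<bar> \<le> (\<Sum>a<c. \<Sum>b<c. \<bar>Y $$ (i, a)\<bar> * \<bar>Y $$ (j, b)\<bar>)"
    proof -
      have YL: "Y * L \<in> carrier_mat m c" and Ytc: "transpose_mat Y \<in> carrier_mat c m" using Y L by auto
      have "(Y * L * transpose_mat Y) $$ (i, j) = (\<Sum>b<c. (\<Sum>a<c. Y $$ (i, a) * L $$ (a, b)) * Y $$ (j, b))"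
        unfolding mat_mult_index_sum[OF YL Ytc ij]
        using Y ij by (intro sum.cong) (auto simp: mat_mult_index_sum[OF Y L] simp del: index_mult_mat(1))
      also have "\<dots> = (\<Sum>a<c. \<Sum>b<c. Y $$ (i, a) * L $$ (a, b) * Y $$ (j, b))"
        unfolding sum_distrib_right by (rule sum.swap)
      also have "\<bar>\<dots>\<bar> \<le> (\<Sum>a<c. \<Sum>b<c. \<bar>Y $$ (i, a) * L $$ (a, b) * Y $$ (j, b)\<bar>)"
        by (rule order_trans[OF sum_abs sum_mono]) (rule sum_abs)
      also have "\<dots> \<le> (\<Sum>a<c. \<Sum>b<c. \<bar>Y $$ (i, a)\<bar> * \<bar>Y $$ (j, b)\<bar>)"
      proof (intro sum_mono)
        fix a b assume ab: "a \<in> {..<c}" "b \<in> {..<c}"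
        have "\<bar>L $$ (a, b)\<bar> \<le> 1"
          using regularized_inverse_bound[OF Mpsd \<epsilon>, of a b] ab R(1)
          by (simp add: L_def R_def H_def)
        then have "\<bar>Y $$ (i, a)\<bar> * \<bar>L $$ (a, b)\<bar> * \<bar>Y $$ (j, b)\<bar> \<le> \<bar>Y $$ (i, a)\<bar> * 1 * \<bar>Y $$ (j, b)\<bar>"
          by (intro mult_right_mono mult_left_mono) auto
        then show "\<bar>Y $$ (i, a) * L $$ (a, b) * Y $$ (j, b)\<bar> \<le> \<bar>Y $$ (i, a)\<bar> * \<bar>Y $$ (j, b)\<bar>"
          by (simp add: abs_mult)
      qed
      finally show ?thesis .
    qed
    ultimately have "\<bar>(V * R * transpose_mat V) $$ (i, j) - (V * N * transpose_mat V) $$ (i, j)\<bar> \<le> \<epsilon> * K"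
      using \<epsilon> by (simp add: abs_mult K_def del: index_mult_mat(1))
    then show "\<bar>(V * det_inv (M + \<epsilon> \<cdot>\<^sub>m 1\<^sub>m c) * transpose_mat V) $$ (i, j) - (V * pinv M * transpose_mat V) $$ (i, j)\<bar> \<le> \<epsilon> * K"
      by (simp add: R_def N_def H_def del: index_mult_mat(1))
  qed
qed

text \<open>A pointwise limit suffices, so the constant of \<open>regularized_error\<close> may
  depend on the sample point, and no uniformity near a change of rank is required.\<close>

lemma weighted_proj_measurable:
  assumes W: "sym_pos_def m W" and V: "mat_measurable \<Omega> m c V"
  shows "mat_measurable \<Omega> m m (\<lambda>\<omega>. weighted_proj W (V \<omega>))"
proof -
  note Wc = sym_pos_defD[OF W]
  have Wm: "mat_measurable \<Omega> m m (\<lambda>_. W)" by (rule mat_measurable_const[OF Wc(1)])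
  note Vt = mat_measurable_transpose[OF V]
  define M where "M \<omega> = transpose_mat (V \<omega>) * W * V \<omega>" for \<omega>
  have M: "mat_measurable \<Omega> c c M" unfolding M_def
    by (rule mat_measurable_mult[OF mat_measurable_mult[OF Vt Wm] V])
  define \<epsilon> :: "nat \<Rightarrow> real" where "\<epsilon> k = 1 / real (Suc k)" for k
  have \<epsilon>: "\<epsilon> k > 0" for k by (simp add: \<epsilon>_def)
  have \<epsilon>0: "\<epsilon> \<longlonglongrightarrow> 0" unfolding \<epsilon>_def by (rule LIMSEQ_Suc[OF lim_1_over_n])
  have P: "mat_measurable \<Omega> m m (\<lambda>\<omega>. V \<omega> * pinv (M \<omega>) * transpose_mat (V \<omega>))"
  proof (rule mat_measurableI)
    fix i j assume ij: "i < m" "j < m"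
    show "(\<lambda>\<omega>. (V \<omega> * pinv (M \<omega>) * transpose_mat (V \<omega>)) $$ (i, j)) \<in> borel_measurable \<Omega>"
    proof (rule borel_measurable_LIMSEQ_real)
      fix k
      have "mat_measurable \<Omega> c c (\<lambda>\<omega>. M \<omega> + \<epsilon> k \<cdot>\<^sub>m 1\<^sub>m c)"
        by (rule mat_measurable_add[OF M mat_measurable_const]) simp
      from mat_measurable_mult[OF mat_measurable_mult[OF V det_inv_measurable[OF this]] Vt]
      show "(\<lambda>\<omega>. (V \<omega> * det_inv (M \<omega> + \<epsilon> k \<cdot>\<^sub>m 1\<^sub>m c) * transpose_mat (V \<omega>)) $$ (i, j)) \<in> borel_measurable \<Omega>"
        using ij by (rule mat_measurableD(2))
    next
      fix \<omega> assume "\<omega> \<in> space \<Omega>"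
      from regularized_error[OF W mat_measurableD(1)[OF V this] ij]
      obtain K where K: "\<And>\<epsilon>. \<epsilon> > 0 \<Longrightarrow>
        \<bar>(V \<omega> * det_inv (M \<omega> + \<epsilon> \<cdot>\<^sub>m 1\<^sub>m c) * transpose_mat (V \<omega>)) $$ (i, j)
          - (V \<omega> * pinv (M \<omega>) * transpose_mat (V \<omega>)) $$ (i, j)\<bar> \<le> \<epsilon> * K"
        unfolding M_def[symmetric] by blast
      have "(\<lambda>k. (V \<omega> * det_inv (M \<omega> + \<epsilon> k \<cdot>\<^sub>m 1\<^sub>m c) * transpose_mat (V \<omega>)) $$ (i, j)
          - (V \<omega> * pinv (M \<omega>) * transpose_mat (V \<omega>)) $$ (i, j)) \<longlonglongrightarrow> 0"
      proof (rule Lim_null_comparison)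
        show "(\<lambda>k. \<epsilon> k * K) \<longlonglongrightarrow> 0" by (rule tendsto_mult_left_zero[OF \<epsilon>0])
      qed (use K[OF \<epsilon>] in \<open>simp del: index_mult_mat(1)\<close>)
      then show "(\<lambda>k. (V \<omega> * det_inv (M \<omega> + \<epsilon> k \<cdot>\<^sub>m 1\<^sub>m c) * transpose_mat (V \<omega>)) $$ (i, j))
          \<longlonglongrightarrow> (V \<omega> * pinv (M \<omega>) * transpose_mat (V \<omega>)) $$ (i, j)"
        by (rule LIM_zero_cancel)
    qed
  next
    fix \<omega> assume "\<omega> \<in> space \<Omega>"
    note v = mat_measurableD(1)[OF V this]
    show "V \<omega> * pinv (M \<omega>) * transpose_mat (V \<omega>) \<in> carrier_mat m m"
      using v by (intro mult_carrier_mat[of _ m c] pinv_symmetric(1))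
        (auto simp: M_def gram_symmetric(2)[OF Wc(1,2) v] intro: gram_symmetric(1)[OF Wc(1,2) v])
  qed
  have eq: "weighted_proj W (V \<omega>) = W * (V \<omega> * pinv (M \<omega>) * transpose_mat (V \<omega>))"
    if "\<omega> \<in> space \<Omega>" for \<omega>
  proof -
    note v = mat_measurableD(1)[OF V that]
    have "pinv (M \<omega>) \<in> carrier_mat c c"
      unfolding M_def by (rule pinv_symmetric(1)[OF gram_symmetric[OF Wc(1,2) v]])
    then show ?thesis
      unfolding weighted_proj_def M_def[symmetric] using v Wc(1) by (simp add: mult_mat_assoc_dim)
  qed
  note Q = mat_measurable_mult[OF Wm P]
  show ?thesis
  proof (rule mat_measurableI)
    fix i j assume ij: "i < m" "j < m"
    show "(\<lambda>\<omega>. weighted_proj W (V \<omega>) $$ (i, j)) \<in> borel_measurable \<Omega>"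
      using mat_measurableD(2)[OF Q ij] by (subst measurable_cong[OF arg_cong[OF eq]])
  qed (use mat_measurableD(1)[OF Q] eq in simp)
qed

section \<open>The measurable space of matrices with a varying number of columns\<close>

lemma mat_borel_generator:
  "{carrier_mat r c | c. True} \<union>
      {{M \<in> carrier_mat r c. M $$ (i, j) \<in> U} | c i j U. i < r \<and> j < c \<and> open U}
    \<subseteq> Pow {M :: real mat. dim_row M = r}"
  by auto

lemma space_mat_borel: "space (mat_borel r) = {M. dim_row M = r}"
  unfolding mat_borel_def by (rule space_measure_of[OF mat_borel_generator])

lemma sets_mat_borel_basic:
  "carrier_mat r c \<in> sets (mat_borel r)"
  "i < r \<Longrightarrow> j < c \<Longrightarrow> open U \<Longrightarrow> {M \<in> carrier_mat r c. M $$ (i, j) \<in> U} \<in> sets (mat_borel r)"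
  unfolding mat_borel_def sets_measure_of[OF mat_borel_generator]
  by (rule sigma_sets.Basic; blast)+

lemma carrier_mat_Int_space: "carrier_mat r c \<inter> space (mat_borel r) \<in> sets (mat_borel r)"
  by (rule sets.Int[OF sets_mat_borel_basic(1) sets.top])

text \<open>On a piece with a fixed number of columns, the preimage of an open set under an entry is
  itself a generator.\<close>

lemma mat_measurable_id:
  "mat_measurable (restrict_space (mat_borel r) (carrier_mat r c)) r c (\<lambda>M. M)"
proof (rule mat_measurableI)
  fix i j assume ij: "i < r" "j < c"
  show "(\<lambda>M. M $$ (i, j)) \<in> borel_measurable (restrict_space (mat_borel r) (carrier_mat r c))"
  proof (rule borel_measurableI)
    fix U :: "real set" assume U: "open U"
    have "(\<lambda>M. M $$ (i, j)) -` U \<inter> space (restrict_space (mat_borel r) (carrier_mat r c))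
      = {M \<in> carrier_mat r c. M $$ (i, j) \<in> U}"
      by (auto simp: space_restrict_space space_mat_borel)
    then show "(\<lambda>M. M $$ (i, j)) -` U \<inter> space (restrict_space (mat_borel r) (carrier_mat r c))
      \<in> sets (restrict_space (mat_borel r) (carrier_mat r c))"
      using sets_mat_borel_basic(2)[OF ij U] sets_restrict_space_iff[OF carrier_mat_Int_space, of _ r c]
      by auto
  qed
qed (simp add: space_restrict_space)

text \<open>The pieces with a fixed number of columns are measurable and countably many. This
  reduces a random number of columns to results for fixed dimensions.\<close>

lemma mat_measurable_mat_borelI:
  assumes "\<And>c. mat_measurable (restrict_space (mat_borel r) (carrier_mat r c)) a b F"
  shows "mat_measurable (mat_borel r) a b F"
proof (rule mat_measurableI)
  fix M :: "real mat" assume "M \<in> space (mat_borel r)"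
  then have "M \<in> space (restrict_space (mat_borel r) (carrier_mat r (dim_col M)))"
    by (auto simp: space_restrict_space space_mat_borel)
  then show "F M \<in> carrier_mat a b" by (rule mat_measurableD(1)[OF assms])
next
  fix i j assume ij: "i < a" "j < b"
  show "(\<lambda>M. F M $$ (i, j)) \<in> borel_measurable (mat_borel r)"
  proof (rule measurable_piecewise_restrict[of "range (carrier_mat r)"])
    fix \<Omega> :: "real mat set" assume "\<Omega> \<in> range (carrier_mat r)"
    then obtain c where c: "\<Omega> = carrier_mat r c" by auto
    show "\<Omega> \<inter> space (mat_borel r) \<in> sets (mat_borel r)"
      unfolding c by (rule carrier_mat_Int_space)
    show "(\<lambda>M. F M $$ (i, j)) \<in> borel_measurable (restrict_space (mat_borel r) \<Omega>)"
      unfolding c by (rule mat_measurableD(2)[OF assms ij])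
  qed (auto simp: space_mat_borel)
qed

section \<open>The sketch operators as random projections\<close>

lemma Z1'_eq_weighted_proj:
  assumes A: "A \<in> carrier_mat p m" and G: "sym_pos_def m G" and S: "S \<in> carrier_mat p c"
  shows "Z1' A G S = weighted_proj (mat_inv G) (transpose_mat A * S)"
proof -
  note Gc = sym_pos_defD[OF G]
  note B = mat_inv[OF Gc(1) sym_pos_def_det[OF G]]
  note W = sym_pos_defD[OF sym_pos_def_inverse[OF G B]]
  have V: "transpose_mat A * S \<in> carrier_mat m c" using A S by simp
  note N = pinv_symmetric(1)[OF gram_symmetric[OF W(1,2) V]]
  note d = carrier_matD[OF A] carrier_matD[OF S] carrier_matD[OF W(1)]
  have e: "transpose_mat (transpose_mat A * S) = transpose_mat S * A"
    by (simp add: transpose_mult_dim d)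
  have e2: "transpose_mat S * A * mat_inv G * transpose_mat A * S
    = transpose_mat (transpose_mat A * S) * mat_inv G * (transpose_mat A * S)"
    unfolding e by (simp add: mult_mat_assoc_dim d)
  show ?thesis
    unfolding Z1'_def weighted_proj_def e2
    using carrier_matD[OF N] by (simp add: e mult_mat_assoc_dim d)
qed

lemma Z2_eq_weighted_proj:
  assumes B: "B \<in> carrier_mat n q" and P: "P \<in> carrier_mat q c"
  shows "Z2 B P = weighted_proj (1\<^sub>m n) (B * P)"
proof -
  have V: "B * P \<in> carrier_mat n c" using B P by simp
  have I: "1\<^sub>m n \<in> carrier_mat n n" "transpose_mat (1\<^sub>m n :: real mat) = 1\<^sub>m n" by auto
  note N = pinv_symmetric(1)[OF gram_symmetric[OF I V]]
  note d = carrier_matD[OF B] carrier_matD[OF P]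
  have V1: "1\<^sub>m n * (B * P) = B * P" using left_mult_one_mat[OF V] .
  have e: "transpose_mat (B * P) = transpose_mat P * transpose_mat B"
    by (simp add: transpose_mult_dim d)
  have e2: "transpose_mat P * transpose_mat B * B * P = transpose_mat (B * P) * 1\<^sub>m n * (B * P)"
  proof -
    have "transpose_mat (B * P) * 1\<^sub>m n * (B * P) = transpose_mat (B * P) * (1\<^sub>m n * (B * P))"
      by (rule mult_mat_assoc_dim) (simp_all add: d)
    then show ?thesis unfolding V1 e by (simp add: mult_mat_assoc_dim d)
  qed
  show ?thesis
    unfolding Z2_def weighted_proj_def e2 V1
    using carrier_matD[OF N] by (simp add: e mult_mat_assoc_dim d)
qed

lemma sym_pos_def_one: "sym_pos_def n (1\<^sub>m n)"
  unfolding sym_pos_def_def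
proof (intro conjI ballI impI)
  fix v :: "real vec" assume v: "v \<in> carrier_vec n" "v \<noteq> 0\<^sub>v n"
  then have "v \<bullet> v \<noteq> 0" using scalar_prod_self_eq_0 by blast
  then show "0 < v \<bullet> (1\<^sub>m n *\<^sub>v v)" using v(1) scalar_prod_self_nonneg[of v] by simp
qed auto

lemma Z1'_props:
  assumes A: "A \<in> carrier_mat p m" and G: "sym_pos_def m G" and S: "dim_row S = p"
  shows "Z1' A G S \<in> carrier_mat m m" "Z1' A G S * Z1' A G S = Z1' A G S"
    "transpose_mat (G * Z1' A G S) = G * Z1' A G S"
proof -
  have S': "S \<in> carrier_mat p (dim_col S)" using S by auto
  note Gc = sym_pos_defD[OF G]
  note B = mat_inv[OF Gc(1) sym_pos_def_det[OF G]]
  note W = sym_pos_defD[OF sym_pos_def_inverse[OF G B]]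
  have V: "transpose_mat A * S \<in> carrier_mat m (dim_col S)"
    by (rule mult_carrier_mat[OF _ S']) (simp only: transpose_carrier_mat A)
  note P = weighted_proj[OF W(1,2) V]
  show "Z1' A G S \<in> carrier_mat m m" "Z1' A G S * Z1' A G S = Z1' A G S"
    "transpose_mat (G * Z1' A G S) = G * Z1' A G S"
    unfolding Z1'_eq_weighted_proj[OF A G S'] using P(1,2) P(3)[OF Gc(1) B(2)] by auto
qed

lemma Z2_props:
  assumes B: "B \<in> carrier_mat n q" and P: "dim_row P = q"
  shows "Z2 B P \<in> carrier_mat n n" "Z2 B P * Z2 B P = Z2 B P" "transpose_mat (Z2 B P) = Z2 B P"
proof -
  have P': "P \<in> carrier_mat q (dim_col P)" using P by auto
  have V: "B * P \<in> carrier_mat n (dim_col P)" by (rule mult_carrier_mat[OF B P'])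
  have I: "1\<^sub>m n \<in> carrier_mat n n" "transpose_mat (1\<^sub>m n :: real mat) = 1\<^sub>m n" by auto
  note Q = weighted_proj[OF I V]
  show c: "Z2 B P \<in> carrier_mat n n" and "Z2 B P * Z2 B P = Z2 B P"
    unfolding Z2_eq_weighted_proj[OF B P'] using Q(1,2) by auto
  have "1\<^sub>m n * Z2 B P = Z2 B P" by (rule left_mult_one_mat[OF c])
  then show "transpose_mat (Z2 B P) = Z2 B P"
    using Q(3)[OF I(1)] unfolding Z2_eq_weighted_proj[OF B P'] by simp
qed

lemma Z1'_measurable:
  assumes A: "A \<in> carrier_mat p m" and G: "sym_pos_def m G"
  shows "mat_measurable (mat_borel p) m m (Z1' A G)"
proof (rule mat_measurable_mat_borelI)
  fix c
  let ?R = "restrict_space (mat_borel p) (carrier_mat p c)"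
  note Gc = sym_pos_defD[OF G]
  note B = mat_inv[OF Gc(1) sym_pos_def_det[OF G]]
  note W = sym_pos_def_inverse[OF G B]
  have "mat_measurable ?R m c (\<lambda>S. transpose_mat A * S)"
    by (rule mat_measurable_mult[OF mat_measurable_const mat_measurable_id]) (use A in simp)
  note P = weighted_proj_measurable[OF W this]
  have e: "Z1' A G S = weighted_proj (mat_inv G) (transpose_mat A * S)" if "S \<in> space ?R" for S
    by (rule Z1'_eq_weighted_proj[OF A G]) (use that in \<open>auto simp: space_restrict_space\<close>)
  show "mat_measurable ?R m m (Z1' A G)"
  proof (rule mat_measurableI)
    fix i j assume ij: "i < m" "j < m"
    show "(\<lambda>S. Z1' A G S $$ (i, j)) \<in> borel_measurable ?R"
      using mat_measurableD(2)[OF P ij] by (subst measurable_cong[OF arg_cong[OF e]])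
  qed (use mat_measurableD(1)[OF P] e in simp)
qed

lemma Z2_measurable:
  assumes B: "B \<in> carrier_mat n q"
  shows "mat_measurable (mat_borel q) n n (Z2 B)"
proof (rule mat_measurable_mat_borelI)
  fix c
  let ?R = "restrict_space (mat_borel q) (carrier_mat q c)"
  have "mat_measurable ?R n c (\<lambda>P. B * P)"
    by (rule mat_measurable_mult[OF mat_measurable_const mat_measurable_id]) (use B in simp)
  note P = weighted_proj_measurable[OF sym_pos_def_one this]
  have e: "Z2 B P = weighted_proj (1\<^sub>m n) (B * P)" if "P \<in> space ?R" for P
    by (rule Z2_eq_weighted_proj[OF B]) (use that in \<open>auto simp: space_restrict_space\<close>)
  show "mat_measurable ?R n n (Z2 B)"
  proof (rule mat_measurableI)
    fix i j assume ij: "i < n" "j < n"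
    show "(\<lambda>S. Z2 B S $$ (i, j)) \<in> borel_measurable ?R"
      using mat_measurableD(2)[OF P ij] by (subst measurable_cong[OF arg_cong[OF e]])
  qed (use mat_measurableD(1)[OF P] e in simp)
qed

text \<open>A draw is kept as a pair, since \<open>S\<close> and \<open>P\<close> of the same
  iteration may depend on each other. The order of the pair is opposite to that of the Kronecker
  factors.\<close>

lemma mat_measurable_kronecker:
  assumes F: "mat_measurable N1 n n F" and G: "mat_measurable N2 m m G"
  shows "mat_measurable (N2 \<Otimes>\<^sub>M N1) (n * m) (n * m) (\<lambda>(S, P). kronecker (F P) (G S))"
proof (rule mat_measurableI)
  fix i j assume i: "i < n * m" and j: "j < n * m"
  note i' = div_mod_less_product[OF i] and j' = div_mod_less_product[OF j]
  have "(\<lambda>y. F (snd y) $$ (i div m, j div m) * G (fst y) $$ (i mod m, j mod m))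
      \<in> borel_measurable (N2 \<Otimes>\<^sub>M N1)"
    by (intro borel_measurable_times
        measurable_compose[OF measurable_snd mat_measurableD(2)[OF F i'(1) j'(1)]]
        measurable_compose[OF measurable_fst mat_measurableD(2)[OF G i'(2) j'(2)]])
  moreover have "(case y of (S, P) \<Rightarrow> kronecker (F P) (G S)) $$ (i, j) =
      F (snd y) $$ (i div m, j div m) * G (fst y) $$ (i mod m, j mod m)"
    if y: "y \<in> space (N2 \<Otimes>\<^sub>M N1)" for y
  proof -
    have "F (snd y) \<in> carrier_mat n n" "G (fst y) \<in> carrier_mat m m"
      using y mat_measurableD(1)[OF F] mat_measurableD(1)[OF G] by (auto simp: space_pair_measure)
    then show ?thesis using kronecker_index[OF _ _ i j] by (simp add: case_prod_unfold)
  qed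
  ultimately show "(\<lambda>y. (case y of (S, P) \<Rightarrow> kronecker (F P) (G S)) $$ (i, j))
      \<in> borel_measurable (N2 \<Otimes>\<^sub>M N1)"
    by (subst measurable_cong) auto
next
  fix y assume y: "y \<in> space (N2 \<Otimes>\<^sub>M N1)"
  have "F (snd y) \<in> carrier_mat n n" "G (fst y) \<in> carrier_mat m m"
    using y mat_measurableD(1)[OF F] mat_measurableD(1)[OF G] by (auto simp: space_pair_measure)
  then show "(case y of (S, P) \<Rightarrow> kronecker (F P) (G S)) \<in> carrier_mat (n * m) (n * m)"
    by (auto simp: case_prod_unfold)
qed

section \<open>Expectations\<close>

lemma mat_expectation_carrier [simp]: "mat_expectation D r c F \<in> carrier_mat r c"
  by (simp add: mat_expectation_def)

lemma mat_expectation_index: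
  "i < r \<Longrightarrow> j < c \<Longrightarrow> mat_expectation D r c F $$ (i, j) = (\<integral>y. F y $$ (i, j) \<partial>D)"
  by (simp add: mat_expectation_def)

text \<open>The quadratic form at a fixed vector is a finite linear combination of the entries, so
  it commutes with the expectation.\<close>

lemma mat_expectation_psd:
  assumes int: "\<And>i j. i < n \<Longrightarrow> j < n \<Longrightarrow> integrable D (\<lambda>y. F y $$ (i, j))"
    and psd: "\<And>y. y \<in> space D \<Longrightarrow> psd n (F y)"
  shows "psd n (mat_expectation D n n F)"
  unfolding psd_def
proof (intro conjI ballI)
  let ?E = "mat_expectation D n n F"
  show "?E \<in> carrier_mat n n" by simp
  show "transpose_mat ?E = ?E"
  proof (rule eq_matI)
    fix i j assume "i < dim_row ?E" "j < dim_col ?E"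
    then have ij: "i < n" "j < n" by (auto simp: mat_expectation_def)
    have "F y $$ (j, i) = F y $$ (i, j)" if "y \<in> space D" for y
    proof -
      have "transpose_mat (F y) $$ (i, j) = F y $$ (j, i)" using psdD(1)[OF psd[OF that]] ij by simp
      then show ?thesis using psdD(2)[OF psd[OF that]] by simp
    qed
    then have "(\<integral>y. F y $$ (j, i) \<partial>D) = (\<integral>y. F y $$ (i, j) \<partial>D)" by (intro Bochner_Integration.integral_cong) auto
    then show "transpose_mat ?E $$ (i, j) = ?E $$ (i, j)"
      using ij carrier_matD[OF mat_expectation_carrier[of D n n F]] by (simp add: mat_expectation_index)
  qed (simp_all add: mat_expectation_def)
  fix v :: "real vec" assume v: "v \<in> carrier_vec n"
  have int2: "integrable D (\<lambda>y. v $ i * F y $$ (i, j) * v $ j)" if "i < n" "j < n" for i j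
    using int[OF that] by simp
  have "v \<bullet> (?E *\<^sub>v v) = (\<Sum>i<n. \<Sum>j<n. (\<integral>y. v $ i * F y $$ (i, j) * v $ j \<partial>D))"
    unfolding quadratic_form_sum[OF mat_expectation_carrier v]
    by (intro sum.cong) (auto simp: mat_expectation_index)
  also have "\<dots> = (\<Sum>i<n. (\<integral>y. (\<Sum>j<n. v $ i * F y $$ (i, j) * v $ j) \<partial>D))"
    by (intro sum.cong refl Bochner_Integration.integral_sum[symmetric] int2) auto
  also have "\<dots> = (\<integral>y. (\<Sum>i<n. \<Sum>j<n. v $ i * F y $$ (i, j) * v $ j) \<partial>D)"
    by (intro Bochner_Integration.integral_sum[symmetric] Bochner_Integration.integrable_sum int2) auto
  also have "\<dots> = (\<integral>y. v \<bullet> (F y *\<^sub>v v) \<partial>D)"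
    by (intro Bochner_Integration.integral_cong refl quadratic_form_sum[symmetric] v psdD(1)[OF psd])
  also have "\<dots> \<ge> 0"
    by (rule Bochner_Integration.integral_nonneg_AE) (use psdD(3)[OF psd v] in auto)
  finally show "0 \<le> v \<bullet> (?E *\<^sub>v v)" .
qed

lemma mat_expectation_mult_left:
  assumes H: "H \<in> carrier_mat n n"
    and F: "\<And>y. y \<in> space D \<Longrightarrow> F y \<in> carrier_mat n n"
    and int: "\<And>i j. i < n \<Longrightarrow> j < n \<Longrightarrow> integrable D (\<lambda>y. F y $$ (i, j))"
  shows "mat_expectation D n n (\<lambda>y. H * F y) = H * mat_expectation D n n F"
    and "i < n \<Longrightarrow> j < n \<Longrightarrow> integrable D (\<lambda>y. (H * F y) $$ (i, j))"
proof -
  have e: "(H * F y) $$ (i, j) = (\<Sum>k<n. H $$ (i, k) * F y $$ (k, j))"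
    if "y \<in> space D" "i < n" "j < n" for y i j
    by (rule mat_mult_index_sum[OF H F[OF that(1)] that(2,3)])
  show "integrable D (\<lambda>y. (H * F y) $$ (i, j))" if ij: "i < n" "j < n" for i j
  proof -
    have "integrable D (\<lambda>y. \<Sum>k<n. H $$ (i, k) * F y $$ (k, j))"
      using int ij by (intro Bochner_Integration.integrable_sum integrable_mult_right) auto
    then show ?thesis using e ij by (subst Bochner_Integration.integrable_cong) auto
  qed
  show "mat_expectation D n n (\<lambda>y. H * F y) = H * mat_expectation D n n F"
  proof (rule eq_matI)
    fix i j assume "i < dim_row (H * mat_expectation D n n F)" "j < dim_col (H * mat_expectation D n n F)"
    then have ij: "i < n" "j < n" using H by (auto simp: mat_expectation_def)
    have "(\<integral>y. (H * F y) $$ (i, j) \<partial>D) = (\<integral>y. (\<Sum>k<n. H $$ (i, k) * F y $$ (k, j)) \<partial>D)"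
      using e ij by (intro Bochner_Integration.integral_cong) auto
    also have "\<dots> = (\<Sum>k<n. H $$ (i, k) * (\<integral>y. F y $$ (k, j) \<partial>D))"
      using int ij by (subst Bochner_Integration.integral_sum) auto
    also have "\<dots> = (H * mat_expectation D n n F) $$ (i, j)"
      unfolding mat_mult_index_sum[OF H mat_expectation_carrier ij]
      using ij by (intro sum.cong) (auto simp: mat_expectation_index)
    finally show "mat_expectation D n n (\<lambda>y. H * F y) $$ (i, j) = (H * mat_expectation D n n F) $$ (i, j)"
      using ij by (simp only: mat_expectation_index)
  qed (use H in \<open>simp_all add: mat_expectation_def\<close>)
qed

section \<open>Linear recursions driven by independent matrices\<close>

text \<open>The iterates as a deterministic function of the sequence \<open>g\<close> of draws:
  which draws are read, measurability and bounds can be settled without a probability space.\<close>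

primrec linear_iterates ::
  "('a \<Rightarrow> real mat) \<Rightarrow> real vec \<Rightarrow> nat \<Rightarrow> (nat \<Rightarrow> 'a) \<Rightarrow> real vec" where
  "linear_iterates K v 0 g = v"
| "linear_iterates K v (Suc k) g = linear_iterates K v k g - K (g k) *\<^sub>v linear_iterates K v k g"

lemma linear_iterates_cong:
  assumes "\<And>i. i < k \<Longrightarrow> g i = g' i"
  shows "linear_iterates K v k g = linear_iterates K v k g'"
  using assms by (induction k) auto

lemma linear_iterates_carrier:
  assumes "v \<in> carrier_vec d" "\<And>i. i < k \<Longrightarrow> K (g i) \<in> carrier_mat d d"
  shows "linear_iterates K v k g \<in> carrier_vec d"
  using assms(2)
proof (induction k)
  case (Suc k)
  then have "K (g k) *\<^sub>v linear_iterates K v k g \<in> carrier_vec d"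
    by (intro mult_mat_vec_carrier[of _ d d]) auto
  then show ?case using Suc by simp
qed (use assms in simp)

lemma mult_mat_vec_index_sum:
  fixes A :: "real mat"
  assumes "A \<in> carrier_mat r n" "v \<in> carrier_vec n" "i < r"
  shows "(A *\<^sub>v v) $ i = (\<Sum>j<n. A $$ (i, j) * v $ j)"
  using assms by (simp add: scalar_prod_def lessThan_atLeast0)

lemma linear_iterates_Suc_index:
  assumes v: "v \<in> carrier_vec d" and K: "\<And>i. i \<le> k \<Longrightarrow> K (g i) \<in> carrier_mat d d" and i: "i < d"
  shows "linear_iterates K v (Suc k) g $ i =
    linear_iterates K v k g $ i - (\<Sum>j<d. K (g k) $$ (i, j) * linear_iterates K v k g $ j)"
proof -
  have l: "linear_iterates K v k g \<in> carrier_vec d"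
    by (rule linear_iterates_carrier[OF v]) (use K in auto)
  have c: "K (g k) \<in> carrier_mat d d" using K by simp
  have "linear_iterates K v (Suc k) g $ i =
    linear_iterates K v k g $ i - (K (g k) *\<^sub>v linear_iterates K v k g) $ i"
    using c i l by (simp del: index_mult_mat_vec)
  then show ?thesis unfolding mult_mat_vec_index_sum[OF c l i] .
qed

text \<open>\<open>I\<close> stays fixed during the induction, although the iterate with index
  \<open>k\<close> reads only coordinates below \<open>k\<close>. The smallest choice
  \<open>{..<k}\<close> is the one that independence asks for.\<close>

lemma linear_iterates_measurable:
  assumes K: "mat_measurable N d d K" and v: "v \<in> carrier_vec d" and I: "{..<k} \<subseteq> I" and i: "i < d"
  shows "(\<lambda>g. linear_iterates K v k g $ i) \<in> borel_measurable (PiM I (\<lambda>_. N))"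
  using I i
proof (induction k arbitrary: i)
  case (Suc k)
  have kI: "k \<in> I" using Suc.prems by auto
  have IH: "(\<lambda>g. linear_iterates K v k g $ j) \<in> borel_measurable (PiM I (\<lambda>_. N))" if "j < d" for j
    using Suc.prems(1) that by (intro Suc.IH) auto
  have "(\<lambda>g. linear_iterates K v k g $ i - (\<Sum>j<d. K (g k) $$ (i, j) * linear_iterates K v k g $ j))
    \<in> borel_measurable (PiM I (\<lambda>_. N))"
    using Suc.prems(2)
    by (intro borel_measurable_diff borel_measurable_sum borel_measurable_times IH
        measurable_compose[OF measurable_component_singleton[OF kI] mat_measurableD(2)[OF K]]) auto
  moreover have "linear_iterates K v (Suc k) g $ i =
      linear_iterates K v k g $ i - (\<Sum>j<d. K (g k) $$ (i, j) * linear_iterates K v k g $ j)"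
    if g: "g \<in> space (PiM I (\<lambda>_. N))" for g
  proof (rule linear_iterates_Suc_index[OF v _ Suc.prems(2)])
    fix i assume "i \<le> k"
    then have "i \<in> I" using Suc.prems by auto
    then show "K (g i) \<in> carrier_mat d d"
      using g by (intro mat_measurableD(1)[OF K]) (auto simp: space_PiM)
  qed
  ultimately show ?case by (subst measurable_cong) auto
qed simp

text \<open>A bound over all sequences of draws, for fixed \<open>k\<close>; on a probability space
  it makes the entries of the iterates integrable.\<close>

lemma linear_iterates_bounded:
  assumes K: "mat_measurable N d d K" and v: "v \<in> carrier_vec d"
    and c: "\<And>y i j. y \<in> space N \<Longrightarrow> i < d \<Longrightarrow> j < d \<Longrightarrow> \<bar>K y $$ (i, j)\<bar> \<le> c"
  shows "\<exists>b. \<forall>g. (\<forall>i. g i \<in> space N) \<longrightarrow> (\<forall>i<d. \<bar>linear_iterates K v k g $ i\<bar> \<le> b)"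
proof (induction k)
  case 0
  have "\<bar>v $ i\<bar> \<le> (\<Sum>i<d. \<bar>v $ i\<bar>)" if "i < d" for i using that by (intro member_le_sum) auto
  then show ?case by auto
next
  case (Suc k)
  then obtain b where b: "\<And>g i. (\<And>i. g i \<in> space N) \<Longrightarrow> i < d \<Longrightarrow> \<bar>linear_iterates K v k g $ i\<bar> \<le> b"
    by blast
  have "\<bar>linear_iterates K v (Suc k) g $ i\<bar> \<le> b + (\<Sum>j<d. c * b)"
    if g: "\<And>i. g i \<in> space N" and i: "i < d" for g i
  proof -
    have "\<bar>\<Sum>j<d. K (g k) $$ (i, j) * linear_iterates K v k g $ j\<bar> \<le>
        (\<Sum>j<d. \<bar>K (g k) $$ (i, j) * linear_iterates K v k g $ j\<bar>)" by (rule sum_abs)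
    also have "\<dots> \<le> (\<Sum>j<d. c * b)"
    proof (rule sum_mono)
      fix j assume "j \<in> {..<d}"
      then have j: "j < d" by simp
      show "\<bar>K (g k) $$ (i, j) * linear_iterates K v k g $ j\<bar> \<le> c * b"
        unfolding abs_mult using c[OF g i j] b[OF g j] order_trans[OF abs_ge_zero c[OF g i j]]
        by (intro mult_mono) auto
    qed
    finally have le: "\<bar>\<Sum>j<d. K (g k) $$ (i, j) * linear_iterates K v k g $ j\<bar> \<le> (\<Sum>j<d. c * b)" .
    have "linear_iterates K v (Suc k) g $ i =
        linear_iterates K v k g $ i - (\<Sum>j<d. K (g k) $$ (i, j) * linear_iterates K v k g $ j)"
      by (rule linear_iterates_Suc_index[OF v _ i]) (rule mat_measurableD(1)[OF K g])
    then show ?thesis using b[of g, OF g i] le by linarith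
  qed
  then show ?case by blast
qed

context prob_space
begin

text \<open>The iterate with index \<open>k\<close> is built from the draws before \<open>k\<close>,
  so it is independent of draw \<open>k\<close>. In each term of the matrix-vector product the
  expectation factors, and the common law \<open>D\<close> turns the matrix factor into an entry of
  the mean.\<close>

lemma expectation_linear_iterates:
  fixes Y :: "nat \<Rightarrow> 'a \<Rightarrow> 'b"
  assumes indep: "indep_vars (\<lambda>_. N) Y UNIV" and D: "\<And>k. distr M N (Y k) = D"
    and K: "mat_measurable N d d K" and v: "v \<in> carrier_vec d"
    and c: "\<And>y i j. y \<in> space N \<Longrightarrow> i < d \<Longrightarrow> j < d \<Longrightarrow> \<bar>K y $$ (i, j)\<bar> \<le> c"
  defines "e \<equiv> \<lambda>k. vec d (\<lambda>i. expectation (\<lambda>\<omega>. linear_iterates K v k (\<lambda>l. Y l \<omega>) $ i))"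
  shows "e (Suc k) = (1\<^sub>m d - mat_expectation D d d K) *\<^sub>v e k"
proof -
  have Y: "Y l \<in> measurable M N" for l using indep by (auto simp: indep_vars_def)
  have YN: "Y l \<omega> \<in> space N" if "\<omega> \<in> space M" for l \<omega> using measurable_space[OF Y that] .
  have KY: "K (Y l \<omega>) \<in> carrier_mat d d" if "\<omega> \<in> space M" for l \<omega>
    by (rule mat_measurableD(1)[OF K YN[OF that]])
  define w where "w k \<omega> = linear_iterates K v k (\<lambda>l. Y l \<omega>)" for k \<omega>
  \<comment> \<open>Restriction to the draws before \<open>k\<close> exhibits the iterate as a
    function on the product space over \<open>{..<k}\<close>, the form in which independence of
    disjoint blocks applies.\<close>
  have restr: "w k \<omega> = linear_iterates K v k (restrict (\<lambda>l. Y l \<omega>) {..<k})" for k \<omega>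
    unfolding w_def by (rule linear_iterates_cong) simp
  have wm: "(\<lambda>\<omega>. w k \<omega> $ j) \<in> borel_measurable M" if "j < d" for j k
    unfolding restr
    by (rule measurable_compose[OF measurable_restrict linear_iterates_measurable[OF K v order_refl that]])
      (rule Y)
  have wi: "integrable M (\<lambda>\<omega>. w k \<omega> $ j)" if j: "j < d" for j k
  proof -
    obtain b where b: "\<And>g i. (\<And>i. g i \<in> space N) \<Longrightarrow> i < d \<Longrightarrow> \<bar>linear_iterates K v k g $ i\<bar> \<le> b"
      using linear_iterates_bounded[OF K v c, of k] by blast
    have "\<bar>w k \<omega> $ j\<bar> \<le> b" if "\<omega> \<in> space M" for \<omega>
      unfolding w_def by (rule b[OF YN[OF that] j])
    then show ?thesis by (intro integrable_const_bound[of _ b]) (use wm[OF j] in auto)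
  qed
  have Km: "(\<lambda>\<omega>. K (Y l \<omega>) $$ (i, j)) \<in> borel_measurable M" if "i < d" "j < d" for i j l
    by (rule measurable_compose[OF Y mat_measurableD(2)[OF K that]])
  have Ki: "integrable M (\<lambda>\<omega>. K (Y l \<omega>) $$ (i, j))" if "i < d" "j < d" for i j l
    by (rule integrable_const_bound[of _ c]) (use c[OF YN] that Km[OF that] in auto)
  have ind: "indep_var borel (\<lambda>\<omega>. K (Y k \<omega>) $$ (i, j)) borel (\<lambda>\<omega>. w k \<omega> $ j)"
    if ij: "i < d" "j < d" for i j
  proof -
    have "indep_var (PiM {k} (\<lambda>_. N)) (\<lambda>\<omega>. restrict (\<lambda>l. Y l \<omega>) {k})
        (PiM {..<k} (\<lambda>_. N)) (\<lambda>\<omega>. restrict (\<lambda>l. Y l \<omega>) {..<k})"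
      by (rule indep_var_restrict[OF indep]) auto
    from indep_var_compose[OF this
        measurable_compose[OF measurable_component_singleton[of k "{k}"] mat_measurableD(2)[OF K ij]]
        linear_iterates_measurable[OF K v order_refl ij(2)]]
    show ?thesis unfolding restr by (simp add: comp_def)
  qed
  have E: "expectation (\<lambda>\<omega>. K (Y k \<omega>) $$ (i, j)) = mat_expectation D d d K $$ (i, j)"
    if "i < d" "j < d" for i j
    unfolding mat_expectation_index[OF that] D[of k, symmetric]
    by (rule integral_distr[OF Y mat_measurableD(2)[OF K that], symmetric])
  define EK where "EK = mat_expectation D d d K"
  have EK: "EK \<in> carrier_mat d d" by (simp add: EK_def)
  have ei: "e k $ i = expectation (\<lambda>\<omega>. w k \<omega> $ i)" if "i < d" for i k
    using that by (simp add: e_def w_def)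
  have ec: "e k \<in> carrier_vec d" for k by (simp add: e_def)
  have "(1\<^sub>m d - EK) *\<^sub>v e k = 1\<^sub>m d *\<^sub>v e k - EK *\<^sub>v e k"
    by (rule minus_mult_distrib_mat_vec[OF one_carrier_mat EK ec])
  then have T: "(1\<^sub>m d - EK) *\<^sub>v e k = e k - EK *\<^sub>v e k" using ec by simp
  show ?thesis
    unfolding EK_def[symmetric] T
  proof (rule eq_vecI)
    fix i assume "i < dim_vec (e k - EK *\<^sub>v e k)"
    then have i: "i < d" using EK by simp
    have "e (Suc k) $ i = expectation (\<lambda>\<omega>. w k \<omega> $ i - (\<Sum>j<d. K (Y k \<omega>) $$ (i, j) * w k \<omega> $ j))"
      unfolding ei[OF i] unfolding w_def
      by (intro Bochner_Integration.integral_cong refl linear_iterates_Suc_index[OF v _ i] KY)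
    also have "\<dots> = expectation (\<lambda>\<omega>. w k \<omega> $ i) - (\<Sum>j<d. expectation (\<lambda>\<omega>. K (Y k \<omega>) $$ (i, j) * w k \<omega> $ j))"
      using wi[OF i] indep_var_integrable[OF ind[OF i] Ki[OF i] wi]
      by (subst Bochner_Integration.integral_diff) auto
    also have "(\<Sum>j<d. expectation (\<lambda>\<omega>. K (Y k \<omega>) $$ (i, j) * w k \<omega> $ j)) = (\<Sum>j<d. EK $$ (i, j) * e k $ j)"
    proof (rule sum.cong[OF refl])
      fix j assume "j \<in> {..<d}"
      then have j: "j < d" by simp
      show "expectation (\<lambda>\<omega>. K (Y k \<omega>) $$ (i, j) * w k \<omega> $ j) = EK $$ (i, j) * e k $ j"
        unfolding indep_var_lebesgue_integral[OF ind[OF i j] Ki[OF i j] wi[OF j]] E[OF i j] EK_def ei[OF j] ..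
    qed
    also have "\<dots> = (EK *\<^sub>v e k) $ i" by (rule mult_mat_vec_index_sum[OF EK ec i, symmetric])
    finally show "e (Suc k) $ i = (e k - EK *\<^sub>v e k) $ i"
      unfolding ei[OF i, of k, symmetric] using i EK by simp
  qed (use EK in \<open>simp add: e_def\<close>)
qed

end

section \<open>The sketch-and-project iteration\<close>

text \<open>Consistency replaces \<open>C\<close> by \<open>A * Xs * B\<close>, so the residual is
  \<open>A (X - Xs) B\<close>: the step refers to no solution, yet it acts linearly on the error
  relative to every solution.\<close>

lemma sketch_step_error:
  assumes A: "A \<in> carrier_mat p m" and B: "B \<in> carrier_mat n q" and G: "sym_pos_def m G"
    and S: "dim_row S = p" and P: "dim_row P = q"
    and X: "X \<in> carrier_mat m n" and Xs: "Xs \<in> carrier_mat m n" "A * Xs * B = C"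
  shows "sketch_step A B C G S P X - Xs = (X - Xs) - Z1' A G S * (X - Xs) * Z2 B P"
    and "sketch_step A B C G S P X \<in> carrier_mat m n"
proof -
  note Gc = sym_pos_defD[OF G]
  note Gi = mat_inv[OF Gc(1) sym_pos_def_det[OF G]]
  define E where "E = X - Xs"
  have E: "E \<in> carrier_mat m n" unfolding E_def by (rule minus_carrier_mat[OF Xs(1)])
  define N1 where "N1 = pinv (transpose_mat S * A * mat_inv G * transpose_mat A * S)"
  define N2 where "N2 = pinv (transpose_mat P * transpose_mat B * B * P)"
  have S': "S \<in> carrier_mat p (dim_col S)" and P': "P \<in> carrier_mat q (dim_col P)" using S P by auto
  note W = sym_pos_defD[OF sym_pos_def_inverse[OF G Gi]]
  have V: "transpose_mat A * S \<in> carrier_mat m (dim_col S)"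
    by (rule mult_carrier_mat[OF _ S']) (simp only: transpose_carrier_mat A)
  have V2: "B * P \<in> carrier_mat n (dim_col P)" by (rule mult_carrier_mat[OF B P'])
  note d = carrier_matD[OF A] carrier_matD[OF B] S P carrier_matD[OF Gi(1)] carrier_matD[OF E]
  have N1: "N1 \<in> carrier_mat (dim_col S) (dim_col S)"
  proof -
    have "transpose_mat S * A * mat_inv G * transpose_mat A * S
      = transpose_mat (transpose_mat A * S) * mat_inv G * (transpose_mat A * S)"
      by (simp add: transpose_mult_dim mult_mat_assoc_dim d)
    then show ?thesis
      unfolding N1_def using pinv_symmetric(1)[OF gram_symmetric[OF W(1,2) V]] by simp
  qed
  have N2: "N2 \<in> carrier_mat (dim_col P) (dim_col P)"
  proof -
    have I: "1\<^sub>m n \<in> carrier_mat n n" "transpose_mat (1\<^sub>m n :: real mat) = 1\<^sub>m n" by auto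
    have "transpose_mat (B * P) * 1\<^sub>m n * (B * P) = transpose_mat (B * P) * (1\<^sub>m n * (B * P))"
      by (rule mult_mat_assoc_dim) (simp_all add: d)
    then have "transpose_mat P * transpose_mat B * B * P = transpose_mat (B * P) * 1\<^sub>m n * (B * P)"
      unfolding left_mult_one_mat[OF V2] by (simp add: transpose_mult_dim mult_mat_assoc_dim d)
    then show ?thesis
      unfolding N2_def using pinv_symmetric(1)[OF gram_symmetric[OF I V2]] by simp
  qed
  have AEB: "A * X * B - C = A * E * B"
  proof -
    have AX: "A * X \<in> carrier_mat p n" "A * Xs \<in> carrier_mat p n" using A X Xs by auto
    have "A * E * B = (A * X - A * Xs) * B"
      unfolding E_def using mult_minus_distrib_mat[OF A X Xs(1)] by simp
    also have "\<dots> = A * X * B - A * Xs * B" by (rule minus_mult_distrib_mat[OF AX B])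
    finally show ?thesis unfolding Xs(2) by simp
  qed
  have Z: "Z1' A G S * E * Z2 B P \<in> carrier_mat m n"
    using Z1'_props(1)[OF A G S] E Z2_props(1)[OF B P] by (intro mult_carrier_mat)
  have step: "sketch_step A B C G S P X = X - Z1' A G S * E * Z2 B P"
    unfolding sketch_step_def Z1'_def Z2_def N1_def[symmetric] N2_def[symmetric] AEB
    by (simp add: mult_mat_assoc_dim d carrier_matD[OF N1] carrier_matD[OF N2])
  show "sketch_step A B C G S P X \<in> carrier_mat m n" unfolding step by (rule minus_carrier_mat[OF Z])
  show "sketch_step A B C G S P X - Xs = (X - Xs) - Z1' A G S * (X - Xs) * Z2 B P"
    unfolding step E_def[symmetric]
  proof -
    have "X - W - Xs = X - Xs - W" if "W \<in> carrier_mat m n" for W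
      using X Xs(1) that by (intro eq_matI) auto
    from this[OF Z] show "X - Z1' A G S * E * Z2 B P - Xs = E - Z1' A G S * E * Z2 B P"
      by (simp only: E_def)
  qed
qed

lemma vectorize_minus:
  assumes "X \<in> carrier_mat m n" "Y \<in> carrier_mat m n"
  shows "vectorize m n (X - Y) = vectorize m n X - vectorize m n Y"
  using assms div_mod_less_product by (intro eq_vecI) (auto simp: vectorize_def)

text \<open>By the mixed-product rule idempotence passes to \<open>K\<close>, and \<open>H K\<close>
  becomes the Kronecker product of the symmetric matrices \<open>Z2\<close> and
  \<open>G Z1'\<close>.\<close>

lemma sketch_kronecker_props:
  assumes A: "A \<in> carrier_mat p m" and B: "B \<in> carrier_mat n q" and G: "sym_pos_def m G"
    and S: "dim_row S = p" and P: "dim_row P = q"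
  defines "K \<equiv> kronecker (Z2 B P) (Z1' A G S)" and "H \<equiv> kronecker (1\<^sub>m n) G"
  shows "K \<in> carrier_mat (n * m) (n * m)" "K * K = K" "transpose_mat (H * K) = H * K"
proof -
  note z1 = Z1'_props[OF A G S] and z2 = Z2_props[OF B P]
  note Gc = sym_pos_defD[OF G]
  show "K \<in> carrier_mat (n * m) (n * m)" unfolding K_def by (rule kronecker_carrier[OF z2(1) z1(1)])
  show "K * K = K" unfolding K_def kronecker_mult[OF z2(1) z1(1) z2(1) z1(1)] z1(2) z2(2) ..
  have GZ: "G * Z1' A G S \<in> carrier_mat m m" using Gc(1) z1(1) by simp
  have "H * K = kronecker (1\<^sub>m n * Z2 B P) (G * Z1' A G S)"
    unfolding H_def K_def by (rule kronecker_mult[OF one_carrier_mat Gc(1) z2(1) z1(1)])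
  also have "1\<^sub>m n * Z2 B P = Z2 B P" by (rule left_mult_one_mat[OF z2(1)])
  finally have HK: "H * K = kronecker (Z2 B P) (G * Z1' A G S)" .
  show "transpose_mat (H * K) = H * K"
    unfolding HK kronecker_transpose[OF z2(1) GZ] z1(3) z2(3) ..
qed

theorem theorem4p2:
  fixes A B C G X0 EZ :: "real mat"
    and m n p q :: nat
    and \<rho> :: real
    and M :: "'w measure"
    and D :: "(real mat \<times> real mat) measure"
    and S P X :: "nat \<Rightarrow> 'w \<Rightarrow> real mat"
  assumes dims: "m > 0" "n > 0"
    and A: "A \<in> carrier_mat p m" and B: "B \<in> carrier_mat n q" and C: "C \<in> carrier_mat p q"
    and consistent: "\<exists>Y\<in>carrier_mat m n. A * Y * B = C"
    and G: "sym_pos_def m G"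
    and M: "prob_space M"
    and indep: "prob_space.indep_vars M (\<lambda>_. mat_borel p \<Otimes>\<^sub>M mat_borel q)
                  (\<lambda>k \<omega>. (S k \<omega>, P k \<omega>)) UNIV"
    and ident: "\<And>k. distr M (mat_borel p \<Otimes>\<^sub>M mat_borel q) (\<lambda>\<omega>. (S k \<omega>, P k \<omega>)) = D"
    and X0: "X0 \<in> carrier_mat m n"
    and X_0: "\<And>\<omega>. \<omega> \<in> space M \<Longrightarrow> X 0 \<omega> = X0"
    and X_Suc: "\<And>k \<omega>. \<omega> \<in> space M \<Longrightarrow>
                  X (Suc k) \<omega> = sketch_step A B C G (S k \<omega>) (P k \<omega>) (X k \<omega>)"
    and EZ: "EZ = mat_expectation D (n * m) (n * m)
                    (\<lambda>(S', P'). kronecker (Z2 B P') (Z1' A G S'))"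
    and \<rho>: "\<rho> = lambda_max (1\<^sub>m (n * m) - EZ)"
  shows "\<rho> = 1 - lambda_min EZ \<and>
    (\<forall>Xs\<in>carrier_mat m n. A * Xs * B = C \<longrightarrow>
      (\<forall>k. wfrob_norm G (mat_expectation M m n (\<lambda>\<omega>. X (Suc k) \<omega> - Xs))
             \<le> \<rho> ^ k * wfrob_norm G (X0 - Xs)))"
proof -
  interpret prob_space M by (rule M)
  define N where "N = mat_borel p \<Otimes>\<^sub>M mat_borel q"
  define Y where "Y k \<omega> = (S k \<omega>, P k \<omega>)" for k \<omega>
  define K where "K = (\<lambda>(S', P'). kronecker (Z2 B P') (Z1' A G S'))"
  define H where "H = kronecker (1\<^sub>m n) G"
  define d where "d = n * m"
  note Gc = sym_pos_defD[OF G]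
  have indepY: "indep_vars (\<lambda>_. N) Y UNIV" using indep unfolding N_def Y_def .
  have D: "distr M N (Y k) = D" for k using ident unfolding N_def Y_def .
  have Ym: "Y k \<in> measurable M N" for k using indepY by (auto simp: indep_vars_def)
  interpret D: prob_space D unfolding D[of 0, symmetric] by (rule prob_space_distr[OF Ym])
  have setsD: "sets D = sets N" unfolding D[of 0, symmetric] by simp
  have spaceD: "space D = space N" by (rule sets_eq_imp_space_eq[OF setsD])
  have Km: "mat_measurable N d d K"
    unfolding N_def d_def K_def by (rule mat_measurable_kronecker[OF Z2_measurable[OF B] Z1'_measurable[OF A G]])
  have Kprops: "K y \<in> carrier_mat d d" "K y * K y = K y" "transpose_mat (H * K y) = H * K y"
    if "y \<in> space N" for y
  proof -
    have "dim_row (fst y) = p" "dim_row (snd y) = q"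
      using that by (auto simp: N_def space_pair_measure space_mat_borel)
    from sketch_kronecker_props[OF A B G this]
    show "K y \<in> carrier_mat d d" "K y * K y = K y" "transpose_mat (H * K y) = H * K y"
      by (auto simp: K_def H_def d_def case_prod_unfold)
  qed
  have H: "sym_pos_def d H" unfolding H_def d_def by (rule sym_pos_def_kronecker_one[OF G])
  note Hc = sym_pos_defD[OF H]
  note Hpsd = sym_pos_def_psd[OF H]
  \<comment> \<open>One bound for all entries and all draws. The summand 1 allows
    \<open>2 x \<le> x^2 + 1\<close> in place of a square root of the index bound.\<close>
  define b where "b = 1 + (\<Sum>i<d. \<Sum>j<d. \<bar>mat_inv H $$ (i, i) * H $$ (j, j)\<bar>)"
  have Kb: "\<bar>K y $$ (i, j)\<bar> \<le> b" if y: "y \<in> space N" and ij: "i < d" "j < d" for y i j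
  proof -
    have "(K y $$ (i, j))\<^sup>2 \<le> mat_inv H $$ (i, i) * H $$ (j, j)"
      by (rule self_adjoint_idempotent_index_bound[OF H Kprops(1,3,2)[OF y] ij])
    also have "\<dots> \<le> \<bar>mat_inv H $$ (i, i) * H $$ (j, j)\<bar>" by simp
    also have "\<dots> \<le> (\<Sum>j<d. \<bar>mat_inv H $$ (i, i) * H $$ (j, j)\<bar>)"
      using ij by (intro member_le_sum[of j _ "\<lambda>j. \<bar>mat_inv H $$ (i, i) * H $$ (j, j)\<bar>"]) auto
    also have "\<dots> \<le> (\<Sum>i<d. \<Sum>j<d. \<bar>mat_inv H $$ (i, i) * H $$ (j, j)\<bar>)"
      using ij by (intro member_le_sum[of i _ "\<lambda>i. \<Sum>j<d. \<bar>mat_inv H $$ (i, i) * H $$ (j, j)\<bar>"])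
        (auto intro: sum_nonneg)
    finally have sq: "\<bar>K y $$ (i, j)\<bar>\<^sup>2 \<le> b - 1" by (simp add: b_def)
    have "0 \<le> (\<bar>K y $$ (i, j)\<bar> - 1)\<^sup>2" by simp
    then have "2 * \<bar>K y $$ (i, j)\<bar> \<le> \<bar>K y $$ (i, j)\<bar>\<^sup>2 + 1" by (simp add: power2_diff)
    then show ?thesis using sq by linarith
  qed
  have Ki: "integrable D (\<lambda>y. K y $$ (i, j))" if "i < d" "j < d" for i j
  proof (rule D.integrable_const_bound[of _ b])
    show "(\<lambda>y. K y $$ (i, j)) \<in> borel_measurable D"
      using mat_measurableD(2)[OF Km that] measurable_cong_sets[OF setsD refl] by blast
  qed (use Kb that spaceD in auto)
  have EZ': "EZ = mat_expectation D d d K" unfolding EZ d_def K_def ..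
  have EZc: "EZ \<in> carrier_mat d d" by (simp add: EZ')
  define T where "T = 1\<^sub>m d - EZ"
  have T: "T \<in> carrier_mat d d" unfolding T_def by (rule minus_carrier_mat[OF EZc])
  have psdHE: "psd d (H * EZ)"
  proof -
    have "psd d (mat_expectation D d d (\<lambda>y. H * K y))"
    proof (rule mat_expectation_psd)
      fix y assume "y \<in> space D"
      then have y: "y \<in> space N" by (simp add: spaceD)
      show "psd d (H * K y)" by (rule self_adjoint_idempotent_psd[OF Hpsd Kprops(1,3,2)[OF y]])
    qed (rule mat_expectation_mult_left(2)[OF Hc(1) _ Ki], use Kprops(1) spaceD in auto)
    also have "mat_expectation D d d (\<lambda>y. H * K y) = H * EZ"
      unfolding EZ' by (rule mat_expectation_mult_left(1)[OF Hc(1) _ Ki]) (use Kprops(1) spaceD in auto)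
    finally show ?thesis .
  qed
  \<comment> \<open>\<open>T\<close> is the mean of the complementary projections
    \<open>1 - K y\<close>, because \<open>D\<close> has total mass 1, and each of them contributes
    a nonnegative form.\<close>
  have psdHT: "psd d (H * T)"
  proof -
    define L where "L y = 1\<^sub>m d - K y" for y
    have Lc: "L y \<in> carrier_mat d d" if "y \<in> space D" for y
      unfolding L_def using Kprops(1) that spaceD by (intro minus_carrier_mat) simp
    have Le: "L y $$ (i, j) = 1\<^sub>m d $$ (i, j) - K y $$ (i, j)" if "y \<in> space D" "i < d" "j < d" for y i j
      unfolding L_def using Kprops(1)[of y] that spaceD by (intro index_minus_mat) auto
    have Li: "integrable D (\<lambda>y. L y $$ (i, j))" if ij: "i < d" "j < d" for i j
    proof -
      have "integrable D (\<lambda>y. 1\<^sub>m d $$ (i, j) - K y $$ (i, j))"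
        by (intro Bochner_Integration.integrable_diff Ki[OF ij]) simp
      then show ?thesis using Le ij by (subst Bochner_Integration.integrable_cong) auto
    qed
    have EL: "mat_expectation D d d L = T"
    proof (rule eq_matI)
      fix i j assume "i < dim_row T" "j < dim_col T"
      then have ij: "i < d" "j < d" using T by auto
      have "(\<integral>y. L y $$ (i, j) \<partial>D) = (\<integral>y. 1\<^sub>m d $$ (i, j) - K y $$ (i, j) \<partial>D)"
        using Le ij by (intro Bochner_Integration.integral_cong) auto
      also have "\<dots> = 1\<^sub>m d $$ (i, j) - (\<integral>y. K y $$ (i, j) \<partial>D)"
        using Ki[OF ij] by (subst Bochner_Integration.integral_diff) (simp_all add: D.prob_space)
      also have "\<dots> = 1\<^sub>m d $$ (i, j) - EZ $$ (i, j)"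
        unfolding EZ' mat_expectation_index[OF ij] ..
      also have "\<dots> = T $$ (i, j)"
        unfolding T_def using EZc ij by (intro index_minus_mat(1)[symmetric]) auto
      finally show "mat_expectation D d d L $$ (i, j) = T $$ (i, j)"
        using ij by (simp only: mat_expectation_index)
    qed (use T in \<open>simp_all add: mat_expectation_def\<close>)
    have "psd d (mat_expectation D d d (\<lambda>y. H * L y))"
    proof (rule mat_expectation_psd)
      fix y assume "y \<in> space D"
      then have y: "y \<in> space N" by (simp add: spaceD)
      show "psd d (H * L y)"
        unfolding psd_def
      proof (intro conjI ballI)
        show "H * L y \<in> carrier_mat d d" using Hc(1) Lc \<open>y \<in> space D\<close> by simp
        show "transpose_mat (H * L y) = H * L y"
          unfolding L_def by (rule self_adjoint_one_minus[OF Hc(1,2) Kprops(1,3)[OF y]])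
        fix x :: "real vec" assume x: "x \<in> carrier_vec d"
        show "0 \<le> x \<bullet> (H * L y *\<^sub>v x)"
          unfolding L_def mult_one_minus_vec[OF Hc(1) Kprops(1)[OF y] x]
          using self_adjoint_idempotent_le[OF Hpsd Kprops(1,3,2)[OF y] x] by simp
      qed
    qed (rule mat_expectation_mult_left(2)[OF Hc(1) Lc Li])
    also have "mat_expectation D d d (\<lambda>y. H * L y) = H * T"
      unfolding EL[symmetric] by (rule mat_expectation_mult_left(1)[OF Hc(1) Lc Li])
    finally show ?thesis .
  qed
  \<comment> \<open>\<open>T \<le> 1\<close> in the order of \<open>H\<close>-forms, because the
    form of \<open>H * EZ\<close> is nonnegative.\<close>
  have le1: "x \<bullet> (H * T *\<^sub>v x) \<le> x \<bullet> (H *\<^sub>v x)" if x: "x \<in> carrier_vec d" for x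
    unfolding T_def mult_one_minus_vec[OF Hc(1) EZc x] using psdD(3)[OF psdHE x] by simp
  \<comment> \<open>A positive dimension provides a unit vector, hence a nonempty set of Rayleigh
    quotients.\<close>
  have d0: "d > 0" using dims by (simp add: d_def)
  have \<rho>T: "\<rho> = lambda_max T" unfolding \<rho> T_def d_def ..
  have \<rho>01: "0 \<le> \<rho>" "\<rho> \<le> 1"
    unfolding \<rho>T using lambda_max_contraction(1,2)[OF H T psdHT d0 le1] by auto
  have contr: "(T *\<^sub>v x) \<bullet> (H *\<^sub>v (T *\<^sub>v x)) \<le> \<rho>\<^sup>2 * (x \<bullet> (H *\<^sub>v x))" if "x \<in> carrier_vec d" for x
    unfolding \<rho>T by (rule lambda_max_contraction(3)[OF H T psdHT d0 _ that]) (rule le1)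
  have "lambda_max T \<in> spectrum T"
    by (rule lambda_max_Rayleigh(1)[OF H T psdD(2)[OF psdHT] d0]) (rule le1)
  then have first: "\<rho> = 1 - lambda_min EZ"
    unfolding \<rho>T T_def by (intro lambda_max_one_minus[OF EZc]) auto
  have second: "wfrob_norm G (mat_expectation M m n (\<lambda>\<omega>. X (Suc k) \<omega> - Xs)) \<le> \<rho> ^ k * wfrob_norm G (X0 - Xs)"
    if Xs: "Xs \<in> carrier_mat m n" "A * Xs * B = C" for Xs k
  proof -
    define v where "v = vectorize m n (X0 - Xs)"
    have v: "v \<in> carrier_vec d" by (simp add: v_def d_def)
    have iter: "X k \<omega> \<in> carrier_mat m n \<and> vectorize m n (X k \<omega> - Xs) = linear_iterates K v k (\<lambda>l. Y l \<omega>)"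
      if \<omega>: "\<omega> \<in> space M" for k \<omega>
    proof (induction k)
      case 0
      then show ?case using X0 by (simp add: X_0[OF \<omega>] v_def)
    next
      case (Suc k)
      have "Y k \<omega> \<in> space N" by (rule measurable_space[OF Ym \<omega>])
      then have SP: "dim_row (S k \<omega>) = p" "dim_row (P k \<omega>) = q"
        by (auto simp: N_def Y_def space_pair_measure space_mat_borel)
      have Xc: "X k \<omega> \<in> carrier_mat m n" using Suc by simp
      have E: "X k \<omega> - Xs \<in> carrier_mat m n" by (rule minus_carrier_mat[OF Xs(1)])
      note z1 = Z1'_props[OF A G SP(1)] and z2 = Z2_props[OF B SP(2)]
      have Z: "Z1' A G (S k \<omega>) * (X k \<omega> - Xs) * Z2 B (P k \<omega>) \<in> carrier_mat m n"
        by (intro mult_carrier_mat[OF mult_carrier_mat[OF z1(1) E] z2(1)])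
      note st = sketch_step_error[OF A B G SP Xc Xs]
      have "vectorize m n (X (Suc k) \<omega> - Xs) = vectorize m n (X k \<omega> - Xs)
          - vectorize m n (Z1' A G (S k \<omega>) * (X k \<omega> - Xs) * Z2 B (P k \<omega>))"
        unfolding X_Suc[OF \<omega>] st(1) by (rule vectorize_minus[OF E Z])
      \<comment> \<open>\<open>Z2\<close> is symmetric, so the transpose produced by
        \<open>kronecker_vectorize\<close> disappears.\<close>
      also have "vectorize m n (Z1' A G (S k \<omega>) * (X k \<omega> - Xs) * Z2 B (P k \<omega>))
          = K (Y k \<omega>) *\<^sub>v vectorize m n (X k \<omega> - Xs)"
        using kronecker_vectorize[OF z2(1) z1(1) E] z2(3) by (simp add: K_def Y_def)
      finally show ?case using Suc st(2) by (simp add: X_Suc[OF \<omega>])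
    qed
    define e where "e k = vec d (\<lambda>i. expectation (\<lambda>\<omega>. linear_iterates K v k (\<lambda>l. Y l \<omega>) $ i))" for k
    have ec: "e k \<in> carrier_vec d" for k by (simp add: e_def)
    have e0: "e 0 = v" using v by (intro eq_vecI) (auto simp: e_def prob_space)
    have eS: "e (Suc k) = T *\<^sub>v e k" for k
      unfolding e_def T_def EZ' by (rule expectation_linear_iterates[OF indepY D Km v Kb])
    have bound: "e k \<bullet> (H *\<^sub>v e k) \<le> (\<rho> ^ k)\<^sup>2 * (v \<bullet> (H *\<^sub>v v))" for k
    proof (induction k)
      case (Suc k)
      have "e (Suc k) \<bullet> (H *\<^sub>v e (Suc k)) \<le> \<rho>\<^sup>2 * (e k \<bullet> (H *\<^sub>v e k))"
        unfolding eS by (rule contr[OF ec])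
      also have "\<dots> \<le> \<rho>\<^sup>2 * ((\<rho> ^ k)\<^sup>2 * (v \<bullet> (H *\<^sub>v v)))"
        using Suc by (intro mult_left_mono) auto
      finally show ?case by (simp add: power_mult_distrib mult.assoc)
    qed (simp add: e0)
    \<comment> \<open>Stacking only relabels the entries, so it commutes with the entrywise
      expectation.\<close>
    have vec_e: "vectorize m n (mat_expectation M m n (\<lambda>\<omega>. X k \<omega> - Xs)) = e k" for k
    proof (rule eq_vecI)
      fix i assume "i < dim_vec (e k)"
      then have i: "i < n * m" by (simp add: e_def d_def)
      note i' = div_mod_less_product[OF i]
      have "(X k \<omega> - Xs) $$ (i mod m, i div m) = linear_iterates K v k (\<lambda>l. Y l \<omega>) $ i"
        if "\<omega> \<in> space M" for \<omega>
        using iter[OF that, of k] vectorize_index[OF i, of "X k \<omega> - Xs"] by simp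
      then have "expectation (\<lambda>\<omega>. (X k \<omega> - Xs) $$ (i mod m, i div m))
          = expectation (\<lambda>\<omega>. linear_iterates K v k (\<lambda>l. Y l \<omega>) $ i)"
        by (intro Bochner_Integration.integral_cong) auto
      then show "vectorize m n (mat_expectation M m n (\<lambda>\<omega>. X k \<omega> - Xs)) $ i = e k $ i"
        using i i' by (simp add: vectorize_index mat_expectation_index e_def d_def)
    qed (simp add: e_def d_def vectorize_def)
    have E0: "X0 - Xs \<in> carrier_mat m n" by (rule minus_carrier_mat[OF Xs(1)])
    have "wfrob_norm G (mat_expectation M m n (\<lambda>\<omega>. X (Suc k) \<omega> - Xs)) = sqrt (e (Suc k) \<bullet> (H *\<^sub>v e (Suc k)))"
      unfolding wfrob_norm_vectorize[OF Gc(1) mat_expectation_carrier] vec_e H_def ..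
    also have "\<dots> \<le> sqrt ((\<rho> ^ Suc k)\<^sup>2 * (v \<bullet> (H *\<^sub>v v)))" using bound by (rule real_sqrt_le_mono)
    also have "\<dots> = \<rho> ^ Suc k * sqrt (v \<bullet> (H *\<^sub>v v))"
      using \<rho>01 by (simp add: real_sqrt_mult del: power_Suc)
    \<comment> \<open>One factor \<open>\<rho>\<close> is given away here, using
      \<open>0 \<le> \<rho> \<le> 1\<close>, to reach the stated exponent.\<close>
    also have "\<dots> \<le> \<rho> ^ k * sqrt (v \<bullet> (H *\<^sub>v v))"
      using \<rho>01 psdD(3)[OF Hpsd v] by (intro mult_right_mono power_decreasing) auto
    also have "sqrt (v \<bullet> (H *\<^sub>v v)) = wfrob_norm G (X0 - Xs)"
      unfolding wfrob_norm_vectorize[OF Gc(1) E0] v_def H_def ..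
    finally show ?thesis .
  qed
  show ?thesis using first second by blast
qed

end
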